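(* Let $E$, $F$, $G$ be Banach spaces and let $\alpha$ be a reasonable crossnorm on $E\otimes E$. Let $\Pi=(\pi_n)_{n\in\mathbb{N}}$ be a sequence of partitions of $\mathbb{R}_{\ge0}$. Suppose that a càdlàg path $X\colon\mathbb{R}_{\ge0}\to E$ has strong (resp. weak) $\alpha$-tensor quadratic variation ${}^\alpha[X,X]$ and finite $2$-variation along $(\pi_n)$, and that $A\colon\mathbb{R}_{\ge0}\to F$ is a càdlàg path of finite variation. Suppose that $(\pi_n)$ satisfies Condition (C) for $(A,X)$ and approximates $(A,X)$ from the left. Let $f\colon F\times E\to G$ be a function such that: (i) the map $a\mapsto f(a,x)$ is Gâteaux differentiable on $F$ for all $x\in E$, and $D_af\colon F\times E\to\mathcal{L}_{\mathrm{c}}(F,G)$ is continuous; (ii) the map $x\mapsto f(a,x)$ is twice Gâteaux differentiable on $E$ for all $a\in F$, and $D_xf\colon F\times E\to\mathcal{L}_{\mathrm{c}}(E,G)$ is continuous; (iii) the second derivative of $f$ in $x$ induces a continuous function $D_x^2f\colon F\times E\to\mathcal{L}_{\mathrm{c}}(E\widehat\otimes_\alpha E,G)$. Then for every $t\ge0$ the Itô–Föllmer integral $$\int_0^tD_xf(A_{s-},X_{s-})\,\mathrm{d}X_s=\lim_{n\to\infty}\sum_{(r,s]\in\pi_n}D_xf(A_r,X_r)(X_{s\wedge t}-X_{r\wedge t})$$ exists in the norm (resp. weak) topology of $G$, and $$f(A_t,X_t)-f(A_0,X_0)=\int_0^tD_af(A_{s-},X_{s-})\,\mathrm{d}A^{\mathrm{c}}_s+\int_0^tD_xf(A_{s-},X_{s-})\,\mathrm{d}X_s+\frac12\int_0^tD_x^2f(A_{s-},X_{s-})\,\mathrm{d}\,{}^\alpha[X,X]^{\mathrm{c}}_s+\sum_{0<s\le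 t}\bigl\{\Delta f(A_s,X_s)-D_xf(A_{s-},X_{s-})\Delta X_s\bigr\}.$$
   Context: All Banach spaces are real. $\mathcal{L}(E,G)$ is the space of bounded linear maps. $\mathcal{L}_{\mathrm{c}}(E,G)$ is $\mathcal{L}(E,G)$ with the locally convex topology generated by the seminorms $\rho_K(L)=\inf\{C>0: \|Lx\|\le C\|x\|\ \forall x\in K\}$, $K$ ranging over all compact subsets of $E$. Gâteaux differentiability of $g$ at $x$ means that there is a bounded linear $L$ with $\lim_{t\to0}t^{-1}(g(x+th)-g(x))=Lh$ for all $h$; $D_af,D_xf$ are partial Gâteaux derivatives and $D_x^2f(a,x)$, the derivative of $D_xf(a,\cdot)\colon E\to\mathcal{L}(E,G)$, is regarded as a bounded bilinear map $E\times E\to G$. Condition (iii) means that for each $(a,x)$ there is an element of $\mathcal{L}(E\widehat\otimes_\alpha E,G)$, again denoted $D_x^2f(a,x)$, with $D_x^2f(a,x)(u\otimes v)=D_x^2f(a,x)(u,v)$ for all $u,v\in E$, and that it depends continuously on $(a,x)$. A norm $\alpha$ on the algebraic tensor product $E\otimes F$ is a reasonable crossnorm if $\alpha(x\otimes y)\le\|x\|\|y\|$ for all $x\in E,y\in F$ and $\|x^*\otimes y^*\|_{(E\otimes F,\alpha)^*}\le\|x^*\|\|y^*\|$ for all $x^*\in E^*,y^*\in F^*$; $E\widehat\otimes_\alpha F$ is the completion of $(E\otimes F,\alpha)$. Paths. A càdlàg path is right continuous on $[0,\infty)$ with left limits $X_{t-}$ at $t>0$; $\Delta X_t=X_t-X_{t-}$,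 $\Delta X_0=0$; $\Delta f(A_s,X_s)=f(A_s,X_s)-f(A_{s-},X_{s-})$. $D(X)=\{t:\Delta X_t\ne0\}$, $D_\varepsilon(X)=\{t:\|\Delta X_t\|\ge\varepsilon\}$, $J_\varepsilon(X)_t=\sum_{0<s\le t}\Delta X_s1_{D_\varepsilon(X)}(s)$. $F\times E$ carries the norm $\|\cdot\|_F+\|\cdot\|_E$. A path has finite variation if it has bounded variation on each compact interval; for a càdlàg path $g$ of finite variation, $g^{\mathrm{c}}_t=g_t-\sum_{0<s\le t}\Delta g_s$. Partitions. A partition of $\mathbb{R}_{\ge0}$ is a set $\pi=\{(t_i,t_{i+1}]:i\in\mathbb{N}\}$ with $0=t_0<t_1<\cdots\to\infty$. For $t>0$, $\pi(t)$ is the unique element of $\pi$ containing $t$, $\underline\pi(t)=\inf\pi(t)$, $\overline\pi(t)=\sup\pi(t)$. For a path $X$, $O_t^+(X;\pi)=\sup_{(r,s]\in\pi}\sup_{u,v\in(r,s]\cap[0,t]}\|X_u-X_v\|$. $(\pi_n)$ satisfies Condition (C) for a càdlàg path $X$ if: (C1) for all $t\ge0$, $\varepsilon>0$ there is $N$ such that for all $n\ge N$, $I\in\pi_n$, the set $I\cap[0,t]\cap D_\varepsilon(X)$ has at most one element; (C2) for all $s\in D(X)$ and $t\ge s$, $\lim_n\{X(\overline{\pi_n}(s)\wedge t)-X(\underline{\pi_n}(s)\wedge t)\}=\Delta X_s$; (C3) for all $t\ge0$, $\limsup_{\varepsilon\downarrow0}\limsup_{n\to\infty}O_t^+(X-J_\varepsilon(X);\pi_n)=0$.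 $(\pi_n)$ approximates $X$ from the left if $\lim_nX(\underline{\pi_n}(t))=X(t-)$ for all $t>0$. $X$ has strong (resp. weak) $\alpha$-tensor quadratic variation along $(\pi_n)$ if there is a càdlàg path ${}^\alpha[X,X]\colon\mathbb{R}_{\ge0}\to E\widehat\otimes_\alpha E$ of finite variation such that for all $t\ge0$: $\sum_{(r,s]\in\pi_n}(X_{s\wedge t}-X_{r\wedge t})^{\otimes2}\to{}^\alpha[X,X]_t$ in the norm (resp. weak) topology of $E\widehat\otimes_\alpha E$, and $\Delta{}^\alpha[X,X]_t=(\Delta X_t)^{\otimes2}$. $X$ has finite $2$-variation along $(\pi_n)$ if $\sup_n\sum_{(r,s]\in\pi_n}\|X_{s\wedge t}-X_{r\wedge t}\|^2<\infty$ for all $t\ge0$. Stieltjes integrals. For a càdlàg path $g$ of finite variation in a Banach space $H$ and $t\ge0$, the map $\varphi\mapsto\int_0^t\varphi\,\mathrm{d}g=\int_{(0,t]}\varphi\,\mathrm{d}g$ is defined on step functions $\varphi=1_{\{0\}}c_0+\sum_{i=1}^m1_{(a_i,b_i]}c_i$ ($c_i\in\mathcal{L}(H,G)$) by $\sum_ic_i(g_{b_i\wedge t}-g_{a_i\wedge t})$, and extended by linearity and continuity to all left-continuous functions with right limits (càglàd) $\varphi\colon\mathbb{R}_{\ge0}\to\mathcal{L}_{\mathrm{c}}(H,G)$, with respect to uniform convergence on compacts (seminorms $\sup_{s\le T}\rho_K(\varphi(s))$). *)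

theory Defs
  imports "HOL-Analysis.Analysis"
begin

section \<open>Algebraic tensor products\<close>

text \<open>
  A list \<open>[(x\<^sub>1, y\<^sub>1), \<dots>, (x\<^sub>n, y\<^sub>n)]\<close> represents the tensor \<open>\<Sum>i. x\<^sub>i \<otimes> y\<^sub>i\<close>; two lists are
  identified iff every bilinear form takes the same value on them. In other words, the tensor
  product is the span of the evaluations \<open>B \<mapsto> B x y\<close> in the algebraic dual of the space of
  bilinear forms. The usual universal property is \<open>tensor_universal\<close> below.
\<close>

definition tensor_eval :: "('a \<Rightarrow> 'b \<Rightarrow> 'c::real_vector) \<Rightarrow> ('a \<times> 'b) list \<Rightarrow> 'c" where
  "tensor_eval B xs = (\<Sum>(x, y)\<leftarrow>xs. B x y)"

definition tensor_rel ::
    "('a::real_vector \<times> 'b::real_vector) list \<Rightarrow> ('a \<times> 'b) list \<Rightarrow> bool" where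
  "tensor_rel xs ys \<longleftrightarrow>
     (\<forall>B :: 'a \<Rightarrow> 'b \<Rightarrow> real. bilinear B \<longrightarrow> tensor_eval B xs = tensor_eval B ys)"

quotient_type (overloaded) ('a, 'b) tensor =
    "('a::real_vector \<times> 'b::real_vector) list" / tensor_rel
  by (auto intro!: equivpI reflpI sympI transpI simp: tensor_rel_def)

lemma tensor_eval_Nil [simp]: "tensor_eval B [] = 0"
  by (simp add: tensor_eval_def)

lemma tensor_eval_Cons [simp]: "tensor_eval B ((x, y) # xs) = B x y + tensor_eval B xs"
  by (simp add: tensor_eval_def)

lemma tensor_eval_append [simp]: "tensor_eval B (xs @ ys) = tensor_eval B xs + tensor_eval B ys"
  by (simp add: tensor_eval_def)

lemma tensor_eval_scale [simp]:
  "bilinear B \<Longrightarrow> tensor_eval B (map (\<lambda>(x, y). (c *\<^sub>R x, y)) xs) = c *\<^sub>R tensor_eval B xs"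
  by (induction xs) (auto simp: bilinear_lmul scaleR_add_right)

lemma tensor_rel_neg: "tensor_rel (map (\<lambda>(x, y). ((-1) *\<^sub>R x, y)) xs @ xs) []"
  unfolding tensor_rel_def tensor_eval_append
proof (intro allI impI)
  fix B :: "'a \<Rightarrow> 'b \<Rightarrow> real" assume "bilinear B"
  then have "tensor_eval B (map (\<lambda>(x, y). ((-1) *\<^sub>R x, y)) xs) = (-1) *\<^sub>R tensor_eval B xs"
    by (rule tensor_eval_scale)
  then show "tensor_eval B (map (\<lambda>(x, y). ((-1) *\<^sub>R x, y)) xs) + tensor_eval B xs = tensor_eval B []"
    by (simp only: tensor_eval_Nil scaleR_minus1_left add.left_inverse)
qed

instantiation tensor :: (real_vector, real_vector) real_vector
begin

lift_definition zero_tensor :: "('a, 'b) tensor" is "[]" .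

lift_definition plus_tensor :: "('a, 'b) tensor \<Rightarrow> ('a, 'b) tensor \<Rightarrow> ('a, 'b) tensor" is "(@)"
  by (simp add: tensor_rel_def)

lift_definition scaleR_tensor :: "real \<Rightarrow> ('a, 'b) tensor \<Rightarrow> ('a, 'b) tensor"
  is "\<lambda>c. map (\<lambda>(x, y). (c *\<^sub>R x, y))"
  by (simp add: tensor_rel_def)

definition uminus_tensor :: "('a, 'b) tensor \<Rightarrow> ('a, 'b) tensor" where
  "uminus_tensor u = (-1) *\<^sub>R u"

definition minus_tensor :: "('a, 'b) tensor \<Rightarrow> ('a, 'b) tensor \<Rightarrow> ('a, 'b) tensor" where
  "minus_tensor u v = u + (- v)"

instance
proof
  fix u v w :: "('a, 'b) tensor" and c d :: real
  show "u + v + w = u + (v + w)"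
    by transfer (simp add: tensor_rel_def)
  show "u + v = v + u"
    by transfer (simp add: tensor_rel_def)
  show "0 + u = u"
    by transfer (simp add: tensor_rel_def)
  show "- u + u = 0"
    unfolding uminus_tensor_def by transfer (rule tensor_rel_neg)
  show "u - v = u + (- v)"
    by (simp add: minus_tensor_def)
  show "c *\<^sub>R (u + v) = c *\<^sub>R u + c *\<^sub>R v"
    by transfer (simp add: tensor_rel_def scaleR_add_right)
  show "(c + d) *\<^sub>R u = c *\<^sub>R u + d *\<^sub>R u"
    by transfer (simp add: tensor_rel_def distrib_right)
  show "c *\<^sub>R d *\<^sub>R u = (c * d) *\<^sub>R u"
    by transfer (simp add: tensor_rel_def del: map_map)
  show "1 *\<^sub>R u = u"
    by transfer (simp add: tensor_rel_def)
qed

end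

lift_definition tensor_of :: "'a::real_vector \<Rightarrow> 'b::real_vector \<Rightarrow> ('a, 'b) tensor"
    (infixr "\<otimes>" 70) is "\<lambda>x y. [(x, y)]" .

lemma bilinear_tensor_of: "bilinear (\<otimes>)"
  unfolding bilinear_def
proof (intro conjI allI linearI)
  fix x x' :: 'a and y y' :: 'b and c :: real
  show "x \<otimes> (y + y') = x \<otimes> y + x \<otimes> y'"
    by transfer (simp add: tensor_rel_def bilinear_radd)
  show "(x + x') \<otimes> y = x \<otimes> y + x' \<otimes> y"
    by transfer (simp add: tensor_rel_def bilinear_ladd)
  show "x \<otimes> c *\<^sub>R y = c *\<^sub>R (x \<otimes> y)"
    by transfer (simp add: tensor_rel_def bilinear_rmul bilinear_lmul)
  show "c *\<^sub>R x \<otimes> y = c *\<^sub>R (x \<otimes> y)"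
    by transfer (simp add: tensor_rel_def)
qed

lemma tensor_induct [case_names zero add]:
  assumes "P 0" and "\<And>x y u. P u \<Longrightarrow> P (x \<otimes> y + u)"
  shows "P u"
proof (induction u rule: tensor.abs_induct)
  fix xs :: "('a \<times> 'b) list"
  show "P (abs_tensor xs)"
  proof (induction xs)
    case Nil
    then show ?case using assms(1) by (simp add: zero_tensor.abs_eq)
  next
    case (Cons p xs)
    obtain x y where p: "p = (x, y)" by force
    have "abs_tensor (p # xs) = x \<otimes> y + abs_tensor xs"
      by (simp add: p tensor_of.abs_eq plus_tensor.abs_eq)
    then show ?case using assms(2) Cons by simp
  qed
qed

lemma tensor_rel_eval:
  fixes B :: "'a::real_vector \<Rightarrow> 'b::real_vector \<Rightarrow> 'c::real_vector"
  assumes rel: "tensor_rel xs ys" and B: "bilinear B"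
  shows "tensor_eval B xs = tensor_eval B ys"
proof (rule ccontr)
  let ?w = "tensor_eval B xs - tensor_eval B ys"
  assume "tensor_eval B xs \<noteq> tensor_eval B ys"
  then have "independent {?w}" by simp
  from linear_independent_extend[OF this, of "\<lambda>_. 1::real"]
  obtain g :: "'c \<Rightarrow> real" where g: "linear g" "g ?w = 1" by auto
  have eval: "g (tensor_eval B zs) = tensor_eval (\<lambda>x y. g (B x y)) zs" for zs
    by (induction zs) (auto simp: linear_0[OF g(1)] linear_add[OF g(1)])
  have "bilinear (\<lambda>x y. g (B x y))"
    unfolding bilinear_def
    using B[unfolded bilinear_def] linear_compose[OF _ g(1), unfolded o_def] by metis
  then have "g (tensor_eval B xs) = g (tensor_eval B ys)"
    using rel by (simp add: eval tensor_rel_def)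
  then show False using g by (simp add: linear_diff)
qed

lemma tensor_universal:
  fixes B :: "'a::real_vector \<Rightarrow> 'b::real_vector \<Rightarrow> 'c::real_vector"
  assumes B: "bilinear B"
  shows "\<exists>!L. linear L \<and> (\<forall>x y. L (x \<otimes> y) = B x y)"
proof -
  define L where "L u = tensor_eval B (rep_tensor u)" for u
  have L: "L (abs_tensor xs) = tensor_eval B xs" for xs
    unfolding L_def
    by (intro tensor_rel_eval B)
       (rule tensor.abs_eq_iff[THEN iffD1, OF Quotient3_abs_rep[OF Quotient3_tensor]])
  have add: "L (u + v) = L u + L v" for u v
    by (induction u rule: tensor.abs_induct, induction v rule: tensor.abs_induct)
       (simp add: plus_tensor.abs_eq L)
  have scale: "L (c *\<^sub>R u) = c *\<^sub>R L u" for c u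
    by (induction u rule: tensor.abs_induct) (simp add: scaleR_tensor.abs_eq L B)
  have lin: "linear L" by (intro linearI add scale)
  have pure: "L (x \<otimes> y) = B x y" for x y
    by (simp add: tensor_of.abs_eq L)
  show ?thesis
  proof (intro ex1I[of _ L] conjI allI lin pure)
    fix M :: "('a, 'b) tensor \<Rightarrow> 'c" assume M: "linear M \<and> (\<forall>x y. M (x \<otimes> y) = B x y)"
    show "M = L"
    proof
      fix u show "M u = L u"
        by (induction u rule: tensor_induct)
           (use M in \<open>simp_all add: linear_0 linear_add lin pure\<close>)
    qed
  qed
qed

lift_definition tensor_functional ::
    "('a::real_normed_vector \<Rightarrow>\<^sub>L real) \<Rightarrow> ('b::real_normed_vector \<Rightarrow>\<^sub>L real)
      \<Rightarrow> ('a, 'b) tensor \<Rightarrow> real"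
  is "\<lambda>\<phi> \<psi>. tensor_eval (\<lambda>x y. blinfun_apply \<phi> x * blinfun_apply \<psi> y)"
proof (rule tensor_rel_eval)
  fix \<phi> :: "'a \<Rightarrow>\<^sub>L real" and \<psi> :: "'b \<Rightarrow>\<^sub>L real"
  show "bilinear (\<lambda>x y. blinfun_apply \<phi> x * blinfun_apply \<psi> y)"
    by (auto simp: bilinear_def blinfun.bilinear_simps algebra_simps intro!: linearI)
qed


section \<open>Reasonable crossnorms and completions\<close>

definition is_norm :: "('v::real_vector \<Rightarrow> real) \<Rightarrow> bool" where
  "is_norm \<alpha> \<longleftrightarrow> (\<forall>u. \<alpha> u = 0 \<longleftrightarrow> u = 0) \<and> (\<forall>u v. \<alpha> (u + v) \<le> \<alpha> u + \<alpha> v)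
     \<and> (\<forall>c u. \<alpha> (c *\<^sub>R u) = \<bar>c\<bar> * \<alpha> u)"

text \<open>The value is \<open>\<infinity>\<close> for a functional that is not bounded with respect to \<open>\<alpha>\<close>.\<close>

definition dual_norm :: "('v \<Rightarrow> real) \<Rightarrow> ('v \<Rightarrow> real) \<Rightarrow> ereal" where
  "dual_norm \<alpha> \<Phi> = (SUP u\<in>{u. \<alpha> u \<le> 1}. ereal \<bar>\<Phi> u\<bar>)"

definition reasonable_crossnorm ::
    "(('a::real_normed_vector, 'b::real_normed_vector) tensor \<Rightarrow> real) \<Rightarrow> bool" where
  "reasonable_crossnorm \<alpha> \<longleftrightarrow> is_norm \<alpha>
     \<and> (\<forall>x y. \<alpha> (x \<otimes> y) \<le> norm x * norm y)
     \<and> (\<forall>\<phi> \<psi>. dual_norm \<alpha> (tensor_functional \<phi> \<psi>) \<le> ereal (norm \<phi> * norm \<psi>))"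

text \<open>
  The completion of \<open>(V, \<alpha>)\<close> depends on the term \<open>\<alpha>\<close>, so it cannot be a type constructor. It is
  given by a Banach space \<^typ>\<open>'h\<close> and an isometric linear map \<open>\<iota>\<close> from \<open>V\<close> onto a dense subspace;
  this determines it up to isometric isomorphism over \<open>V\<close>.
\<close>

definition is_completion :: "('v::real_vector \<Rightarrow> real) \<Rightarrow> ('v \<Rightarrow> 'h::banach) \<Rightarrow> bool" where
  "is_completion \<alpha> \<iota> \<longleftrightarrow> linear \<iota> \<and> (\<forall>u. norm (\<iota> u) = \<alpha> u) \<and> closure (range \<iota>) = UNIV"


section \<open>Topologies\<close>

definition rho :: "'a::real_normed_vector set \<Rightarrow> ('a \<Rightarrow>\<^sub>L 'b::real_normed_vector) \<Rightarrow> real" where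
  "rho K L = Inf {C. 0 < C \<and> (\<forall>x\<in>K. norm (blinfun_apply L x) \<le> C * norm x)}"

definition Lc_topology :: "('a::real_normed_vector \<Rightarrow>\<^sub>L 'b::real_normed_vector) topology" where
  "Lc_topology = topology_generated_by
     {{L. rho K (L - L\<^sub>0) < e} | K L\<^sub>0 e. compact K \<and> 0 < e}"

definition weak_topology :: "'a::real_normed_vector topology" where
  "weak_topology = topology_generated_by
     {blinfun_apply \<phi> -` U | (\<phi> :: 'a \<Rightarrow>\<^sub>L real) U. open U}"

text \<open>
  "Strong (resp. weak)" statements carry a parameter of this type, which selects the norm
  (resp. weak) topology in hypothesis and conclusion simultaneously.
\<close>

datatype mode = Strong | Weak

primrec mode_topology :: "mode \<Rightarrow> 'a::real_normed_vector topology" where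
  "mode_topology Strong = euclidean"
| "mode_topology Weak = weak_topology"


section \<open>Gateaux derivatives\<close>

definition has_gateaux_derivative ::
    "('a::real_normed_vector \<Rightarrow> 'b::real_normed_vector) \<Rightarrow> ('a \<Rightarrow>\<^sub>L 'b) \<Rightarrow> 'a \<Rightarrow> bool" where
  "has_gateaux_derivative g L x \<longleftrightarrow>
     (\<forall>h. ((\<lambda>t::real. inverse t *\<^sub>R (g (x + t *\<^sub>R h) - g x)) \<longlongrightarrow> blinfun_apply L h) (at 0))"


section \<open>Paths\<close>

text \<open>
  Paths on \<open>[0, \<infinity>)\<close> are functions on \<^typ>\<open>real\<close> whose values at negative arguments are irrelevant.
\<close>

definition cadlag :: "(real \<Rightarrow> 'a::topological_space) \<Rightarrow> bool" where
  "cadlag X \<longleftrightarrow> (\<forall>t\<ge>0. (X \<longlongrightarrow> X t) (at_right t)) \<and> (\<forall>t>0. \<exists>l. (X \<longlongrightarrow> l) (at_left t))"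

text \<open>The convention \<open>X\<^sub>0\<^sub>- = X\<^sub>0\<close> corresponds to \<open>\<Delta>X\<^sub>0 = 0\<close>.\<close>

definition left_lim :: "(real \<Rightarrow> 'a::t2_space) \<Rightarrow> real \<Rightarrow> 'a" where
  "left_lim X t = (if 0 < t then Lim (at_left t) X else X t)"

definition jump :: "(real \<Rightarrow> 'a::real_normed_vector) \<Rightarrow> real \<Rightarrow> 'a" where
  "jump X t = X t - left_lim X t"

definition finite_variation :: "(real \<Rightarrow> 'a::real_normed_vector) \<Rightarrow> bool" where
  "finite_variation g \<longleftrightarrow>
     (\<forall>T\<ge>0. \<exists>C. \<forall>(n::nat) \<tau>. mono \<tau> \<and> range \<tau> \<subseteq> {0..T} \<longrightarrow>
        (\<Sum>i<n. norm (g (\<tau> (Suc i)) - g (\<tau> i))) \<le> C)"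

definition cont_part :: "(real \<Rightarrow> 'a::real_normed_vector) \<Rightarrow> real \<Rightarrow> 'a" where
  "cont_part g t = g t - (\<Sum>\<^sub>\<infinity>s\<in>{0<..t}. jump g s)"


section \<open>Partitions\<close>

text \<open>A partition is encoded by the set of pairs \<open>(r, s)\<close> of end points of its intervals \<open>(r, s]\<close>.\<close>

definition is_partition :: "(real \<times> real) set \<Rightarrow> bool" where
  "is_partition P \<longleftrightarrow> (\<exists>\<tau> :: nat \<Rightarrow> real. \<tau> 0 = 0 \<and> strict_mono \<tau>
     \<and> filterlim \<tau> at_top sequentially \<and> P = range (\<lambda>i. (\<tau> i, \<tau> (Suc i))))"

definition cell :: "(real \<times> real) set \<Rightarrow> real \<Rightarrow> real \<times> real" where
  "cell P t = (THE I. I \<in> P \<and> t \<in> {fst I<..snd I})"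

abbreviation lower_pt :: "(real \<times> real) set \<Rightarrow> real \<Rightarrow> real" where
  "lower_pt P t \<equiv> fst (cell P t)"

abbreviation upper_pt :: "(real \<times> real) set \<Rightarrow> real \<Rightarrow> real" where
  "upper_pt P t \<equiv> snd (cell P t)"

text \<open>
  All summands considered below involve an increment \<open>X (min s t) - X (min r t)\<close> and hence vanish
  for \<open>t \<le> r\<close>. Only the finitely many intervals with \<open>r < t\<close> are kept, so that the sum is finite.
\<close>

definition partition_sum ::
    "(real \<times> real) set \<Rightarrow> real \<Rightarrow> (real \<Rightarrow> real \<Rightarrow> 'a::comm_monoid_add) \<Rightarrow> 'a" where
  "partition_sum P t h = (\<Sum>(r, s)\<in>{(r, s). (r, s) \<in> P \<and> r < t}. h r s)"

text \<open>
  The norm \<open>N\<close> is an argument because \<^typ>\<open>'f \<times> 'e\<close> is to carry the norm \<open>\<parallel>a\<parallel> + \<parallel>x\<parallel>\<close> rather than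
  the (equivalent) Euclidean combination that is the library's norm on products.
\<close>

definition sum_norm :: "'a::real_normed_vector \<times> 'b::real_normed_vector \<Rightarrow> real" where
  "sum_norm z = norm (fst z) + norm (snd z)"

definition jump_times :: "(real \<Rightarrow> 'a::real_normed_vector) \<Rightarrow> real set" where
  "jump_times X = {t. 0 \<le> t \<and> jump X t \<noteq> 0}"

definition big_jump_times ::
    "('a \<Rightarrow> real) \<Rightarrow> real \<Rightarrow> (real \<Rightarrow> 'a::real_normed_vector) \<Rightarrow> real set" where
  "big_jump_times N \<epsilon> X = {t. 0 \<le> t \<and> \<epsilon> \<le> N (jump X t)}"

definition big_jump_part ::
    "('a \<Rightarrow> real) \<Rightarrow> real \<Rightarrow> (real \<Rightarrow> 'a::real_normed_vector) \<Rightarrow> real \<Rightarrow> 'a" where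
  "big_jump_part N \<epsilon> X t = (\<Sum>s\<in>{0<..t} \<inter> big_jump_times N \<epsilon> X. jump X s)"

definition osc :: "('a \<Rightarrow> real) \<Rightarrow> (real \<Rightarrow> 'a::real_normed_vector)
    \<Rightarrow> (real \<times> real) set \<Rightarrow> real \<Rightarrow> ennreal" where
  "osc N X P t = (SUP (r, s)\<in>P. SUP u\<in>{r<..s} \<inter> {0..t}. SUP v\<in>{r<..s} \<inter> {0..t}.
     ennreal (N (X u - X v)))"

definition condition_C :: "('a \<Rightarrow> real) \<Rightarrow> (nat \<Rightarrow> (real \<times> real) set)
    \<Rightarrow> (real \<Rightarrow> 'a::real_normed_vector) \<Rightarrow> bool" where
  "condition_C N \<pi> X \<longleftrightarrow>
     (\<forall>t\<ge>0. \<forall>\<epsilon>>0. \<exists>n\<^sub>0. \<forall>n\<ge>n\<^sub>0. \<forall>(r, s)\<in>\<pi> n.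
        \<forall>u \<in> {r<..s} \<inter> {0..t} \<inter> big_jump_times N \<epsilon> X.
        \<forall>v \<in> {r<..s} \<inter> {0..t} \<inter> big_jump_times N \<epsilon> X. u = v)
   \<and> (\<forall>s\<in>jump_times X. \<forall>t\<ge>s.
        (\<lambda>n. X (min (upper_pt (\<pi> n) s) t) - X (min (lower_pt (\<pi> n) s) t)) \<longlonglongrightarrow> jump X s)
   \<and> (\<forall>t\<ge>0. Limsup (at_right 0)
        (\<lambda>\<epsilon>. limsup (\<lambda>n. osc N (\<lambda>u. X u - big_jump_part N \<epsilon> X u) (\<pi> n) t)) = 0)"

definition approximates_from_left ::
    "(nat \<Rightarrow> (real \<times> real) set) \<Rightarrow> (real \<Rightarrow> 'a::t2_space) \<Rightarrow> bool" where
  "approximates_from_left \<pi> X \<longleftrightarrow> (\<forall>t>0. (\<lambda>n. X (lower_pt (\<pi> n) t)) \<longlonglongrightarrow> left_lim X t)"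


section \<open>Quadratic variation\<close>

text \<open>\<open>\<iota>\<close> is the embedding of the algebraic tensor product into its completion.\<close>

definition tensor_quadratic_variation ::
    "mode \<Rightarrow> (('e::real_normed_vector, 'e) tensor \<Rightarrow> 'h::real_normed_vector)
      \<Rightarrow> (nat \<Rightarrow> (real \<times> real) set) \<Rightarrow> (real \<Rightarrow> 'e) \<Rightarrow> (real \<Rightarrow> 'h) \<Rightarrow> bool" where
  "tensor_quadratic_variation m \<iota> \<pi> X Q \<longleftrightarrow> cadlag Q \<and> finite_variation Q
     \<and> (\<forall>t\<ge>0.
          limitin (mode_topology m)
            (\<lambda>n. partition_sum (\<pi> n) t (\<lambda>r s.
               \<iota> ((X (min s t) - X (min r t)) \<otimes> (X (min s t) - X (min r t)))))
            (Q t) sequentially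
        \<and> jump Q t = \<iota> (jump X t \<otimes> jump X t))"

definition finite_2_variation ::
    "(nat \<Rightarrow> (real \<times> real) set) \<Rightarrow> (real \<Rightarrow> 'e::real_normed_vector) \<Rightarrow> bool" where
  "finite_2_variation \<pi> X \<longleftrightarrow>
     (\<forall>t\<ge>0. bdd_above (range (\<lambda>n.
        partition_sum (\<pi> n) t (\<lambda>r s. (norm (X (min s t) - X (min r t)))\<^sup>2))))"


section \<open>Stieltjes integrals of operator-valued caglad integrands\<close>

text \<open>
  \<open>(c\<^sub>0, [(a\<^sub>1, b\<^sub>1, c\<^sub>1), \<dots>])\<close> represents the step function \<open>1\<^bsub>{0}\<^esub> c\<^sub>0 + \<Sum>i. 1\<^bsub>(a\<^sub>i, b\<^sub>i]\<^esub> c\<^sub>i\<close>.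
\<close>

type_synonym ('h, 'g) step =
  "('h \<Rightarrow>\<^sub>L 'g) \<times> (real \<times> real \<times> ('h \<Rightarrow>\<^sub>L 'g)) list"

definition is_step :: "('h::real_normed_vector, 'g::real_normed_vector) step \<Rightarrow> bool" where
  "is_step \<sigma> \<longleftrightarrow> (\<forall>(a, b, c)\<in>set (snd \<sigma>). 0 \<le> a \<and> a < b)"

definition step_fun ::
    "('h::real_normed_vector, 'g::real_normed_vector) step \<Rightarrow> real \<Rightarrow> 'h \<Rightarrow>\<^sub>L 'g" where
  "step_fun \<sigma> s = indicat_real {0} s *\<^sub>R fst \<sigma>
     + (\<Sum>(a, b, c)\<leftarrow>snd \<sigma>. indicat_real {a<..b} s *\<^sub>R c)"

definition step_integral :: "(real \<Rightarrow> 'h::real_normed_vector) \<Rightarrow> real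
    \<Rightarrow> ('h, 'g::real_normed_vector) step \<Rightarrow> 'g" where
  "step_integral g t \<sigma> = (\<Sum>(a, b, c)\<leftarrow>snd \<sigma>. blinfun_apply c (g (min b t) - g (min a t)))"

definition caglad_Lc ::
    "(real \<Rightarrow> 'h::real_normed_vector \<Rightarrow>\<^sub>L 'g::real_normed_vector) \<Rightarrow> bool" where
  "caglad_Lc \<phi> \<longleftrightarrow> (\<forall>t>0. limitin Lc_topology \<phi> (\<phi> t) (at_left t))
     \<and> (\<forall>t\<ge>0. \<exists>L. limitin Lc_topology \<phi> L (at_right t))"

text \<open>
  The trace on the step functions of the neighbourhood filter of \<open>\<phi>\<close>, for the topology given by
  the seminorms \<open>sup\<^bsub>s \<le> T\<^esub> \<rho>\<^sub>K (\<phi> s)\<close>. Extending the integral by continuity from step functions to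
  \<open>\<phi>\<close> means taking its limit along this filter; properness of the filter expresses that \<open>\<phi>\<close> is in
  the closure of the step functions, which makes the limit unique.
\<close>

definition step_approx :: "(real \<Rightarrow> 'h::real_normed_vector \<Rightarrow>\<^sub>L 'g::real_normed_vector)
    \<Rightarrow> ('h, 'g) step filter" where
  "step_approx \<phi> = (INF (K, T, \<delta>)\<in>{(K, T, \<delta>). compact K \<and> 0 \<le> T \<and> 0 < \<delta>}.
     principal {\<sigma>. is_step \<sigma> \<and> (\<forall>s\<in>{0..T}. rho K (\<phi> s - step_fun \<sigma> s) < \<delta>)})"

definition has_stieltjes_integral ::
    "(real \<Rightarrow> 'h::real_normed_vector \<Rightarrow>\<^sub>L 'g::real_normed_vector)
      \<Rightarrow> (real \<Rightarrow> 'h) \<Rightarrow> real \<Rightarrow> 'g \<Rightarrow> bool" where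
  "has_stieltjes_integral \<phi> g t I \<longleftrightarrow> caglad_Lc \<phi> \<and> step_approx \<phi> \<noteq> bot
     \<and> (step_integral g t \<longlongrightarrow> I) (step_approx \<phi>)"

end

theory Submission
  imports Defs
begin

text \<open>
  Write \<open>Z = (A, X)\<close>. On a partition interval with increments \<open>\<delta>A\<close>, \<open>\<delta>X\<close>, a Taylor expansion at the
  left end point gives
  \<open>\<delta>f(Z) = D\<^sub>af(Z) \<delta>A + D\<^sub>xf(Z) \<delta>X + 1/2 D\<^sub>x\<^sup>2f(Z) (\<delta>X \<otimes> \<delta>X) + remainder\<close>.
  The left-hand sides add up to \<open>f(Z\<^sub>t) - f(Z\<^sub>0)\<close>. Hence the sums that define the Ito-Foellmer integral
  converge as soon as the sums of the other three terms on the right do, and the formula is read off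
  from the limits.

  The first and the third term are left-point sums \<open>\<Sum> \<Phi>(Z\<^sub>r) h(r, s)\<close> with an integrand that is
  continuous along \<open>Z\<close> and with increments \<open>h(r, s)\<close> that add up, in the limit, to the increments of
  a finite variation path \<open>G\<close>, namely \<open>A\<close> or the quadratic variation \<open>Q\<close>. They converge to
  \<open>\<integral> \<Phi>(Z\<^sub>s\<^sub>-) dG\<^sub>s\<close> by \<open>left_point_sums_converge\<close>: freeze \<open>\<Phi>(Z)\<close> at finitely many times \<open>a\<^sub>k\<close> between
  which \<open>Z\<close> oscillates little, and use the convergence of the sums of \<open>h\<close> between the \<open>a\<^sub>k\<close>. The mesh
  of the partitions may stay away from zero, so the interval that straddles \<open>a\<^sub>k\<close> needs care. It does
  not matter in the limit if the right end points of the intervals around \<open>a\<^sub>k\<close> tend to \<open>a\<^sub>k\<close>; call such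
  times good. A time that is not good starts a stretch on which \<open>Z\<close> stays at its left limit
  (\<open>path_constant_of_upper_pt_not_convergent\<close>, by approximation from the left). The successive times
  at which \<open>Z\<close> leaves a ball around its value at the preceding time never start such a stretch, so
  they are good (\<open>cadlag_subdivision\<close>).

  The remainder sums converge in norm to the sum of the Taylor remainders from \<open>Z\<^sub>s\<^sub>-\<close> to \<open>Z\<^sub>s\<close> over all
  jumps (\<open>remainder_sums_converge\<close>). Intervals without a big jump have small increments, by the
  oscillation condition (C3), and contribute at most a small multiple of the variation of \<open>A\<close> plus the
  \<open>2\<close>-variation of \<open>X\<close>. By (C1) the finitely many big jumps eventually lie in different intervals. The
  values of \<open>Z\<close> at the end points of such an interval tend to \<open>Z\<^sub>s\<^sub>-\<close> and \<open>Z\<^sub>s\<close>, since jump times are good.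

  Finally, integrals against \<open>A\<close> and \<open>Q\<close> are integrals against the continuous parts plus jump sums.
  Since \<open>\<Delta>Q = \<Delta>X \<otimes> \<Delta>X\<close>, the jump sums cancel the terms with \<open>D\<^sub>af\<close> and \<open>D\<^sub>x\<^sup>2f\<close> in the remainders and
  leave \<open>\<Delta>f(Z) - D\<^sub>xf(Z\<^sub>-) \<Delta>X\<close>.

  Continuity of the derivatives in the topology of compact sets suffices everywhere, because
  operators are only ever compared on increments and jumps of cadlag paths on \<open>[0, t]\<close>, which lie in a
  compact set. The seminorms are homogeneous in the argument, so an operator that is small on that set
  maps increments to small multiples of their norms, and these norms have bounded sums.
\<close>


section \<open>Cadlag paths\<close>

lemma cadlag_tendsto_right: "cadlag X \<Longrightarrow> 0 \<le> t \<Longrightarrow> (X \<longlongrightarrow> X t) (at_right t)"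
  by (simp add: cadlag_def)

lemma left_lim_eqI:
  fixes X :: "real \<Rightarrow> 'a::t2_space"
  shows "0 < t \<Longrightarrow> (X \<longlongrightarrow> l) (at_left t) \<Longrightarrow> left_lim X t = l"
  by (simp add: left_lim_def tendsto_Lim)

lemma cadlag_tendsto_left:
  fixes X :: "real \<Rightarrow> 'a::t2_space"
  shows "cadlag X \<Longrightarrow> 0 < t \<Longrightarrow> (X \<longlongrightarrow> left_lim X t) (at_left t)"
  using left_lim_eqI by (fastforce simp: cadlag_def)

lemma left_lim_0 [simp]: "left_lim X 0 = X 0"
  by (simp add: left_lim_def)

lemma left_lim_Pair:
  fixes A :: "real \<Rightarrow> 'a::t2_space" and X :: "real \<Rightarrow> 'b::t2_space"
  assumes "cadlag A" "cadlag X"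
  shows "left_lim (\<lambda>s. (A s, X s)) t = (left_lim A t, left_lim X t)"
proof (cases "0 < t")
  case True
  then show ?thesis
    by (intro left_lim_eqI tendsto_Pair cadlag_tendsto_left assms)
qed (simp add: left_lim_def)

lemma cadlag_Pair:
  fixes A :: "real \<Rightarrow> 'a::t2_space" and X :: "real \<Rightarrow> 'b::t2_space"
  assumes "cadlag A" "cadlag X"
  shows "cadlag (\<lambda>s. (A s, X s))"
  unfolding cadlag_def
proof (intro conjI allI impI)
  fix t :: real assume t: "0 \<le> t"
  show "((\<lambda>s. (A s, X s)) \<longlongrightarrow> (A t, X t)) (at_right t)"
    by (intro tendsto_Pair cadlag_tendsto_right assms t)
next
  fix t :: real assume t: "0 < t"
  show "\<exists>l. ((\<lambda>s. (A s, X s)) \<longlongrightarrow> l) (at_left t)"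
    using tendsto_Pair[OF assms[THEN cadlag_tendsto_left, OF t]] by blast
qed

lemma left_lim_in_closed:
  fixes X :: "real \<Rightarrow> 'a::t2_space"
  assumes X: "cadlag X" and C: "closed C" and a: "0 \<le> a" "a < s" and in_C: "\<And>u. a < u \<Longrightarrow> u < s \<Longrightarrow> X u \<in> C"
  shows "left_lim X s \<in> C"
proof (rule Lim_in_closed_set[OF C])
  show "(X \<longlongrightarrow> left_lim X s) (at_left s)"
    using a by (intro cadlag_tendsto_left X) auto
  show "eventually (\<lambda>u. X u \<in> C) (at_left s)"
    unfolding eventually_at_left_field using in_C a by (intro exI[of _ a]) auto
qed auto

lemma left_lim_tendsto_left:
  fixes X :: "real \<Rightarrow> 'a::metric_space"
  assumes X: "cadlag X" and t: "0 < t"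
  shows "(left_lim X \<longlongrightarrow> left_lim X t) (at_left t)"
proof (rule tendstoI)
  fix e :: real assume e: "0 < e"
  have "eventually (\<lambda>u. dist (X u) (left_lim X t) < e / 2) (at_left t)"
    using tendstoD[OF cadlag_tendsto_left[OF X t], of "e / 2"] e by simp
  then obtain b where b: "b < t" "\<And>u. b < u \<Longrightarrow> u < t \<Longrightarrow> dist (X u) (left_lim X t) < e / 2"
    by (auto simp: eventually_at_left_field)
  have "left_lim X s \<in> cball (left_lim X t) (e / 2)" if "max b 0 < s" "s < t" for s
    by (rule left_lim_in_closed[OF X, of _ "max b 0"])
       (use that b in \<open>auto simp: dist_commute less_eq_real_def\<close>)
  then show "eventually (\<lambda>s. dist (left_lim X s) (left_lim X t) < e) (at_left t)"
    unfolding eventually_at_left_field using b t e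
    by (intro exI[of _ "max b 0"]) (fastforce simp: dist_commute)
qed

lemma left_lim_tendsto_right:
  fixes X :: "real \<Rightarrow> 'a::metric_space"
  assumes X: "cadlag X" and t: "0 \<le> t"
  shows "(left_lim X \<longlongrightarrow> X t) (at_right t)"
proof (rule tendstoI)
  fix e :: real assume e: "0 < e"
  have "eventually (\<lambda>u. dist (X u) (X t) < e / 2) (at_right t)"
    using tendstoD[OF cadlag_tendsto_right[OF X t], of "e / 2"] e by simp
  then obtain b where b: "b > t" "\<And>u. t < u \<Longrightarrow> u < b \<Longrightarrow> dist (X u) (X t) < e / 2"
    by (auto simp: eventually_at_right_field)
  have "left_lim X s \<in> cball (X t) (e / 2)" if "t < s" "s < b" for s
    by (rule left_lim_in_closed[OF X, of _ t])
       (use that b t in \<open>auto simp: dist_commute less_eq_real_def\<close>)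
  then show "eventually (\<lambda>s. dist (left_lim X s) (X t) < e) (at_right t)"
    unfolding eventually_at_right_field using b t e
    by (intro exI[of _ b]) (fastforce simp: dist_commute)
qed

text \<open>
  The breakpoints are the successive times at which the path has moved by more than \<open>\<eta>\<close> away from
  its value at the preceding breakpoint. Left limits rule out an accumulation of such times. A
  breakpoint from which the path starts with a stretch frozen at its left limit cannot occur, since
  the path would still be within \<open>\<eta>\<close> after it; this is what makes all interior breakpoints good.
\<close>

lemma cadlag_subdivision:
  fixes Z :: "real \<Rightarrow> 'a::real_normed_vector"
  assumes Z: "cadlag Z" and t: "0 \<le> t" and \<eta>: "0 < \<eta>"
    and flat: "\<And>u. 0 < u \<Longrightarrow> u < t \<Longrightarrow> \<not> good u \<Longrightarrow> \<exists>v>u. \<forall>w\<in>{u..<v}. Z w = left_lim Z u"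
  obtains N :: nat and a where "a 0 = 0" "a N = t" "\<And>k. k < N \<Longrightarrow> a k < a (Suc k)"
    "\<And>k s. k < N \<Longrightarrow> a k \<le> s \<Longrightarrow> s < a (Suc k) \<Longrightarrow> norm (Z s - Z (a k)) \<le> \<eta>"
    "\<And>k. 0 < k \<Longrightarrow> k < N \<Longrightarrow> good (a k)"
proof -
  \<comment> \<open>\<open>nxt x\<close> is the time, at most \<open>t\<close>, at which the path started at \<open>x\<close> leaves the closed \<open>\<eta>\<close>-ball around \<open>Z x\<close>.\<close>
  define W where "W x = {b \<in> {x..t}. \<forall>s\<in>{x..<b}. norm (Z s - Z x) \<le> \<eta>}" for x
  define nxt where "nxt x = Sup (W x)" for x
  have bdd: "bdd_above (W x)" for x
    by (rule bdd_aboveI[of _ t]) (auto simp: W_def)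
  have xW: "x \<in> W x" if "x \<le> t" for x
    using that by (auto simp: W_def)
  have le: "nxt x \<le> t" if "x \<le> t" for x
    unfolding nxt_def using xW[OF that] by (intro cSup_least) (auto simp: W_def)
  have close: "norm (Z s - Z x) \<le> \<eta>" if "x \<le> t" "x \<le> s" "s < nxt x" for x s
  proof -
    have "\<exists>b\<in>W x. s < b"
      using less_cSup_iff[OF _ bdd, of x s] xW[OF that(1)] that(3) unfolding nxt_def by auto
    then obtain b where "b \<in> W x" "s < b" by auto
    then show ?thesis using that by (auto simp: W_def)
  qed
  have ge: "b \<le> nxt x" if "b \<in> W x" for b x
    unfolding nxt_def using that by (intro cSup_upper bdd)
  have less: "x < nxt x" if x: "0 \<le> x" "x < t" for x
  proof -
    have "eventually (\<lambda>u. dist (Z u) (Z x) < \<eta>) (at_right x)"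
      by (rule tendstoD[OF cadlag_tendsto_right[OF Z x(1)] \<eta>])
    then obtain b where b: "b > x" "\<And>u. x < u \<Longrightarrow> u < b \<Longrightarrow> dist (Z u) (Z x) < \<eta>"
      by (auto simp: eventually_at_right_field)
    have "norm (Z u - Z x) \<le> \<eta>" if "x \<le> u" "u < b" for u
      using b(2)[of u] that \<eta> by (cases "u = x") (auto simp: dist_norm)
    then have "min b t \<in> W x"
      using b x by (auto simp: W_def)
    from ge[OF this] show ?thesis using b x by auto
  qed
  have nxt_good: "good (nxt x)" if x: "0 \<le> x" "x < t" "nxt x < t" for x
  proof (rule ccontr)
    assume "\<not> good (nxt x)"
    then obtain v where v: "v > nxt x" "\<forall>w\<in>{nxt x..<v}. Z w = left_lim Z (nxt x)"
      using flat[of "nxt x"] less[OF x(1,2)] x by auto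
    have "left_lim Z (nxt x) \<in> cball (Z x) \<eta>"
      by (rule left_lim_in_closed[OF Z, of _ x])
         (use close[of x] less[OF x(1,2)] x in \<open>auto simp: dist_norm norm_minus_commute\<close>)
    then have "norm (Z w - Z x) \<le> \<eta>" if "x \<le> w" "w < v" for w
      using that close[of x w] v(2) x by (cases "w < nxt x") (auto simp: dist_norm norm_minus_commute)
    then have "min v t \<in> W x"
      using x v less[OF x(1,2)] by (auto simp: W_def)
    from ge[OF this] show False using x v by auto
  qed
  define a where "a k = (nxt ^^ k) 0" for k
  have a0: "a 0 = 0" and aS: "a (Suc k) = nxt (a k)" for k
    by (auto simp: a_def)
  have a_le: "a k \<le> t" for k
    by (induction k) (auto simp: a0 aS t le)
  have nxt_ge: "x \<le> nxt x" if "x \<le> t" for x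
    using ge[OF xW[OF that]] .
  have inc: "a k \<le> a (Suc k)" for k
    by (simp add: aS nxt_ge a_le)
  have a_ge: "0 \<le> a k" for k
    by (induction k) (use inc in \<open>auto simp: a0 intro: order_trans\<close>)
  \<comment> \<open>Otherwise the times increase to some \<open>u\<close>. Near the left limit at \<open>u\<close> a single step already reaches \<open>u\<close>.\<close>
  have "\<exists>k. a k = t"
  proof (rule ccontr)
    assume "\<nexists>k. a k = t"
    then have lt: "a k < t" for k
      using a_le[of k] by (auto simp: less_eq_real_def)
    have sinc: "a k < a (Suc k)" for k
      using less[OF a_ge lt] by (simp add: aS)
    define u where "u = (SUP k. a k)"
    have bd: "bdd_above (range a)"
      using a_le by (auto intro!: bdd_aboveI[of _ t])
    have lim: "a \<longlonglongrightarrow> u"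
      unfolding u_def by (rule LIMSEQ_incseq_SUP[OF bd]) (auto intro: incseq_SucI inc)
    have upper: "a k < u" for k
      using sinc[of k] cSUP_upper[OF UNIV_I bd, of "Suc k"] by (simp add: u_def)
    have u: "0 < u" "u \<le> t"
      using upper[of 0] a0 a_le by (auto simp: u_def intro!: cSUP_least)
    have "eventually (\<lambda>s. dist (Z s) (left_lim Z u) < \<eta> / 2) (at_left u)"
      using tendstoD[OF cadlag_tendsto_left[OF Z u(1)], of "\<eta> / 2"] \<eta> by simp
    then obtain b where b: "b < u" "\<And>s. b < s \<Longrightarrow> s < u \<Longrightarrow> dist (Z s) (left_lim Z u) < \<eta> / 2"
      by (auto simp: eventually_at_left_field)
    obtain k where k: "b < a k"
      using order_tendstoD(1)[OF lim b(1)] by (auto simp: eventually_sequentially)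
    have "norm (Z s - Z (a k)) \<le> \<eta>" if "a k \<le> s" "s < u" for s
      using b(2)[of s] b(2)[of "a k"] upper[of k] k that
        dist_triangle_half_l[of "Z s" "left_lim Z u" \<eta> "Z (a k)"]
      by (auto simp: dist_norm norm_minus_commute)
    then have "u \<in> W (a k)"
      using upper[of k] u by (auto simp: W_def)
    then have "u \<le> a (Suc k)"
      using ge by (simp add: aS)
    then show False using upper[of "Suc k"] by simp
  qed
  define N where "N = (LEAST k. a k = t)"
  have N: "a N = t"
    unfolding N_def by (rule LeastI_ex) fact
  have N_least: "a k < t" if "k < N" for k
    using not_less_Least[OF that[unfolded N_def]] a_le[of k] by simp
  show ?thesis
  proof (rule that[OF a0 N])
    show "a k < a (Suc k)" if "k < N" for k
      using less[OF a_ge N_least[OF that]] by (simp add: aS)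
    show "norm (Z s - Z (a k)) \<le> \<eta>" if "k < N" "a k \<le> s" "s < a (Suc k)" for k s
      using close[of "a k" s] that a_le by (simp add: aS)
    show "good (a k)" if "0 < k" "k < N" for k
      using nxt_good[of "a (k - 1)"] that a_ge N_least[of "k-1"] N_least[of k] aS[of "k - 1"] by simp
  qed
qed

lemma cadlag_subdivision_simple:
  fixes Z :: "real \<Rightarrow> 'a::real_normed_vector"
  assumes "cadlag Z" "0 \<le> t" "0 < \<eta>"
  obtains N :: nat and a where "a 0 = 0" "a N = t" "\<And>k. k < N \<Longrightarrow> a k < a (Suc k)"
    "\<And>k s. k < N \<Longrightarrow> a k \<le> s \<Longrightarrow> s < a (Suc k) \<Longrightarrow> norm (Z s - Z (a k)) \<le> \<eta>"
  by (rule cadlag_subdivision[OF assms, of "\<lambda>_. True"]) auto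

lemma subdivision_locate:
  fixes a :: "nat \<Rightarrow> real"
  assumes "a 0 \<le> s" "s < a N"
  obtains k where "k < N" "a k \<le> s" "s < a (Suc k)"
proof -
  define k where "k = (LEAST k. s < a k)"
  have k: "s < a k" "\<And>j. j < k \<Longrightarrow> a j \<le> s"
    using LeastI[of "\<lambda>k. s < a k" N, OF assms(2)] not_less_Least[of _ "\<lambda>k. s < a k"]
    unfolding k_def not_less by blast+
  have "k \<le> N" unfolding k_def using assms by (intro Least_le)
  have "k \<noteq> 0" using k assms by (cases "k = 0") auto
  then show ?thesis using k \<open>k \<le> N\<close> by (intro that[of "k - 1"]) auto
qed

lemma subdivision_locate':
  fixes a :: "nat \<Rightarrow> real"
  assumes "a 0 < s" "s \<le> a N"
  obtains k where "k < N" "a k < s" "s \<le> a (Suc k)"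
proof -
  define k where "k = (LEAST k. s \<le> a k)"
  have k: "s \<le> a k" "\<And>j. j < k \<Longrightarrow> a j < s"
    using LeastI[of "\<lambda>k. s \<le> a k" N, OF assms(2)] not_less_Least[of _ "\<lambda>k. s \<le> a k"]
    unfolding k_def not_le by blast+
  have "k \<le> N" unfolding k_def using assms by (intro Least_le)
  have "k \<noteq> 0" using k assms by (cases "k = 0") auto
  then show ?thesis using k \<open>k \<le> N\<close> by (intro that[of "k - 1"]) auto
qed

lemma subdivision_mono:
  fixes a :: "nat \<Rightarrow> real"
  assumes "\<And>k. k < N \<Longrightarrow> a k < a (Suc k)" "i \<le> j" "j \<le> N"
  shows "a i \<le> a j"
  using assms(2,3)
proof (induction j rule: dec_induct)
  case (step j)
  then show ?case using assms(1)[of j] by simp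
qed simp

lemma cadlag_compact_range:
  fixes Z :: "real \<Rightarrow> 'a::banach"
  assumes Z: "cadlag Z"
  shows "compact (closure (Z ` {0..t}))"
proof (cases "0 \<le> t")
  case t: True
  show ?thesis
    unfolding compact_eq_totally_bounded
  proof (intro conjI allI impI)
    show "complete (closure (Z ` {0..t}))"
      by (simp add: complete_eq_closed)
    fix e :: real assume e: "0 < e"
    obtain N a where a: "a 0 = 0" "a N = t" "\<And>k. k < N \<Longrightarrow> a k < a (Suc k)"
      "\<And>k s. k < N \<Longrightarrow> a k \<le> s \<Longrightarrow> s < a (Suc k) \<Longrightarrow> norm (Z s - Z (a k)) \<le> e / 2"
      using cadlag_subdivision_simple[OF Z t, of "e / 2"] e by (metis half_gt_zero)
    have "Z s \<in> (\<Union>x\<in>(Z \<circ> a) ` {..N}. cball x (e / 2))" if s: "0 \<le> s" "s \<le> t" for s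
    proof (cases "s = t")
      case True
      then show ?thesis using a(2) e by force
    next
      case False
      then obtain k where "k < N" "a k \<le> s" "s < a (Suc k)"
        using subdivision_locate[of a s N] a s by auto
      then show ?thesis
        using a(4)[of k s] by (auto simp: dist_norm norm_minus_commute intro!: bexI[of _ k])
    qed
    then have "closure (Z ` {0..t}) \<subseteq> (\<Union>x\<in>(Z \<circ> a) ` {..N}. cball x (e / 2))"
      by (intro closure_minimal closed_UN) auto
    also have "\<dots> \<subseteq> (\<Union>x\<in>(Z \<circ> a) ` {..N}. ball x e)"
      using e by (fastforce simp: less_eq_real_def)
    finally show "\<exists>k. finite k \<and> closure (Z ` {0..t}) \<subseteq> (\<Union>x\<in>k. ball x e)"
      by (intro exI[of _ "(Z \<circ> a) ` {..N}"]) auto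
  qed
qed auto

lemma left_lim_in_closure_range:
  fixes Z :: "real \<Rightarrow> 'a::t2_space"
  assumes "cadlag Z" "0 \<le> s" "s \<le> t"
  shows "left_lim Z s \<in> closure (Z ` {0..t})"
proof (cases "s = 0")
  case True
  then show ?thesis using assms closure_subset by fastforce
next
  case False
  then show ?thesis
    using assms closure_subset[of "Z ` {0..t}"]
    by (intro left_lim_in_closed[OF assms(1), of _ 0]) auto
qed

text \<open>Operators are controlled only on compact sets, so the vectors to which an integral along the path
  applies them have to lie in a common one.\<close>

lemma cadlag_compact_increments:
  fixes Z :: "real \<Rightarrow> 'a::banach"
  assumes Z: "cadlag Z"
  obtains K where "compact K" "\<And>u v. u \<in> {0..t} \<Longrightarrow> v \<in> {0..t} \<Longrightarrow> Z u - Z v \<in> K"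
    "\<And>u. u \<in> {0..t} \<Longrightarrow> jump Z u \<in> K"
proof -
  let ?M = "closure (Z ` {0..t})"
  have sub: "Z u \<in> ?M" if "u \<in> {0..t}" for u
    using that closure_subset by fastforce
  show ?thesis
  proof (rule that[of "{x - y | x y. x \<in> ?M \<and> y \<in> ?M}"])
    show "compact {x - y | x y. x \<in> ?M \<and> y \<in> ?M}"
      by (intro compact_differences cadlag_compact_range Z)
  qed (use sub left_lim_in_closure_range[OF Z, of _ t] in \<open>auto simp: jump_def\<close>)
qed

lemma finite_big_jumps:
  fixes Z :: "real \<Rightarrow> 'a::real_normed_vector"
  assumes Z: "cadlag Z" and \<epsilon>: "0 < \<epsilon>"
  shows "finite {s \<in> {0<..t}. \<epsilon> \<le> norm (jump Z s)}"
proof (cases "0 \<le> t")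
  case t: True
  obtain N a where a: "a 0 = 0" "a N = t" "\<And>k. k < N \<Longrightarrow> a k < a (Suc k)"
    "\<And>k s. k < N \<Longrightarrow> a k \<le> s \<Longrightarrow> s < a (Suc k) \<Longrightarrow> norm (Z s - Z (a k)) \<le> \<epsilon> / 3"
    using cadlag_subdivision_simple[OF Z t, of "\<epsilon> / 3"] \<epsilon> by (metis divide_pos_pos zero_less_numeral)
  have "s \<in> a ` {..N}" if s: "0 < s" "s \<le> t" "\<epsilon> \<le> norm (jump Z s)" for s
  proof -
    obtain k where k: "k < N" "a k < s" "s \<le> a (Suc k)"
      using subdivision_locate'[of a s N] a s by auto
    have "s = a (Suc k)"
    proof (rule ccontr)
      assume "s \<noteq> a (Suc k)"
      then have k': "s < a (Suc k)" using k by auto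
      have "0 \<le> a k" using subdivision_mono[of N a 0 k] a k by simp
      have "left_lim Z s \<in> cball (Z (a k)) (\<epsilon> / 3)"
        by (rule left_lim_in_closed[OF Z, of _ "a k"])
           (use a(4)[OF k(1)] k k' \<open>0 \<le> a k\<close> in \<open>auto simp: dist_norm norm_minus_commute\<close>)
      then have "norm (jump Z s) \<le> \<epsilon> / 3 + \<epsilon> / 3"
        using a(4)[OF k(1), of s] k k' norm_triangle_ineq4[of "Z s - Z (a k)" "left_lim Z s - Z (a k)"]
        by (auto simp: jump_def dist_norm norm_minus_commute)
      then show False using s \<epsilon> by linarith
    qed
    then show ?thesis using k by auto
  qed
  then have "{s \<in> {0<..t}. \<epsilon> \<le> norm (jump Z s)} \<subseteq> a ` {..N}"
    unfolding subset_eq by simp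
  then show ?thesis by (rule finite_subset) simp
qed (auto intro: finite_subset[of _ "{}"])

section \<open>Uniform convergence of operators on compact sets\<close>

lemma rho_nonempty:
  fixes L :: "'a::real_normed_vector \<Rightarrow>\<^sub>L 'b::real_normed_vector"
  shows "norm L + 1 \<in> {C. 0 < C \<and> (\<forall>x\<in>K. norm (blinfun_apply L x) \<le> C * norm x)}"
proof -
  have "norm (blinfun_apply L x) \<le> (norm L + 1) * norm x" for x
    using norm_blinfun[of L x] norm_ge_zero[of x] unfolding distrib_right by linarith
  moreover have "0 < norm L + 1" using norm_ge_zero[of L] by linarith
  ultimately show ?thesis by blast
qed

lemma rho_bdd: "bdd_below {C. 0 < C \<and> (\<forall>x\<in>K. norm (blinfun_apply L x) \<le> C * norm x)}"
  by (rule bdd_belowI[of _ 0]) auto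

lemma rho_less_witness:
  assumes "rho K L < c"
  obtains C where "0 < C" "\<forall>x\<in>K. norm (blinfun_apply L x) \<le> C * norm x" "C < c"
proof -
  have "\<exists>C\<in>{C. 0 < C \<and> (\<forall>x\<in>K. norm (blinfun_apply L x) \<le> C * norm x)}. C < c"
    using assms rho_nonempty[of L K] unfolding rho_def by (subst (asm) cInf_less_iff[OF _ rho_bdd]) auto
  then show ?thesis using that by auto
qed

lemma rho_lessD: "rho K L < c \<Longrightarrow> x \<in> K \<Longrightarrow> norm (blinfun_apply L x) \<le> c * norm x"
proof -
  assume a: "rho K L < c" "x \<in> K"
  then obtain C where "0 < C" "\<forall>x\<in>K. norm (blinfun_apply L x) \<le> C * norm x" "C < c"
    using rho_less_witness by metis
  then show ?thesis
    using a by (meson less_imp_le mult_right_mono norm_ge_zero order_trans)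
qed

lemma rho_leI:
  "0 < C \<Longrightarrow> (\<And>x. x \<in> K \<Longrightarrow> norm (blinfun_apply L x) \<le> C * norm x) \<Longrightarrow> rho K L \<le> C"
  unfolding rho_def by (intro cInf_lower rho_bdd) auto

lemma rho_triangle_less:
  assumes "rho K L < c" "rho K M < d"
  shows "rho K (L + M) < c + d"
proof -
  obtain C where C: "0 < C" "\<forall>x\<in>K. norm (blinfun_apply L x) \<le> C * norm x" "C < c"
    by (rule rho_less_witness[OF assms(1)])
  obtain D where D: "0 < D" "\<forall>x\<in>K. norm (blinfun_apply M x) \<le> D * norm x" "D < d"
    by (rule rho_less_witness[OF assms(2)])
  have "rho K (L + M) \<le> C + D"
  proof (rule rho_leI)
    fix x assume "x \<in> K"
    then show "norm (blinfun_apply (L + M) x) \<le> (C + D) * norm x"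
      using C D norm_triangle_ineq[of "L x" "M x"]
      by (fastforce simp: blinfun.add_left distrib_right)
  qed (use C D in auto)
  then show ?thesis using C D by auto
qed

lemma rho_minus_commute: "rho K (L - M) = rho K (M - L)"
  by (simp add: rho_def blinfun.diff_left norm_minus_commute)

lemma rho_0: "0 < c \<Longrightarrow> rho K 0 < c"
  by (rule le_less_trans[OF rho_leI[of "c / 2"]]) auto

lemma openin_Lc_ball:
  "compact K \<Longrightarrow> 0 < e \<Longrightarrow> openin Lc_topology {L. rho K (L - L0) < e}"
  unfolding Lc_topology_def by (intro topology_generated_by_Basis) auto

lemma limitin_topology_generated_by:
  assumes l: "l \<in> \<Union>S" and ev: "\<And>U. U \<in> S \<Longrightarrow> l \<in> U \<Longrightarrow> eventually (\<lambda>x. f x \<in> U) F"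
  shows "limitin (topology_generated_by S) f l F"
  unfolding limitin_def
proof (intro conjI allI impI)
  show "l \<in> topspace (topology_generated_by S)" using l by simp
  fix U assume U: "openin (topology_generated_by S) U \<and> l \<in> U"
  then have "generate_topology_on S U" by (simp add: openin_topology_generated_by_iff)
  then show "eventually (\<lambda>x. f x \<in> U) F" using U[THEN conjunct2]
  proof induction
    case (Int a b)
    then show ?case by (auto elim: eventually_elim2)
  next
    case (UN K)
    then obtain k where "k \<in> K" "eventually (\<lambda>x. f x \<in> k) F" by auto
    then show ?case by (auto elim!: eventually_mono)
  qed (auto simp: ev)
qed

lemma limitin_LcI:
  assumes "\<And>K e. compact K \<Longrightarrow> 0 < e \<Longrightarrow> eventually (\<lambda>x. rho K (f x - l) < e) F"
  shows "limitin Lc_topology f l F"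
  unfolding Lc_topology_def
proof (rule limitin_topology_generated_by)
  show "l \<in> \<Union> {{L. rho K (L - L0) < e} | K L0 e. compact K \<and> 0 < e}"
    using rho_0[of 1 "{}"]
    by (intro UnionI[of "{L. rho {} (L - l) < 1}"] CollectI exI[of _ "{}"] exI[of _ l] exI[of _ 1]) auto
  fix U assume "U \<in> {{L. rho K (L - L0) < e} | K L0 e. compact K \<and> 0 < e}" and lU: "l \<in> U"
  then obtain K L0 e where U: "U = {L. rho K (L - L0) < e}" "compact K" "0 < e" by auto
  have "eventually (\<lambda>x. rho K (f x - l) < e - rho K (l - L0)) F"
    using lU U by (intro assms) auto
  then show "eventually (\<lambda>x. f x \<in> U) F"
  proof eventually_elim
    case (elim x)
    obtain d where d: "rho K (f x - l) < d" "d < e - rho K (l - L0)"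
      using dense[OF elim] by auto
    then have "rho K ((f x - l) + (l - L0)) < d + (e - d)"
      by (intro rho_triangle_less) auto
    then show ?case by (simp add: U)
  qed
qed

lemma continuous_map_Lc_nhd:
  assumes "continuous_map euclidean Lc_topology \<Phi>" "compact K" "0 < e"
  shows "open {z'. rho K (\<Phi> z' - \<Phi> z) < e}"
proof -
  have "openin euclidean {x \<in> topspace euclidean. \<Phi> x \<in> {L. rho K (L - \<Phi> z) < e}}"
    by (rule openin_continuous_map_preimage[OF assms(1) openin_Lc_ball[OF assms(2,3)]])
  then show ?thesis by simp
qed

lemma continuous_map_Lc_limitin:
  fixes \<Phi> :: "'z::topological_space \<Rightarrow> 'a::real_normed_vector \<Rightarrow>\<^sub>L 'b::real_normed_vector"
  assumes \<Phi>: "continuous_map euclidean Lc_topology \<Phi>" and Z: "(Z \<longlongrightarrow> z) F"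
  shows "limitin Lc_topology (\<lambda>s. \<Phi> (Z s)) (\<Phi> z) F"
proof (rule limitin_LcI)
  fix K :: "'a set" and e :: real assume K: "compact K" "0 < e"
  have "z \<in> {z'. rho K (\<Phi> z' - \<Phi> z) < e}" using K rho_0 by auto
  from topological_tendstoD[OF Z continuous_map_Lc_nhd[OF \<Phi> K] this]
  show "eventually (\<lambda>s. rho K (\<Phi> (Z s) - \<Phi> z) < e) F" by simp
qed

text \<open>
  A Lebesgue number of the cover of \<open>M\<close> by the open sets on which \<open>\<Phi>\<close> varies little. The second point
  ranges over a full ball, so that the estimate also covers the segments of the Taylor expansion,
  which may leave the range of the path.
\<close>

lemma continuous_map_Lc_uniform:
  fixes \<Phi> :: "'z::metric_space \<Rightarrow> 'a::real_normed_vector \<Rightarrow>\<^sub>L 'b::real_normed_vector"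
  assumes \<Phi>: "continuous_map euclidean Lc_topology \<Phi>" and M: "compact M" and K: "compact K" and e: "0 < e"
  obtains \<delta> where "0 < \<delta>" "\<And>z z'. z \<in> M \<Longrightarrow> dist z z' < \<delta> \<Longrightarrow> rho K (\<Phi> z' - \<Phi> z) < e"
proof -
  define U where "U z = {z'. rho K (\<Phi> z' - \<Phi> z) < e / 2}" for z
  have "z \<in> U z" for z using e rho_0[of "e/2" K] by (simp add: U_def)
  then have "M \<subseteq> \<Union> (range U)" by blast
  moreover have "open G" if "G \<in> range U" for G
    using that continuous_map_Lc_nhd[OF \<Phi> K, of "e / 2"] e by (auto simp: U_def)
  ultimately obtain \<delta> where \<delta>: "0 < \<delta>" "\<forall>x\<in>M. \<exists>G\<in>range U. ball x \<delta> \<subseteq> G"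
    using Heine_Borel_lemma[OF M] by metis
  show ?thesis
  proof (rule that[OF \<delta>(1)])
    fix z z' assume "z \<in> M" "dist z z' < \<delta>"
    then obtain y where y: "ball z \<delta> \<subseteq> U y" using \<delta> by auto
    then have "z \<in> U y" "z' \<in> U y" using \<delta>(1) \<open>dist z z' < \<delta>\<close> by auto
    then have "rho K ((\<Phi> z' - \<Phi> y) + (\<Phi> y - \<Phi> z)) < e / 2 + e / 2"
      by (intro rho_triangle_less) (auto simp: U_def rho_minus_commute)
    then show "rho K (\<Phi> z' - \<Phi> z) < e" by simp
  qed
qed

text \<open>A member of an open cover that contains the limit contains all but finitely many terms.\<close>

lemma compact_insert_limit:
  fixes v :: "nat \<Rightarrow> 'a::topological_space"
  assumes v: "v \<longlonglongrightarrow> l"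
  shows "compact (insert l (range v))"
proof (rule compactI)
  fix \<C> assume \<C>: "\<forall>t\<in>\<C>. open t" "insert l (range v) \<subseteq> \<Union>\<C>"
  then obtain U where U: "U \<in> \<C>" "l \<in> U" by auto
  then have "open U" using \<C>(1) by auto
  from topological_tendstoD[OF v this U(2)] obtain n0 where n0: "\<And>n. n \<ge> n0 \<Longrightarrow> v n \<in> U"
    by (auto simp: eventually_sequentially)
  have "\<forall>n. \<exists>W\<in>\<C>. v n \<in> W" using \<C>(2) by auto
  then obtain W where W: "\<And>n. W n \<in> \<C>" "\<And>n. v n \<in> W n" by metis
  have "insert l (range v) \<subseteq> \<Union>(insert U (W ` {..<n0}))"
  proof
    fix x assume "x \<in> insert l (range v)"
    then consider "x = l" | n where "x = v n" by auto
    then show "x \<in> \<Union>(insert U (W ` {..<n0}))"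
    proof cases
      case (2 n)
      then show ?thesis using W(2)[of n] n0[of n] by (cases "n < n0") auto
    qed (use U in auto)
  qed
  then show "\<exists>C'\<subseteq>\<C>. finite C' \<and> insert l (range v) \<subseteq> \<Union> C'"
    using U W(1) by (intro exI[of _ "insert U (W ` {..<n0})"]) auto
qed

lemma continuous_map_Lc_tendsto_apply:
  fixes \<Phi> :: "'z::metric_space \<Rightarrow> 'a::real_normed_vector \<Rightarrow>\<^sub>L 'b::real_normed_vector"
  assumes \<Phi>: "continuous_map euclidean Lc_topology \<Phi>" and z: "z \<longlonglongrightarrow> z0" and v: "v \<longlonglongrightarrow> v0"
  shows "(\<lambda>n. blinfun_apply (\<Phi> (z n)) (v n)) \<longlonglongrightarrow> blinfun_apply (\<Phi> z0) v0"
proof -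
  define K where "K = insert v0 (range v)"
  have K: "compact K" unfolding K_def by (rule compact_insert_limit[OF v])
  have "(\<lambda>n. blinfun_apply (\<Phi> (z n) - \<Phi> z0) (v n)) \<longlonglongrightarrow> 0"
  proof (rule LIMSEQ_I)
    fix r :: real assume r: "0 < r"
    obtain B where B: "\<And>x. x \<in> K \<Longrightarrow> norm x \<le> B" "0 < B"
      using compact_imp_bounded[OF K] by (auto simp: bounded_pos)
    have "0 < r / (2 * B)" using r B by auto
    then have "z0 \<in> {z'. rho K (\<Phi> z' - \<Phi> z0) < r / (2 * B)}" using rho_0 by auto
    from topological_tendstoD[OF z continuous_map_Lc_nhd[OF \<Phi> K \<open>0 < r / (2 * B)\<close>] this]
    obtain n0 where n0: "\<And>n. n \<ge> n0 \<Longrightarrow> rho K (\<Phi> (z n) - \<Phi> z0) < r / (2 * B)"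
      by (auto simp: eventually_sequentially)
    have "norm (blinfun_apply (\<Phi> (z n) - \<Phi> z0) (v n) - 0) < r" if "n \<ge> n0" for n
    proof -
      have "norm (blinfun_apply (\<Phi> (z n) - \<Phi> z0) (v n)) \<le> r / (2 * B) * norm (v n)"
        by (rule rho_lessD[OF n0[OF that]]) (auto simp: K_def)
      also have "\<dots> \<le> r / (2 * B) * B"
        using B r by (intro mult_left_mono B) (auto simp: K_def)
      finally show ?thesis using B r by auto
    qed
    then show "\<exists>no. \<forall>n\<ge>no. norm (blinfun_apply (\<Phi> (z n) - \<Phi> z0) (v n) - 0) < r" by blast
  qed
  moreover have "(\<lambda>n. blinfun_apply (\<Phi> z0) (v n)) \<longlonglongrightarrow> blinfun_apply (\<Phi> z0) v0"
    by (intro tendsto_intros v)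
  ultimately have "(\<lambda>n. blinfun_apply (\<Phi> (z n) - \<Phi> z0) (v n) + blinfun_apply (\<Phi> z0) (v n))
      \<longlonglongrightarrow> 0 + blinfun_apply (\<Phi> z0) v0"
    by (rule tendsto_add)
  then show ?thesis by (simp add: blinfun.diff_left)
qed


section \<open>Norm and weak limits\<close>

lemma limitin_weak_topology:
  fixes f :: "'x \<Rightarrow> 'a::real_normed_vector"
  shows "limitin weak_topology f l F \<longleftrightarrow>
    (\<forall>\<phi> :: 'a \<Rightarrow>\<^sub>L real. ((\<lambda>x. blinfun_apply \<phi> (f x)) \<longlongrightarrow> blinfun_apply \<phi> l) F)"
proof safe
  fix \<phi> :: "'a \<Rightarrow>\<^sub>L real" assume lim: "limitin weak_topology f l F"
  show "((\<lambda>x. blinfun_apply \<phi> (f x)) \<longlongrightarrow> blinfun_apply \<phi> l) F"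
  proof (rule topological_tendstoI)
    fix U :: "real set" assume U: "open U" "blinfun_apply \<phi> l \<in> U"
    have "openin weak_topology (blinfun_apply \<phi> -` U)"
      unfolding weak_topology_def using U(1) by (intro topology_generated_by_Basis) auto
    then have "eventually (\<lambda>x. f x \<in> blinfun_apply \<phi> -` U) F"
      using lim U(2) by (auto simp: limitin_def)
    then show "eventually (\<lambda>x. blinfun_apply \<phi> (f x) \<in> U) F" by simp
  qed
next
  assume lim: "\<forall>\<phi> :: 'a \<Rightarrow>\<^sub>L real. ((\<lambda>x. blinfun_apply \<phi> (f x)) \<longlongrightarrow> blinfun_apply \<phi> l) F"
  show "limitin weak_topology f l F"
    unfolding weak_topology_def
  proof (rule limitin_topology_generated_by)
    show "l \<in> \<Union> {blinfun_apply \<phi> -` U | (\<phi> :: 'a \<Rightarrow>\<^sub>L real) U. open U}"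
      by (rule UnionI[of "blinfun_apply 0 -` UNIV"]) auto
    fix V assume "V \<in> {blinfun_apply \<phi> -` U | (\<phi> :: 'a \<Rightarrow>\<^sub>L real) U. open U}" "l \<in> V"
    then obtain \<phi> :: "'a \<Rightarrow>\<^sub>L real" and U where "V = blinfun_apply \<phi> -` U" "open U" "blinfun_apply \<phi> l \<in> U"
      by auto
    then show "eventually (\<lambda>x. f x \<in> V) F"
      using topological_tendstoD[OF lim[rule_format, of \<phi>]] by simp
  qed
qed

lemma mode_limit_of_tendsto: "(f \<longlongrightarrow> l) F \<Longrightarrow> limitin (mode_topology m) f l F"
  by (cases m) (auto simp: limitin_weak_topology intro!: tendsto_intros)

lemma mode_limit_add:
  "limitin (mode_topology m) f l F \<Longrightarrow> limitin (mode_topology m) g k F \<Longrightarrow>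
    limitin (mode_topology m) (\<lambda>x. f x + g x) (l + k) F"
  by (cases m) (simp_all add: limitin_weak_topology blinfun.add_right tendsto_add)

lemma mode_limit_diff:
  "limitin (mode_topology m) f l F \<Longrightarrow> limitin (mode_topology m) g k F \<Longrightarrow>
    limitin (mode_topology m) (\<lambda>x. f x - g x) (l - k) F"
  by (cases m) (simp_all add: limitin_weak_topology blinfun.diff_right tendsto_diff)

lemma mode_limit_scaleR:
  "limitin (mode_topology m) f l F \<Longrightarrow> limitin (mode_topology m) (\<lambda>x. c *\<^sub>R f x) (c *\<^sub>R l) F"
  by (cases m) (simp_all add: limitin_weak_topology blinfun.scaleR_right
    tendsto_scaleR[OF tendsto_const] tendsto_mult_left)

lemma mode_limit_blinfun:
  fixes c :: "'a::real_normed_vector \<Rightarrow>\<^sub>L 'b::real_normed_vector"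
  assumes lim: "limitin (mode_topology m) f l F"
  shows "limitin (mode_topology m) (\<lambda>x. blinfun_apply c (f x)) (blinfun_apply c l) F"
proof (cases m)
  case Strong
  then show ?thesis using lim by (auto intro!: tendsto_intros)
next
  case Weak
  have "((\<lambda>x. blinfun_apply (\<phi> o\<^sub>L c) (f x)) \<longlongrightarrow> blinfun_apply (\<phi> o\<^sub>L c) l) F" for \<phi> :: "'b \<Rightarrow>\<^sub>L real"
    using lim Weak by (simp only: mode_topology.simps limitin_weak_topology)
  then show ?thesis using Weak by (simp add: limitin_weak_topology)
qed

lemma mode_limit_sum:
  assumes "\<And>i. i \<in> I \<Longrightarrow> limitin (mode_topology m) (\<lambda>x. f i x) (l i) F"
  shows "limitin (mode_topology m) (\<lambda>x. \<Sum>i\<in>I. f i x) (\<Sum>i\<in>I. l i) F"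
  using assms
proof (induction I rule: infinite_finite_induct)
  case (insert i I)
  then show ?case by (simp add: mode_limit_add)
next
  case (infinite I)
  then show ?case using mode_limit_of_tendsto[OF tendsto_const[of 0]] by simp
next
  case empty
  then show ?case using mode_limit_of_tendsto[OF tendsto_const[of 0]] by simp
qed

text \<open>
  An approximation in norm that is uniform in \<open>x\<close> is uniform under every bounded linear map, and both
  topologies are tested by bounded linear maps: the identity, or all functionals.
\<close>

lemma mode_limit_approx:
  fixes f :: "'x \<Rightarrow> 'a::real_normed_vector"
  assumes approx: "\<And>e. 0 < e \<Longrightarrow> \<exists>g k. limitin (mode_topology m) g k F
      \<and> eventually (\<lambda>x. norm (f x - g x) \<le> e) F \<and> norm (l - k) \<le> e"
  shows "limitin (mode_topology m) f l F"
proof -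
  have lim: "((\<lambda>x. T (f x)) \<longlongrightarrow> T l) F"
    if T: "bounded_linear T" and mode: "\<And>g k. limitin (mode_topology m) g k F \<Longrightarrow> ((\<lambda>x. T (g x)) \<longlongrightarrow> T k) F"
    for T :: "'a \<Rightarrow> 'c::real_normed_vector"
  proof (rule tendstoI)
    fix e :: real assume e: "0 < e"
    obtain B where B: "0 < B" "\<And>x. norm (T x) \<le> norm x * B"
      using bounded_linear.pos_bounded[OF T] by auto
    have small: "norm (T x) \<le> e / 3" if "norm x \<le> e / (3 * B)" for x
    proof -
      have "norm x * B \<le> e / (3 * B) * B" using that B by (intro mult_right_mono) auto
      then show ?thesis using B(2)[of x] B(1) by simp
    qed
    obtain g k where gk: "limitin (mode_topology m) g k F"
      "eventually (\<lambda>x. norm (f x - g x) \<le> e / (3 * B)) F" "norm (l - k) \<le> e / (3 * B)"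
      using approx[of "e / (3 * B)"] e B by auto
    have "eventually (\<lambda>x. dist (T (g x)) (T k) < e / 3) F"
      using tendstoD[OF mode[OF gk(1)], of "e / 3"] e by simp
    with gk(2) show "eventually (\<lambda>x. dist (T (f x)) (T l) < e) F"
    proof eventually_elim
      case (elim x)
      have "T (f x) - T l = T (f x - g x) + (T (g x) - T k) - T (l - k)"
        by (simp add: linear_diff[OF bounded_linear.linear[OF T]])
      also have "norm \<dots> \<le> norm (T (f x - g x)) + norm (T (g x) - T k) + norm (T (l - k))"
        by (intro order_trans[OF norm_triangle_ineq4] add_right_mono norm_triangle_ineq)
      also have "\<dots> < e / 3 + e / 3 + e / 3"
        using small[OF elim(1)] small[OF gk(3)] elim(2) by (auto simp: dist_norm)
      finally show ?case by (simp add: dist_norm)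
    qed
  qed
  show ?thesis
  proof (cases m)
    case Strong
    then show ?thesis using lim[of "\<lambda>x. x"] bounded_linear_ident by simp
  next
    case Weak
    have "((\<lambda>x. blinfun_apply \<phi> (f x)) \<longlongrightarrow> blinfun_apply \<phi> l) F" for \<phi> :: "'a \<Rightarrow>\<^sub>L real"
      by (rule lim[OF blinfun.bounded_linear_right]) (use Weak in \<open>simp add: limitin_weak_topology\<close>)
    then show ?thesis using Weak by (simp add: limitin_weak_topology)
  qed
qed

section \<open>Paths of finite variation\<close>

text \<open>Bounds by increments of a scalar function add up over disjoint intervals by telescoping, so a
  dominating function is easier to use than the suprema in the definition of finite variation.\<close>

definition dominates_increments :: "(real \<Rightarrow> real) \<Rightarrow> (real \<Rightarrow> 'a::real_normed_vector) \<Rightarrow> bool" where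
  "dominates_increments v g \<longleftrightarrow> (\<forall>a b. 0 \<le> a \<longrightarrow> a \<le> b \<longrightarrow> norm (g b - g a) \<le> v b - v a)"

lemma dominates_incrementsD:
  "dominates_increments v g \<Longrightarrow> 0 \<le> a \<Longrightarrow> a \<le> b \<Longrightarrow> norm (g b - g a) \<le> v b - v a"
  by (simp add: dominates_increments_def)

lemma dominates_increments_mono:
  "dominates_increments v g \<Longrightarrow> 0 \<le> a \<Longrightarrow> a \<le> b \<Longrightarrow> v a \<le> v b"
  using dominates_incrementsD[of v g a b] norm_ge_zero[of "g b - g a"] by linarith

text \<open>The supremum of the variation sums over \<open>[0, t]\<close>, as a function of \<open>t\<close>, is a witness.\<close>

lemma finite_variation_dominated:
  fixes g :: "real \<Rightarrow> 'a::real_normed_vector"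
  assumes g: "finite_variation g"
  obtains v where "dominates_increments v g"
proof -
  define W where "W t = {(\<Sum>i<n. norm (g (\<tau> (Suc i)) - g (\<tau> i))) | (n::nat) \<tau>. mono \<tau> \<and> range \<tau> \<subseteq> {0..t}}" for t
  define v where "v t = Sup (W t)" for t
  have bdd: "bdd_above (W t)" if t: "0 \<le> t" for t
  proof -
    obtain C where C: "\<forall>(n::nat) \<tau>. mono \<tau> \<and> range \<tau> \<subseteq> {0..t} \<longrightarrow>
        (\<Sum>i<n. norm (g (\<tau> (Suc i)) - g (\<tau> i))) \<le> C"
      using g[unfolded finite_variation_def, THEN spec, THEN mp, OF t] by (elim exE)
    show ?thesis
    proof (rule bdd_aboveI)
      fix x assume "x \<in> W t"
      then show "x \<le> C" using C unfolding W_def by blast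
    qed
  qed
  have ne: "W t \<noteq> {}" if "0 \<le> t" for t
  proof -
    have "(\<Sum>i<0. norm (g ((\<lambda>_. 0) (Suc i)) - g ((\<lambda>_. 0) i))) \<in> W t"
      unfolding W_def using that
      by (intro CollectI exI[of _ "0::nat"] exI[of _ "\<lambda>_::nat. 0::real"] conjI refl) (auto simp: mono_def)
    then show ?thesis by auto
  qed
  have "norm (g b - g a) \<le> v b - v a" if ab: "0 \<le> a" "a \<le> b" for a b
  proof -
    have "x \<le> v b - norm (g b - g a)" if x: "x \<in> W a" for x
    proof -
      obtain n :: nat and \<tau> :: "nat \<Rightarrow> real"
        where \<tau>: "x = (\<Sum>i<n. norm (g (\<tau> (Suc i)) - g (\<tau> i)))" "mono \<tau>" "range \<tau> \<subseteq> {0..a}"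
        using x[unfolded W_def mem_Collect_eq] by (elim exE conjE)
      \<comment> \<open>Append the interval from \<open>a\<close> to \<open>b\<close> to the given sequence in \<open>[0, a]\<close>.\<close>
      define \<sigma> where "\<sigma> i = (if i \<le> n then \<tau> i else if i = Suc n then a else b)" for i
      have \<tau>a: "0 \<le> \<tau> i" "\<tau> i \<le> a" for i using \<tau>(3) by (auto simp: image_subset_iff)
      have "\<sigma> i \<le> \<sigma> (Suc i)" for i
        using monoD[OF \<tau>(2), of i "Suc i"] \<tau>a[of i] ab by (auto simp: \<sigma>_def)
      then have "mono \<sigma>" by (simp add: mono_iff_le_Suc)
      moreover have "\<sigma> i \<in> {0..b}" for i
        using \<tau>a[of i] ab by (simp add: \<sigma>_def)
      then have "range \<sigma> \<subseteq> {0..b}" by blast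
      ultimately have "(\<Sum>i<Suc (Suc n). norm (g (\<sigma> (Suc i)) - g (\<sigma> i))) \<in> W b"
        unfolding W_def by (intro CollectI exI[of _ "Suc (Suc n)"] exI[of _ \<sigma>] conjI refl)
      then have "(\<Sum>i<Suc (Suc n). norm (g (\<sigma> (Suc i)) - g (\<sigma> i))) \<le> v b"
        unfolding v_def using ab by (intro cSup_upper bdd) auto
      moreover have "(\<Sum>i<n. norm (g (\<sigma> (Suc i)) - g (\<sigma> i))) = x"
        unfolding \<tau>(1) by (intro sum.cong) (auto simp: \<sigma>_def)
      ultimately have "x + norm (g (\<sigma> (Suc n)) - g (\<sigma> n)) + norm (g b - g a) \<le> v b"
        by (simp add: \<sigma>_def)
      then show ?thesis using norm_ge_zero[of "g (\<sigma> (Suc n)) - g (\<sigma> n)"] by linarith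
    qed
    then have "v a \<le> v b - norm (g b - g a)"
      unfolding v_def[of a] using ab by (intro cSup_least ne)
    then show ?thesis by simp
  qed
  then show ?thesis
    by (intro that[of v]) (simp add: dominates_increments_def)
qed

text \<open>
  Induction on the latest jump time \<open>b\<close> in \<open>F\<close>: its jump is at most the growth of \<open>v\<close> since the
  preceding jump time, and the earlier jumps are covered by the growth of \<open>v\<close> up to there.
\<close>

lemma sum_norm_jump_le:
  fixes g :: "real \<Rightarrow> 'a::real_normed_vector"
  assumes g: "cadlag g" and v: "dominates_increments v g" and t: "0 \<le> t"
    and F: "finite F" "F \<subseteq> {0<..t}"
  shows "(\<Sum>s\<in>F. norm (jump g s)) \<le> v t - v 0"
  using F t
proof (induction F arbitrary: t rule: finite_linorder_max_induct)
  case empty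
  then show ?case using dominates_increments_mono[OF v, of 0 t] by simp
next
  case (insert b F)
  define s where "s = Max (insert 0 F)"
  have s: "0 \<le> s" "s < b" "F \<subseteq> {0<..s}"
    using insert by (auto simp: s_def)
  have "left_lim g b \<in> cball (g b) (v b - v s)"
  proof (rule left_lim_in_closed[OF g _ s(1,2)])
    fix u assume u: "s < u" "u < b"
    then show "g u \<in> cball (g b) (v b - v s)"
      using dominates_incrementsD[OF v, of u b] dominates_increments_mono[OF v, of s u] s(1)
      by (auto simp: dist_norm)
  qed auto
  then have "norm (jump g b) \<le> v b - v s" by (simp add: jump_def dist_norm)
  moreover have "(\<Sum>s\<in>F. norm (jump g s)) \<le> v s - v 0" by (rule insert.IH[OF s(3,1)])
  moreover have "v b \<le> v t" using insert.prems by (intro dominates_increments_mono[OF v]) auto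
  moreover have "b \<notin> F" using insert by auto
  ultimately show ?case using insert by simp
qed

lemma jump_abs_summable:
  fixes g :: "real \<Rightarrow> 'a::real_normed_vector"
  assumes "cadlag g" "finite_variation g"
  shows "(\<lambda>s. norm (jump g s)) summable_on {0<..t}"
proof (cases "0 \<le> t")
  case True
  obtain v where v: "dominates_increments v g" using assms finite_variation_dominated by blast
  show ?thesis
    using sum_norm_jump_le[OF assms(1) v True]
    by (intro nonneg_bdd_above_summable_on bdd_aboveI[of _ "v t - v 0"]) auto
next
  case False
  then have "{0<..t} = {}" by auto
  then show ?thesis by simp
qed

section \<open>Stieltjes integrals\<close>

lemma finite_set_enumeration:
  fixes P :: "real set"
  assumes "finite P" "P \<subseteq> {0<..}"
  shows "\<exists>(N::nat) p. p 0 = 0 \<and> (\<forall>k<N. p k < p (Suc k)) \<and> p ` {..N} = insert 0 P"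
  using assms
proof (induction P rule: finite_linorder_max_induct)
  case empty
  have "(\<lambda>_. 0::real) ` {..0::nat} = {0}" by simp
  then show ?case by (intro exI[of _ "0::nat"] exI[of _ "\<lambda>_::nat. 0::real"]) simp
next
  case (insert b P)
  have "P \<subseteq> {0<..}" using insert.prems by simp
  from insert.IH[OF this] obtain N :: nat and p
    where p: "p 0 = 0" "\<forall>k<N. p k < p (Suc k)" "p ` {..N} = insert 0 P" by blast
  have "p N \<in> insert 0 P" using p(3) by (metis atMost_iff imageI order_refl)
  then have "p N < b" using insert by auto
  have "(p(Suc N := b)) k < (p(Suc N := b)) (Suc k)" if "k < Suc N" for k
    using p(2)[rule_format, of k] that \<open>p N < b\<close> by (cases "k = N") simp_all
  moreover have "(p(Suc N := b)) ` {..Suc N} = insert 0 (insert b P)"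
  proof -
    have "(p(Suc N := b)) ` {..N} = p ` {..N}" by (intro image_cong) simp_all
    then show ?thesis unfolding atMost_Suc image_insert p(3) by (simp add: insert_commute)
  qed
  moreover have "(p(Suc N := b)) 0 = 0" using p(1) by simp
  ultimately show ?case by blast
qed

lemma subdivision_strict_mono:
  fixes p :: "nat \<Rightarrow> real"
  assumes "\<And>k. k < N \<Longrightarrow> p k < p (Suc k)" "i \<le> N" "j \<le> N"
  shows "p i < p j \<longleftrightarrow> i < j"
proof -
  have lt: "p i < p j" if "i < j" "j \<le> N" for i j
  proof -
    have "p i < p (Suc i)" using assms(1) that by simp
    also have "\<dots> \<le> p j" using assms(1) that by (intro subdivision_mono[of N]) auto
    finally show ?thesis .
  qed
  show ?thesis
    using lt[of i j] lt[of j i] assms(2,3) by (cases i j rule: linorder_cases) auto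
qed

lemma is_stepD: "is_step \<sigma> \<Longrightarrow> (a, b, c) \<in> set (snd \<sigma>) \<Longrightarrow> 0 \<le> a \<and> a < b"
  by (auto simp: is_step_def)

text \<open>
  The intervals of a step may overlap. Refining by all their end points collects the coefficients
  into the values of the step function, so that a pointwise bound on the latter can be used.
\<close>

lemma step_integral_refine:
  fixes g :: "real \<Rightarrow> 'h::real_normed_vector"
  assumes \<sigma>: "is_step \<sigma>" and t: "0 \<le> t"
  obtains N :: nat and p where "p 0 = 0" "p N = t" "\<And>k. k < N \<Longrightarrow> p k < p (Suc k)"
    "step_integral g t \<sigma> = (\<Sum>j<N. blinfun_apply (step_fun \<sigma> (p (Suc j))) (g (p (Suc j)) - g (p j)))"
proof -
  define P where "P = (insert t (\<Union>(a, b, c)\<in>set (snd \<sigma>). {min a t, min b t})) - {0}"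
  have "finite P" "P \<subseteq> {0<..t}"
  proof -
    show "finite P" by (auto simp: P_def)
    have "x \<in> {0..t}" if "x \<in> insert t (\<Union>(a, b, c)\<in>set (snd \<sigma>). {min a t, min b t})" for x
    proof -
      consider "x = t" | a b c where "(a, b, c) \<in> set (snd \<sigma>)" "x = min a t \<or> x = min b t"
        using \<open>x \<in> insert t _\<close> by auto
      then show ?thesis
      proof cases
        case (2 a b c)
        then show ?thesis using is_stepD[OF \<sigma> 2(1)] t by auto
      qed (use t in auto)
    qed
    then have "x \<in> {0<..t}" if "x \<in> P" for x
    proof -
      have "x \<in> insert t (\<Union>(a, b, c)\<in>set (snd \<sigma>). {min a t, min b t})" "x \<noteq> 0"
        using that unfolding P_def by blast+
      with \<open>\<And>x. x \<in> insert t _ \<Longrightarrow> _\<close> have "x \<in> {0..t}" by blast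
      with \<open>x \<noteq> 0\<close> show ?thesis by simp
    qed
    then show "P \<subseteq> {0<..t}" by blast
  qed
  then have "P \<subseteq> {0<..}" by auto
  from finite_set_enumeration[OF \<open>finite P\<close> this] obtain N :: nat and p
    where p: "p 0 = 0" "\<And>k. k < N \<Longrightarrow> p k < p (Suc k)" "p ` {..N} = insert 0 P" by blast
  note sm = subdivision_strict_mono[of N p, OF p(2)]
  have le_t: "p i \<le> t" if "i \<le> N" for i
  proof -
    have "p i \<in> insert 0 P" using p(3) that by (metis atMost_iff imageI)
    then show ?thesis using \<open>P \<subseteq> {0<..t}\<close> t by auto
  qed
  have find: "\<exists>i\<le>N. p i = x" if "x \<in> insert 0 P" for x
    using that unfolding p(3)[symmetric] by auto
  have pN: "p N = t"
  proof -
    have "t \<in> insert 0 P" by (auto simp: P_def)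
    then obtain i where "i \<le> N" "p i = t" using find by blast
    then have "t \<le> p N" using subdivision_mono[of N p i N] p(2) by auto
    then show ?thesis using le_t[of N] by simp
  qed
  have pos: "0 < p (Suc j)" if "j < N" for j
    using sm[of 0 "Suc j"] that p(1) by simp
  have one: "blinfun_apply c (g (min b t) - g (min a t)) =
      (\<Sum>j<N. blinfun_apply (indicat_real {a<..b} (p (Suc j)) *\<^sub>R c) (g (p (Suc j)) - g (p j)))"
    if "(a, b, c) \<in> set (snd \<sigma>)" for a b c
  proof -
    have ab: "0 \<le> a" "a < b" using is_stepD[OF \<sigma> that] by auto
    have "min a t \<in> insert 0 P" "min b t \<in> insert 0 P"
      using that by (auto simp: P_def)
    then obtain i k where ik: "i \<le> N" "p i = min a t" "k \<le> N" "p k = min b t"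
      using find by metis
    have "i \<le> k"
    proof (rule ccontr)
      assume "\<not> i \<le> k"
      then have "p k < p i" using sm[of k i] ik by simp
      then show False using ik ab by auto
    qed
    have ind: "p (Suc j) \<in> {a<..b} \<longleftrightarrow> i \<le> j \<and> j < k" if j: "j < N" for j
    proof -
      have "p (Suc j) \<in> {a<..b} \<longleftrightarrow> p i < p (Suc j) \<and> p (Suc j) \<le> p k"
        using ik le_t[of "Suc j"] j by auto
      also have "\<dots> \<longleftrightarrow> i < Suc j \<and> \<not> k < Suc j"
        using sm[of i "Suc j"] sm[of k "Suc j"] ik j by (auto simp: not_less[symmetric])
      finally show ?thesis by auto
    qed
    have "(\<Sum>j<N. blinfun_apply (indicat_real {a<..b} (p (Suc j)) *\<^sub>R c) (g (p (Suc j)) - g (p j)))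
        = (\<Sum>j\<in>{i..<k}. blinfun_apply (indicat_real {a<..b} (p (Suc j)) *\<^sub>R c) (g (p (Suc j)) - g (p j)))"
      using ik ind by (intro sum.mono_neutral_right) (auto simp: indicator_def)
    also have "\<dots> = (\<Sum>j\<in>{i..<k}. blinfun_apply c (g (p (Suc j)) - g (p j)))"
      using ik ind by (intro sum.cong) (auto simp: indicator_def)
    also have "\<dots> = blinfun_apply c (\<Sum>j\<in>{i..<k}. g (p (Suc j)) - g (p j))"
      by (simp add: blinfun.sum_right)
    also have "(\<Sum>j\<in>{i..<k}. g (p (Suc j)) - g (p j)) = g (p k) - g (p i)"
      using \<open>i \<le> k\<close> by (rule sum_Suc_diff')
    finally show ?thesis using ik by simp
  qed
  have all: "(\<Sum>(a, b, c)\<leftarrow>xs. blinfun_apply c (g (min b t) - g (min a t))) =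
      (\<Sum>j<N. blinfun_apply (\<Sum>(a, b, c)\<leftarrow>xs. indicat_real {a<..b} (p (Suc j)) *\<^sub>R c) (g (p (Suc j)) - g (p j)))"
    if "set xs \<subseteq> set (snd \<sigma>)" for xs
    using that
  proof (induction xs)
    case (Cons q xs)
    obtain a b c where q: "q = (a, b, c)" by (cases q) auto
    show ?case
      using Cons one[of a b c] by (simp add: q blinfun.add_left sum.distrib)
  qed simp
  have "step_integral g t \<sigma> = (\<Sum>j<N. blinfun_apply (step_fun \<sigma> (p (Suc j))) (g (p (Suc j)) - g (p j)))"
    unfolding step_integral_def all[OF order_refl] step_fun_def
  proof (intro sum.cong refl)
    fix j assume "j \<in> {..<N}"
    then have "indicat_real {0} (p (Suc j)) = 0" using pos[of j] by (simp add: indicator_def)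
    then show "blinfun_apply (\<Sum>(a, b, c)\<leftarrow>snd \<sigma>. indicat_real {a<..b} (p (Suc j)) *\<^sub>R c) (g (p (Suc j)) - g (p j))
      = blinfun_apply (indicat_real {0} (p (Suc j)) *\<^sub>R fst \<sigma> +
          (\<Sum>(a, b, c)\<leftarrow>snd \<sigma>. indicat_real {a<..b} (p (Suc j)) *\<^sub>R c)) (g (p (Suc j)) - g (p j))"
      by simp
  qed
  then show ?thesis using that[OF p(1) pN p(2)] by simp
qed

text \<open>The bound that makes integration continuous: smallness of the integrand enters only through its
  values on the increments of the integrator.\<close>

lemma step_integral_bound:
  fixes g :: "real \<Rightarrow> 'h::real_normed_vector"
  assumes \<sigma>: "is_step \<sigma>" and t: "0 \<le> t" and v: "dominates_increments v g" and \<eta>: "0 \<le> \<eta>"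
    and K: "\<And>u v. u \<in> {0..t} \<Longrightarrow> v \<in> {0..t} \<Longrightarrow> g u - g v \<in> K"
    and small: "\<And>s x. s \<in> {0..t} \<Longrightarrow> x \<in> K \<Longrightarrow> norm (blinfun_apply (step_fun \<sigma> s) x) \<le> \<eta> * norm x"
  shows "norm (step_integral g t \<sigma>) \<le> \<eta> * (v t - v 0)"
proof -
  obtain N :: nat and p where p: "p 0 = 0" "p N = t" "\<And>k. k < N \<Longrightarrow> p k < p (Suc k)"
    "step_integral g t \<sigma> = (\<Sum>j<N. blinfun_apply (step_fun \<sigma> (p (Suc j))) (g (p (Suc j)) - g (p j)))"
    using step_integral_refine[OF \<sigma> t] by metis
  have in_t: "p j \<in> {0..t}" if "j \<le> N" for j
    using subdivision_mono[of N p 0 j] subdivision_mono[of N p j N] p that by auto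
  have "norm (step_integral g t \<sigma>) \<le> (\<Sum>j<N. \<eta> * (v (p (Suc j)) - v (p j)))"
    unfolding p(4)
  proof (rule sum_norm_le)
    fix j assume "j \<in> {..<N}"
    then have j: "p j \<in> {0..t}" "p (Suc j) \<in> {0..t}" "p j < p (Suc j)" using in_t p(3) by auto
    then have "norm (blinfun_apply (step_fun \<sigma> (p (Suc j))) (g (p (Suc j)) - g (p j)))
        \<le> \<eta> * norm (g (p (Suc j)) - g (p j))"
      by (intro small K) auto
    also have "\<dots> \<le> \<eta> * (v (p (Suc j)) - v (p j))"
      using j by (intro mult_left_mono dominates_incrementsD[OF v] \<eta>) auto
    finally show "norm (blinfun_apply (step_fun \<sigma> (p (Suc j))) (g (p (Suc j)) - g (p j)))
        \<le> \<eta> * (v (p (Suc j)) - v (p j))" .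
  qed
  also have "\<dots> = \<eta> * (v t - v 0)"
    using sum_lessThan_telescope[of "\<lambda>j. v (p j)" N] p by (simp add: sum_distrib_left[symmetric])
  finally show ?thesis .
qed

definition step_diff :: "('h::real_normed_vector, 'g::real_normed_vector) step \<Rightarrow> ('h, 'g) step \<Rightarrow> ('h, 'g) step" where
  "step_diff \<sigma> \<tau> = (fst \<sigma> - fst \<tau>, snd \<sigma> @ map (\<lambda>(a, b, c). (a, b, - c)) (snd \<tau>))"

lemma is_step_diff: "is_step \<sigma> \<Longrightarrow> is_step \<tau> \<Longrightarrow> is_step (step_diff \<sigma> \<tau>)"
  by (fastforce simp: is_step_def step_diff_def)

lemma step_fun_diff: "step_fun (step_diff \<sigma> \<tau>) s = step_fun \<sigma> s - step_fun \<tau> s"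
proof -
  have "(\<Sum>(a, b, c)\<leftarrow>map (\<lambda>(a, b, c). (a, b, - c)) xs. indicat_real {a<..b} s *\<^sub>R c)
      = - (\<Sum>(a, b, c)\<leftarrow>xs. indicat_real {a<..b} s *\<^sub>R c)" for xs :: "(real \<times> real \<times> ('a \<Rightarrow>\<^sub>L 'b)) list"
    by (induction xs) auto
  then show ?thesis
    by (simp add: step_fun_def step_diff_def scaleR_diff_right algebra_simps del: map_map)
qed

lemma step_integral_diff:
  fixes \<sigma> \<tau> :: "('h::real_normed_vector, 'g::real_normed_vector) step"
  shows "step_integral g t (step_diff \<sigma> \<tau>) = step_integral g t \<sigma> - step_integral g t \<tau>"
proof -
  have "(\<Sum>(a, b, c)\<leftarrow>map (\<lambda>(a, b, c). (a, b, - c)) xs. blinfun_apply c (g (min b t) - g (min a t)))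
      = - (\<Sum>(a, b, c)\<leftarrow>xs. blinfun_apply c (g (min b t) - g (min a t)))"
    for xs :: "(real \<times> real \<times> ('h \<Rightarrow>\<^sub>L 'g)) list"
    by (induction xs) (auto simp: blinfun.minus_left)
  then show ?thesis
    by (simp add: step_integral_def step_diff_def del: map_map)
qed

lemma step_integral_close:
  fixes g :: "real \<Rightarrow> 'h::real_normed_vector"
  assumes steps: "is_step \<sigma>" "is_step \<tau>" and t: "0 \<le> t" and v: "dominates_increments v g"
    and K: "\<And>u v. u \<in> {0..t} \<Longrightarrow> v \<in> {0..t} \<Longrightarrow> g u - g v \<in> K"
    and \<sigma>: "\<And>s. s \<in> {0..t} \<Longrightarrow> rho K (\<phi> s - step_fun \<sigma> s) < \<delta>"
    and \<tau>: "\<And>s. s \<in> {0..t} \<Longrightarrow> rho K (\<phi> s - step_fun \<tau> s) < \<delta>"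
    and \<delta>: "0 < \<delta>"
  shows "norm (step_integral g t \<sigma> - step_integral g t \<tau>) \<le> (2 * \<delta>) * (v t - v 0)"
  unfolding step_integral_diff[symmetric]
proof (rule step_integral_bound[OF is_step_diff[OF steps] t v _ K])
  fix s x assume s: "s \<in> {0..t}" and x: "x \<in> K"
  have "rho K ((\<phi> s - step_fun \<tau> s) + (step_fun \<sigma> s - \<phi> s)) < \<delta> + \<delta>"
    using \<sigma>[OF s] \<tau>[OF s] by (intro rho_triangle_less) (auto simp: rho_minus_commute)
  then have "rho K (step_fun (step_diff \<sigma> \<tau>) s) < 2 * \<delta>"
    by (simp add: step_fun_diff)
  from rho_lessD[OF this x] show "norm (blinfun_apply (step_fun (step_diff \<sigma> \<tau>) s) x) \<le> 2 * \<delta> * norm x" .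
qed (use \<delta> in auto)

lemma eventually_step_approx:
  assumes "compact K" "0 \<le> T" "0 < \<delta>"
  shows "eventually (\<lambda>\<sigma>. is_step \<sigma> \<and> (\<forall>s\<in>{0..T}. rho K (\<phi> s - step_fun \<sigma> s) < \<delta>)) (step_approx \<phi>)"
  unfolding step_approx_def
  by (rule eventually_INF1[of "(K, T, \<delta>)"]) (use assms in \<open>auto simp: eventually_principal\<close>)

lemma rho_less_subset: "K \<subseteq> K' \<Longrightarrow> rho K' L < c \<Longrightarrow> rho K L < c"
proof -
  assume "K \<subseteq> K'" "rho K' L < c"
  then obtain C where "0 < C" "\<forall>x\<in>K'. norm (blinfun_apply L x) \<le> C * norm x" "C < c"
    using rho_less_witness by blast
  then have "rho K L \<le> C" using \<open>K \<subseteq> K'\<close> by (intro rho_leI) auto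
  then show ?thesis using \<open>C < c\<close> by simp
qed

text \<open>The sets that generate the filter are directed: unite the compact sets, and take the longer
  interval and the smaller tolerance.\<close>

lemma step_approx_neq_bot:
  fixes \<phi> :: "real \<Rightarrow> 'h::real_normed_vector \<Rightarrow>\<^sub>L 'g::real_normed_vector"
  assumes ex: "\<And>K T \<delta>. compact K \<Longrightarrow> 0 \<le> T \<Longrightarrow> 0 < \<delta> \<Longrightarrow>
    \<exists>\<sigma>. is_step \<sigma> \<and> (\<forall>s\<in>{0..T}. rho K (\<phi> s - step_fun \<sigma> s) < \<delta>)"
  shows "step_approx \<phi> \<noteq> bot"
proof -
  define S where "S = (\<lambda>(K, T, \<delta>). {\<sigma> :: ('h, 'g) step. is_step \<sigma> \<and> (\<forall>s\<in>{0..T}. rho K (\<phi> s - step_fun \<sigma> s) < \<delta>)})"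
  define B where "B = {(K :: 'h set, T :: real, \<delta> :: real). compact K \<and> 0 \<le> T \<and> 0 < \<delta>}"
  have eq: "step_approx \<phi> = (INF b\<in>B. principal (S b))"
    unfolding step_approx_def B_def S_def by (intro INF_cong) auto
  have "({}, 0, 1) \<in> B" by (auto simp: B_def)
  then have "B \<noteq> {}" by blast
  moreover have "\<exists>x\<in>B. principal (S x) \<le> inf (principal (S a)) (principal (S b))" if "a \<in> B" "b \<in> B" for a b
  proof -
    obtain K T \<delta> K' T' \<delta>' where ab: "a = (K, T, \<delta>)" "b = (K', T', \<delta>')" by (cases a, cases b) auto
    have "(K \<union> K', max T T', min \<delta> \<delta>') \<in> B"
      using that by (auto simp: ab B_def compact_Un)
    moreover have "S (K \<union> K', max T T', min \<delta> \<delta>') \<subseteq> S a \<inter> S b"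
    proof
      fix \<sigma> assume \<sigma>: "\<sigma> \<in> S (K \<union> K', max T T', min \<delta> \<delta>')"
      have "rho K (\<phi> s - step_fun \<sigma> s) < \<delta>" if "s \<in> {0..T}" for s
        using \<sigma> that by (intro rho_less_subset[of K "K \<union> K'"]) (auto simp: S_def)
      moreover have "rho K' (\<phi> s - step_fun \<sigma> s) < \<delta>'" if "s \<in> {0..T'}" for s
        using \<sigma> that by (intro rho_less_subset[of K' "K \<union> K'"]) (auto simp: S_def)
      ultimately show "\<sigma> \<in> S a \<inter> S b"
        using \<sigma> by (simp add: S_def ab)
    qed
    ultimately show ?thesis by (intro bexI) (auto simp: principal_le_iff)
  qed
  ultimately have "eventually (\<lambda>_. False) (step_approx \<phi>) \<longleftrightarrow> (\<exists>b\<in>B. eventually (\<lambda>_. False) (principal (S b)))"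
    unfolding eq by (rule eventually_INF_base)
  moreover have "S b \<noteq> {}" if "b \<in> B" for b
  proof -
    obtain K T \<delta> where b: "b = (K, T, \<delta>)" by (cases b)
    then show ?thesis using ex[of K T \<delta>] that by (auto simp: B_def S_def simp del: split_paired_Ex)
  qed
  ultimately show ?thesis
    unfolding trivial_limit_def eventually_principal by blast
qed

text \<open>Two steps close to \<open>\<phi>\<close> on a compact set of increments have close integrals, so the image of the
  filter is Cauchy.\<close>

lemma stieltjes_limit_exists:
  fixes g :: "real \<Rightarrow> 'h::banach" and \<phi> :: "real \<Rightarrow> 'h \<Rightarrow>\<^sub>L 'g::banach"
  assumes nb: "step_approx \<phi> \<noteq> bot" and g: "cadlag g" "finite_variation g" and t: "0 \<le> t"
  obtains I where "(step_integral g t \<longlongrightarrow> I) (step_approx \<phi>)"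
proof -
  obtain v where v: "dominates_increments v g" using finite_variation_dominated[OF g(2)] .
  obtain K where K: "compact K" "\<And>u v. u \<in> {0..t} \<Longrightarrow> v \<in> {0..t} \<Longrightarrow> g u - g v \<in> K"
    using cadlag_compact_increments[OF g(1)] by metis
  define V where "V = v t - v 0"
  have V: "0 \<le> V" using dominates_increments_mono[OF v, of 0 t] t by (simp add: V_def)
  let ?F = "filtermap (step_integral g t) (step_approx \<phi>)"
  have "cauchy_filter ?F"
    unfolding cauchy_filter_metric_filtermap
  proof (intro allI impI)
    fix e :: real assume e: "0 < e"
    define \<delta> where "\<delta> = e / (2 * (V + 1))"
    have \<delta>: "0 < \<delta>" "(2 * \<delta>) * V < e"
      using e V by (auto simp: \<delta>_def field_simps)
    let ?P = "\<lambda>\<sigma>. is_step \<sigma> \<and> (\<forall>s\<in>{0..t}. rho K (\<phi> s - step_fun \<sigma> s) < \<delta>)"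
    have "dist (step_integral g t \<sigma>) (step_integral g t \<tau>) < e" if "?P \<sigma>" "?P \<tau>" for \<sigma> \<tau>
      using step_integral_close[OF _ _ t v K(2) _ _ \<delta>(1), of \<sigma> \<tau> \<phi>] that \<delta>(2)
      by (auto simp: dist_norm V_def)
    then show "\<exists>P. eventually P (step_approx \<phi>) \<and>
        (\<forall>x y. P x \<and> P y \<longrightarrow> dist (step_integral g t x) (step_integral g t y) < e)"
      using eventually_step_approx[OF K(1) t \<delta>(1), of \<phi>] by (intro exI[of _ ?P]) auto
  qed
  moreover have "?F \<noteq> bot" using nb by (simp add: filtermap_bot_iff)
  ultimately obtain I where "?F \<le> nhds I"
    using complete_UNIV[where 'a='g] unfolding complete_uniform by auto
  then show ?thesis using that by (simp add: filterlim_def)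
qed

lemma stieltjes_limit_close:
  fixes g :: "real \<Rightarrow> 'h::real_normed_vector" and \<phi> :: "real \<Rightarrow> 'h \<Rightarrow>\<^sub>L 'g::real_normed_vector"
  assumes nb: "step_approx \<phi> \<noteq> bot" and lim: "(step_integral g t \<longlongrightarrow> I) (step_approx \<phi>)"
    and \<sigma>: "is_step \<sigma>" "\<And>s. s \<in> {0..t} \<Longrightarrow> rho K (\<phi> s - step_fun \<sigma> s) < \<delta>"
    and t: "0 \<le> t" and v: "dominates_increments v g"
    and K: "compact K" "\<And>u v. u \<in> {0..t} \<Longrightarrow> v \<in> {0..t} \<Longrightarrow> g u - g v \<in> K"
    and \<delta>: "0 < \<delta>"
  shows "norm (I - step_integral g t \<sigma>) \<le> (2 * \<delta>) * (v t - v 0)"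
proof (rule Lim_norm_ubound[OF nb])
  show "((\<lambda>\<tau>. step_integral g t \<tau> - step_integral g t \<sigma>) \<longlongrightarrow> I - step_integral g t \<sigma>) (step_approx \<phi>)"
    by (intro tendsto_intros lim)
  show "eventually (\<lambda>\<tau>. norm (step_integral g t \<tau> - step_integral g t \<sigma>) \<le> (2 * \<delta>) * (v t - v 0)) (step_approx \<phi>)"
    using eventually_step_approx[OF K(1) t \<delta>, of \<phi>]
    by eventually_elim (intro step_integral_close[OF _ \<sigma>(1) t v K(2) _ \<sigma>(2) \<delta>], auto)
qed


text \<open>An increment of the accumulated jumps over \<open>(a, b]\<close> is the sum of the jumps in \<open>(a, b]\<close>, so
  integrating a step against it evaluates the step function at the jump times.\<close>

lemma has_sum_step_integral_jumps:
  fixes g :: "real \<Rightarrow> 'h::banach" and \<sigma> :: "('h, 'g::real_normed_vector) step"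
  assumes g: "cadlag g" "finite_variation g" and t: "0 \<le> t" and \<sigma>: "is_step \<sigma>"
  shows "((\<lambda>s. blinfun_apply (step_fun \<sigma> s) (jump g s)) has_sum
    step_integral (\<lambda>u. \<Sum>\<^sub>\<infinity>s\<in>{0<..u}. jump g s) t \<sigma>) {0<..t}"
proof -
  define D where "D u = (\<Sum>\<^sub>\<infinity>s\<in>{0<..u}. jump g s)" for u
  have summ: "(jump g) summable_on {0<..u}" for u
    using jump_abs_summable[OF g] by (rule abs_summable_summable)
  have D: "((jump g) has_sum (D b - D a)) {a<..b}" if ab: "0 \<le> a" "a \<le> b" for a b
  proof -
    have eq: "{0<..b} - {0<..a} = {a<..b}" using ab by auto
    show ?thesis
      using has_sum_Diff[OF has_sum_infsum[OF summ[of b]] has_sum_infsum[OF summ[of a]]] ab(2)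
      unfolding D_def eq by (simp add: subset_iff)
  qed
  have one: "((\<lambda>s. blinfun_apply (indicat_real {a<..b} s *\<^sub>R c) (jump g s)) has_sum
      blinfun_apply c (D (min b t) - D (min a t))) {0<..t}" if ab: "0 \<le> a" "a < b" for a b and c :: "'h \<Rightarrow>\<^sub>L 'g"
  proof -
    have "((\<lambda>s. blinfun_apply c (jump g s)) has_sum blinfun_apply c (D (min b t) - D (min a t))) {min a t<..min b t}"
      using has_sum_bounded_linear[OF blinfun.bounded_linear_right D[of "min a t" "min b t"], of c] ab t
      by (simp add: o_def)
    then show ?thesis
      by (rule has_sum_cong_neutral[THEN iffD1, rotated -1]) (use ab in \<open>auto simp: indicator_def\<close>)
  qed
  have all: "((\<lambda>s. blinfun_apply (\<Sum>(a, b, c)\<leftarrow>xs. indicat_real {a<..b} s *\<^sub>R c) (jump g s)) has_sum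
      (\<Sum>(a, b, c)\<leftarrow>xs. blinfun_apply c (D (min b t) - D (min a t)))) {0<..t}"
    if "set xs \<subseteq> set (snd \<sigma>)" for xs
    using that
  proof (induction xs)
    case (Cons q xs)
    obtain a b c where q: "q = (a, b, c)" by (cases q) auto
    have "0 \<le> a" "a < b" using is_stepD[OF \<sigma>, of a b c] Cons.prems q by auto
    from has_sum_add[OF one[OF this, of c] Cons.IH] show ?case
      using Cons.prems by (simp add: q blinfun.add_left)
  qed simp
  have "((\<lambda>s. blinfun_apply (step_fun \<sigma> s) (jump g s)) has_sum step_integral D t \<sigma>) {0<..t}"
    unfolding step_integral_def
    by (rule has_sum_cong[THEN iffD1, OF _ all[OF order_refl]]) (simp add: step_fun_def)
  then show ?thesis by (simp add: D_def[abs_def])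
qed

lemma step_integral_minus_path:
  fixes \<sigma> :: "('h::real_normed_vector, 'g::real_normed_vector) step"
  shows "step_integral (\<lambda>u. g u - h u) t \<sigma> = step_integral g t \<sigma> - step_integral h t \<sigma>"
proof -
  have "(\<Sum>(a, b, c)\<leftarrow>xs. blinfun_apply c (g (min b t) - h (min b t) - (g (min a t) - h (min a t))))
      = (\<Sum>(a, b, c)\<leftarrow>xs. blinfun_apply c (g (min b t) - g (min a t)))
      - (\<Sum>(a, b, c)\<leftarrow>xs. blinfun_apply c (h (min b t) - h (min a t)))"
    for xs :: "(real \<times> real \<times> ('h \<Rightarrow>\<^sub>L 'g)) list"
    by (induction xs) (auto simp: blinfun.diff_right)
  then show ?thesis by (simp add: step_integral_def)
qed

text \<open>
  A step integral against the accumulated jumps is a sum over the jumps. It differs from the jump sum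
  of \<open>\<phi>\<close> by at most \<open>\<delta>\<close> times the total size of the jumps if the step is \<open>\<delta>\<close>-close to \<open>\<phi>\<close> on a compact
  set that contains them. Hence it converges along the filter, and so does the difference of the
  integrals against \<open>g\<close> and against its jumps.
\<close>

lemma stieltjes_limit_cont_part:
  fixes g :: "real \<Rightarrow> 'h::banach" and \<phi> :: "real \<Rightarrow> 'h \<Rightarrow>\<^sub>L 'g::banach"
  assumes nb: "step_approx \<phi> \<noteq> bot" and g: "cadlag g" "finite_variation g" and t: "0 \<le> t"
    and lim: "(step_integral g t \<longlongrightarrow> I) (step_approx \<phi>)"
  shows "(\<lambda>s. blinfun_apply (\<phi> s) (jump g s)) summable_on {0<..t}"
    and "(step_integral (cont_part g) t \<longlongrightarrow> I - (\<Sum>\<^sub>\<infinity>s\<in>{0<..t}. blinfun_apply (\<phi> s) (jump g s))) (step_approx \<phi>)"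
proof -
  obtain K where K: "compact K" "\<And>u. u \<in> {0..t} \<Longrightarrow> jump g u \<in> K"
    using cadlag_compact_increments[OF g(1)] by metis
  define V where "V = (\<Sum>\<^sub>\<infinity>s\<in>{0<..t}. norm (jump g s))"
  have V: "0 \<le> V" unfolding V_def by (intro infsum_nonneg) auto
  have V_sum: "((\<lambda>s. norm (jump g s)) has_sum V) {0<..t}"
    unfolding V_def by (intro has_sum_infsum jump_abs_summable g)
  define D where "D u = (\<Sum>\<^sub>\<infinity>s\<in>{0<..u}. jump g s)" for u
  let ?f = "\<lambda>s. blinfun_apply (\<phi> s) (jump g s)"
  let ?near = "\<lambda>\<delta> \<sigma>. is_step \<sigma> \<and> (\<forall>s\<in>{0..t}. rho K (\<phi> s - step_fun \<sigma> s) < \<delta>)"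
  have near_sum: "((\<lambda>s. blinfun_apply (\<phi> s - step_fun \<sigma> s) (jump g s)) summable_on {0<..t}) \<and>
      norm (\<Sum>\<^sub>\<infinity>s\<in>{0<..t}. blinfun_apply (\<phi> s - step_fun \<sigma> s) (jump g s)) \<le> \<delta> * V"
    if \<sigma>: "?near \<delta> \<sigma>" for \<delta> \<sigma>
  proof -
    have le: "norm (blinfun_apply (\<phi> s - step_fun \<sigma> s) (jump g s)) \<le> \<delta> * norm (jump g s)" if "s \<in> {0<..t}" for s
      using that \<sigma> by (intro rho_lessD[of K] K) auto
    have bound: "((\<lambda>s. \<delta> * norm (jump g s)) has_sum \<delta> * V) {0<..t}"
      by (rule has_sum_cmult_right[OF V_sum])
    have summ: "(\<lambda>s. norm (blinfun_apply (\<phi> s - step_fun \<sigma> s) (jump g s))) summable_on {0<..t}"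
      using summable_on_comparison_test[OF has_sum_imp_summable[OF bound], of "\<lambda>s. norm (blinfun_apply (\<phi> s - step_fun \<sigma> s) (jump g s))"]
        le by simp
    have "norm (\<Sum>\<^sub>\<infinity>s\<in>{0<..t}. blinfun_apply (\<phi> s - step_fun \<sigma> s) (jump g s))
        \<le> (\<Sum>\<^sub>\<infinity>s\<in>{0<..t}. norm (blinfun_apply (\<phi> s - step_fun \<sigma> s) (jump g s)))"
      by (rule norm_infsum_bound[OF summ])
    also have "\<dots> \<le> \<delta> * V"
      by (rule has_sum_mono[OF has_sum_infsum[OF summ] bound le])
    finally show ?thesis using abs_summable_summable[OF summ] by simp
  qed
  have step_sum: "((\<lambda>s. blinfun_apply (step_fun \<sigma> s) (jump g s)) has_sum step_integral D t \<sigma>) {0<..t}"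
    if "is_step \<sigma>" for \<sigma> :: "('h, 'g) step"
    using has_sum_step_integral_jumps[OF g t that] by (simp add: D_def[abs_def])
  have sum_diff: "?f summable_on {0<..t} \<and> (\<Sum>\<^sub>\<infinity>s\<in>{0<..t}. ?f s) - step_integral D t \<sigma>
      = (\<Sum>\<^sub>\<infinity>s\<in>{0<..t}. blinfun_apply (\<phi> s - step_fun \<sigma> s) (jump g s))" if \<sigma>: "?near \<delta> \<sigma>" for \<delta> \<sigma>
  proof -
    have "((\<lambda>s. blinfun_apply (\<phi> s - step_fun \<sigma> s) (jump g s) + blinfun_apply (step_fun \<sigma> s) (jump g s)) has_sum
        ((\<Sum>\<^sub>\<infinity>s\<in>{0<..t}. blinfun_apply (\<phi> s - step_fun \<sigma> s) (jump g s)) + step_integral D t \<sigma>)) {0<..t}"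
      using near_sum[OF \<sigma>] step_sum \<sigma> by (intro has_sum_add has_sum_infsum) auto
    then have "(?f has_sum
        ((\<Sum>\<^sub>\<infinity>s\<in>{0<..t}. blinfun_apply (\<phi> s - step_fun \<sigma> s) (jump g s)) + step_integral D t \<sigma>)) {0<..t}"
      by (simp add: blinfun.diff_left)
    from infsumI[OF this] has_sum_imp_summable[OF this] show ?thesis by simp
  qed
  have ev: "eventually (?near \<delta>) (step_approx \<phi>)" if "0 < \<delta>" for \<delta>
    by (rule eventually_step_approx[OF K(1) t that])
  have "\<exists>\<sigma>. ?near 1 \<sigma>"
    using eventually_happens'[OF nb ev[of 1]] by simp
  then show "?f summable_on {0<..t}" using sum_diff by blast
  have "(step_integral D t \<longlongrightarrow> (\<Sum>\<^sub>\<infinity>s\<in>{0<..t}. ?f s)) (step_approx \<phi>)"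
  proof (rule tendstoI)
    fix e :: real assume e: "0 < e"
    define \<delta> where "\<delta> = e / (V + 1)"
    have \<delta>: "0 < \<delta>" "\<delta> * V < e"
      using e V by (auto simp: \<delta>_def field_simps)
    from ev[OF \<delta>(1)] show "eventually (\<lambda>\<sigma>. dist (step_integral D t \<sigma>) (\<Sum>\<^sub>\<infinity>s\<in>{0<..t}. ?f s) < e) (step_approx \<phi>)"
    proof eventually_elim
      case (elim \<sigma>)
      then show ?case
        using sum_diff[OF elim] near_sum[OF elim] \<delta>(2)
        unfolding dist_norm by (subst norm_minus_commute) simp
    qed
  qed
  from tendsto_diff[OF lim this]
  show "(step_integral (cont_part g) t \<longlongrightarrow> I - (\<Sum>\<^sub>\<infinity>s\<in>{0<..t}. ?f s)) (step_approx \<phi>)"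
  proof -
    have "step_integral (cont_part g) t = (\<lambda>\<sigma> :: ('h, 'g) step. step_integral g t \<sigma> - step_integral D t \<sigma>)"
      by (rule ext) (simp add: cont_part_def[abs_def] D_def[abs_def] step_integral_minus_path)
    with \<open>((\<lambda>\<sigma>. step_integral g t \<sigma> - step_integral D t \<sigma>) \<longlongrightarrow> _) _\<close> show ?thesis by simp
  qed
qed


section \<open>Partitions\<close>

lemma partition_enum:
  assumes "is_partition P"
  obtains \<tau> :: "nat \<Rightarrow> real" and k :: nat where "\<tau> 0 = 0" "strict_mono \<tau>"
    "P = range (\<lambda>i. (\<tau> i, \<tau> (Suc i)))" "\<And>i. \<tau> i < t \<longleftrightarrow> i < k"
proof -
  obtain \<tau> :: "nat \<Rightarrow> real" where \<tau>: "\<tau> 0 = 0" "strict_mono \<tau>"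
    "filterlim \<tau> at_top sequentially" "P = range (\<lambda>i. (\<tau> i, \<tau> (Suc i)))"
    using assms unfolding is_partition_def by blast
  have "eventually (\<lambda>i. t \<le> \<tau> i) sequentially"
    using \<tau>(3) by (simp add: filterlim_at_top)
  then obtain i0 where i0: "t \<le> \<tau> i0" by (auto simp: eventually_sequentially)
  define k where "k = (LEAST i. t \<le> \<tau> i)"
  have k: "t \<le> \<tau> k" unfolding k_def by (rule LeastI[of _ i0]) fact
  have "\<tau> i < t \<longleftrightarrow> i < k" for i
  proof
    assume "i < k"
    then show "\<tau> i < t" using not_less_Least[of i "\<lambda>i. t \<le> \<tau> i"] by (simp add: k_def)
  next
    assume "\<tau> i < t"
    then have "\<tau> i < \<tau> k" using k by simp
    then show "i < k" using strict_mono_less[OF \<tau>(2)] by simp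
  qed
  then show ?thesis using that \<tau> by metis
qed

lemma cell_eqI:
  assumes P: "is_partition P" and rs: "(r, s) \<in> P" "r < t" "t \<le> s"
  shows "cell P t = (r, s)"
proof -
  obtain \<tau> :: "nat \<Rightarrow> real" and k where \<tau>: "\<tau> 0 = 0" "strict_mono \<tau>"
    "P = range (\<lambda>i. (\<tau> i, \<tau> (Suc i)))" "\<And>i. \<tau> i < t \<longleftrightarrow> i < k"
    using partition_enum[OF P, where t = t] by blast
  have idx: "i = k - 1" if "\<tau> i < t" "t \<le> \<tau> (Suc i)" for i
    using \<tau>(4)[of i] \<tau>(4)[of "Suc i"] that by auto
  obtain i where i: "(r, s) = (\<tau> i, \<tau> (Suc i))" using rs(1) unfolding \<tau>(3) by blast
  have "i = k - 1" using idx[of i] rs i by simp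
  show ?thesis
    unfolding cell_def
  proof (rule the_equality)
    show "(r, s) \<in> P \<and> t \<in> {fst (r, s)<..snd (r, s)}" using rs by simp
    fix I assume I: "I \<in> P \<and> t \<in> {fst I<..snd I}"
    then obtain j where "I = (\<tau> j, \<tau> (Suc j))" unfolding \<tau>(3) by blast
    then show "I = (r, s)" using idx[of j] I i \<open>i = k - 1\<close> by simp
  qed
qed

lemma cell_mem:
  assumes P: "is_partition P" and t: "0 < t"
  shows "cell P t \<in> P" "lower_pt P t < t" "t \<le> upper_pt P t"
proof -
  obtain \<tau> :: "nat \<Rightarrow> real" and k where \<tau>: "\<tau> 0 = 0" "strict_mono \<tau>"
    "P = range (\<lambda>i. (\<tau> i, \<tau> (Suc i)))" "\<And>i. \<tau> i < t \<longleftrightarrow> i < k"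
    using partition_enum[OF P, where t = t] by blast
  have "0 < k" using \<tau>(4)[of 0] \<tau>(1) t by simp
  then have "\<tau> (k - 1) < t" "t \<le> \<tau> (Suc (k - 1))"
    using \<tau>(4)[of "k - 1"] \<tau>(4)[of k] by auto
  moreover have "(\<tau> (k - 1), \<tau> (Suc (k - 1))) \<in> P" unfolding \<tau>(3) by blast
  ultimately have "cell P t = (\<tau> (k - 1), \<tau> (Suc (k - 1)))" using cell_eqI[OF P] by blast
  then show "cell P t \<in> P" "lower_pt P t < t" "t \<le> upper_pt P t"
    using \<open>(\<tau> (k - 1), \<tau> (Suc (k - 1))) \<in> P\<close> \<open>\<tau> (k - 1) < t\<close> \<open>t \<le> \<tau> (Suc (k - 1))\<close> by simp_all
qed

lemma partition_cell_order:
  assumes "is_partition P" "(r, s) \<in> P"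
  shows "0 \<le> r" "r < s"
proof -
  obtain \<tau> :: "nat \<Rightarrow> real" where \<tau>: "\<tau> 0 = 0" "strict_mono \<tau>" "P = range (\<lambda>i. (\<tau> i, \<tau> (Suc i)))"
    using partition_enum[OF assms(1)] by blast
  obtain i where "r = \<tau> i" "s = \<tau> (Suc i)" using assms(2) unfolding \<tau>(3) by blast
  then show "0 \<le> r" "r < s"
    using strict_mono_less_eq[OF \<tau>(2), of 0 i] strict_mono_less[OF \<tau>(2), of i "Suc i"] \<tau>(1) by auto
qed

lemma partition_sum_enum:
  assumes "strict_mono \<tau>" "P = range (\<lambda>i. (\<tau> i, \<tau> (Suc i)))" "\<And>i. \<tau> i < t \<longleftrightarrow> i < k"
  shows "partition_sum P t h = (\<Sum>i<k. h (\<tau> i) (\<tau> (Suc i)))"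
proof -
  have eq: "{(r, s). (r, s) \<in> P \<and> r < t} = (\<lambda>i. (\<tau> i, \<tau> (Suc i))) ` {..<k}"
    using assms(2,3) by auto
  have "inj_on (\<lambda>i. (\<tau> i, \<tau> (Suc i))) {..<k}"
    using strict_mono_eq[OF assms(1)] by (auto simp: inj_on_def)
  then show ?thesis unfolding partition_sum_def eq by (simp add: sum.reindex)
qed

lemma finite_partition_cells:
  assumes "is_partition P"
  shows "finite {(r, s). (r, s) \<in> P \<and> r < t}"
proof -
  obtain \<tau> :: "nat \<Rightarrow> real" and k where \<tau>:
    "P = range (\<lambda>i. (\<tau> i, \<tau> (Suc i)))" "\<And>i. \<tau> i < t \<longleftrightarrow> i < k"
    using partition_enum[OF assms] by blast
  have "{(r, s). (r, s) \<in> P \<and> r < t} \<subseteq> (\<lambda>i. (\<tau> i, \<tau> (Suc i))) ` {..<k}"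
    using \<tau> by auto
  then show ?thesis by (rule finite_subset) simp
qed

lemma partition_sum_cong:
  "(\<And>r s. (r, s) \<in> P \<Longrightarrow> r < t \<Longrightarrow> h r s = h' r s) \<Longrightarrow> partition_sum P t h = partition_sum P t h'"
  unfolding partition_sum_def by (intro sum.cong) auto

lemma partition_sum_add:
  "partition_sum P t (\<lambda>r s. h r s + k r s) = partition_sum P t h + partition_sum P t k"
  unfolding partition_sum_def by (simp add: case_prod_unfold sum.distrib)

lemma partition_sum_diff:
  fixes h :: "real \<Rightarrow> real \<Rightarrow> 'a::ab_group_add"
  shows "partition_sum P t (\<lambda>r s. h r s - k r s) = partition_sum P t h - partition_sum P t k"
  unfolding partition_sum_def by (simp add: case_prod_unfold sum_subtractf)

lemma partition_sum_scaleR: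
  fixes h :: "real \<Rightarrow> real \<Rightarrow> 'a::real_vector"
  shows "partition_sum P t (\<lambda>r s. c *\<^sub>R h r s) = c *\<^sub>R partition_sum P t h"
  unfolding partition_sum_def case_prod_unfold by (rule scaleR_right.sum[symmetric])

lemma partition_sum_cmult:
  "partition_sum P t (\<lambda>r s. c * h r s) = (c::real) * partition_sum P t h"
  unfolding partition_sum_def by (simp add: case_prod_unfold sum_distrib_left)

lemma partition_sum_blinfun:
  "partition_sum P t (\<lambda>r s. blinfun_apply c (h r s)) = blinfun_apply c (partition_sum P t h)"
  unfolding partition_sum_def by (simp add: case_prod_unfold blinfun.sum_right)

lemma partition_sum_sum:
  "partition_sum P t (\<lambda>r s. \<Sum>i\<in>I. h i r s) = (\<Sum>i\<in>I. partition_sum P t (h i))"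
  unfolding partition_sum_def case_prod_unfold by (rule sum.swap)

lemma partition_sum_norm_le:
  "(\<And>r s. (r, s) \<in> P \<Longrightarrow> r < t \<Longrightarrow> norm (h r s) \<le> k r s) \<Longrightarrow> norm (partition_sum P t h) \<le> partition_sum P t k"
  unfolding partition_sum_def by (intro sum_norm_le) auto

lemma partition_sum_mono:
  fixes h k :: "real \<Rightarrow> real \<Rightarrow> real"
  shows "(\<And>r s. (r, s) \<in> P \<Longrightarrow> r < t \<Longrightarrow> h r s \<le> k r s) \<Longrightarrow> partition_sum P t h \<le> partition_sum P t k"
  unfolding partition_sum_def by (intro sum_mono) auto

lemma partition_sum_telescope:
  fixes g :: "real \<Rightarrow> 'a::ab_group_add"
  assumes P: "is_partition P" and t: "0 \<le> t"
  shows "partition_sum P t (\<lambda>r s. g (min s t) - g (min r t)) = g t - g 0"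
proof -
  obtain \<tau> :: "nat \<Rightarrow> real" and k where \<tau>: "\<tau> 0 = 0" "strict_mono \<tau>"
    "P = range (\<lambda>i. (\<tau> i, \<tau> (Suc i)))" "\<And>i. \<tau> i < t \<longleftrightarrow> i < k"
    using partition_enum[OF P, where t = t] by blast
  have "t \<le> \<tau> k" using \<tau>(4)[of k] by simp
  then show ?thesis
    unfolding partition_sum_enum[OF \<tau>(2-4)]
    using sum_lessThan_telescope[of "\<lambda>i. g (min (\<tau> i) t)" k] \<tau>(1) t by (simp add: min_def)
qed

text \<open>
  The sum up to time \<open>t\<close> splits at an earlier time \<open>a\<close> up to the contribution of the interval that
  straddles \<open>a\<close>, which the sum up to time \<open>a\<close> cuts off at \<open>a\<close>.
\<close>

lemma partition_sum_from:
  fixes H :: "real \<Rightarrow> real \<Rightarrow> 'a::ab_group_add"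
  assumes P: "is_partition P" and a: "0 < a" "a < t"
  shows "partition_sum P t (\<lambda>r s. if a \<le> r then H (min r t) (min s t) else 0) =
    partition_sum P t (\<lambda>r s. H (min r t) (min s t)) - partition_sum P a (\<lambda>r s. H (min r a) (min s a))
    - (H (lower_pt P a) (min (upper_pt P a) t) - H (lower_pt P a) a)"
proof -
  obtain \<tau> :: "nat \<Rightarrow> real" and k where \<tau>: "\<tau> 0 = 0" "strict_mono \<tau>"
    "P = range (\<lambda>i. (\<tau> i, \<tau> (Suc i)))" "\<And>i. \<tau> i < t \<longleftrightarrow> i < k"
    using partition_enum[OF P, where t = t] by blast
  obtain j where j: "cell P a = (\<tau> j, \<tau> (Suc j))" "\<tau> j < a" "a \<le> \<tau> (Suc j)"
    using cell_mem[OF P a(1)] unfolding \<tau>(3) by auto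
  have ja: "\<tau> i < a \<longleftrightarrow> i < Suc j" for i
    using j strict_mono_less_eq[OF \<tau>(2), of i j] strict_mono_less_eq[OF \<tau>(2), of "Suc j" i]
    by (cases "i \<le> j") auto
  have "j < k" using \<tau>(4)[of j] j a by simp
  define S where "S = (\<Sum>i<j. H (\<tau> i) (\<tau> (Suc i)))"
  have less: "\<tau> (Suc i) < a" if "i < j" for i using ja[of "Suc i"] that by simp
  have less': "\<tau> i < a" if "i < j" for i using ja[of i] that by simp
  have sum_a: "partition_sum P a (\<lambda>r s. H (min r a) (min s a)) = S + H (\<tau> j) a"
    unfolding partition_sum_enum[OF \<tau>(2,3) ja] S_def
    using less less' j by (simp add: min_def less_le)
  let ?h = "\<lambda>i. H (min (\<tau> i) t) (min (\<tau> (Suc i)) t)"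
  have split: "{..<k} = {..<j} \<union> insert j {Suc j..<k}" using \<open>j < k\<close> by auto
  have "(\<Sum>i<k. ?h i) = (\<Sum>i<j. ?h i) + (?h j + (\<Sum>i\<in>{Suc j..<k}. ?h i))"
    unfolding split by (subst sum.union_disjoint) auto
  moreover have "(\<Sum>i<j. ?h i) = S"
    unfolding S_def
  proof (intro sum.cong refl)
    fix i assume "i \<in> {..<j}"
    then show "?h i = H (\<tau> i) (\<tau> (Suc i))"
      using less[of i] less'[of i] a by (simp add: min_absorb1)
  qed
  moreover have "?h j = H (\<tau> j) (min (\<tau> (Suc j)) t)"
    using j a by (simp add: min_absorb1)
  ultimately have sum_t: "partition_sum P t (\<lambda>r s. H (min r t) (min s t))
      = S + (H (\<tau> j) (min (\<tau> (Suc j)) t) + (\<Sum>i\<in>{Suc j..<k}. ?h i))"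
    unfolding partition_sum_enum[OF \<tau>(2-4)] by simp
  have "(\<Sum>i<k. if a \<le> \<tau> i then ?h i else 0) = (\<Sum>i\<in>{Suc j..<k}. ?h i)"
  proof -
    have ja': "a \<le> \<tau> i \<longleftrightarrow> Suc j \<le> i" for i using ja[of i] by linarith
    show ?thesis unfolding ja' by (rule sum.mono_neutral_cong_right) auto
  qed
  then have "partition_sum P t (\<lambda>r s. if a \<le> r then H (min r t) (min s t) else 0) = (\<Sum>i\<in>{Suc j..<k}. ?h i)"
    unfolding partition_sum_enum[OF \<tau>(2-4)] .
  then show ?thesis unfolding sum_a sum_t by (simp add: j)
qed

lemma partition_sum_increments_le:
  fixes g :: "real \<Rightarrow> 'a::real_normed_vector"
  assumes P: "is_partition P" and t: "0 \<le> t" and v: "dominates_increments v g"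
  shows "partition_sum P t (\<lambda>r s. norm (g (min s t) - g (min r t))) \<le> v t - v 0"
  unfolding partition_sum_telescope[OF P t, of v, symmetric]
proof (rule partition_sum_mono)
  fix r s assume "(r, s) \<in> P" "r < t"
  then show "norm (g (min s t) - g (min r t)) \<le> v (min s t) - v (min r t)"
    using partition_cell_order[OF P, of r s] by (intro dominates_incrementsD[OF v]) auto
qed

section \<open>Left-point sums\<close>

text \<open>
  If the partition intervals containing \<open>u\<close> do not shrink to \<open>u\<close> from the right, then infinitely often
  a fixed right neighbourhood of \<open>u\<close> shares its left end point with \<open>u\<close>. Approximation from the left
  then forces all left limits in that neighbourhood to coincide.
\<close>

lemma path_constant_of_upper_pt_not_convergent:
  fixes Z :: "real \<Rightarrow> 'a::real_normed_vector"
  assumes P: "\<And>n. is_partition (\<pi> n)" and Z: "cadlag Z" and left: "approximates_from_left \<pi> Z"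
    and u: "0 < u" and bad: "\<not> (\<lambda>n. upper_pt (\<pi> n) u) \<longlonglongrightarrow> u"
  shows "\<exists>v>u. \<forall>w\<in>{u..<v}. Z w = left_lim Z u"
proof -
  obtain e where e: "0 < e" "\<not> eventually (\<lambda>n. dist (upper_pt (\<pi> n) u) u < e) sequentially"
    using bad unfolding tendsto_iff by blast
  have L: "left_lim Z w = left_lim Z u" if w: "u < w" "w < u + e" for w
  proof (rule ccontr)
    assume ne: "left_lim Z w \<noteq> left_lim Z u"
    have "(\<lambda>n. Z (lower_pt (\<pi> n) w) - Z (lower_pt (\<pi> n) u)) \<longlonglongrightarrow> left_lim Z w - left_lim Z u"
      using left w u unfolding approximates_from_left_def by (intro tendsto_diff) auto
    from tendsto_imp_eventually_ne[OF this, of 0] ne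
    have "eventually (\<lambda>n. Z (lower_pt (\<pi> n) w) \<noteq> Z (lower_pt (\<pi> n) u)) sequentially" by simp
    then have "eventually (\<lambda>n. dist (upper_pt (\<pi> n) u) u < e) sequentially"
    proof eventually_elim
      case (elim n)
      show ?case
      proof (rule ccontr)
        assume "\<not> dist (upper_pt (\<pi> n) u) u < e"
        then have "w \<le> upper_pt (\<pi> n) u" using cell_mem(3)[OF P u, of n] w by (auto simp: dist_norm)
        then have "cell (\<pi> n) w = cell (\<pi> n) u"
          using cell_eqI[OF P, of "lower_pt (\<pi> n) u" "upper_pt (\<pi> n) u" n w] cell_mem[OF P u, of n] w by simp
        then show False using elim by simp
      qed
    qed
    then show False using e by simp
  qed
  have "Z w = left_lim Z u" if w: "u \<le> w" "w < u + e" for w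
  proof -
    have "(left_lim Z \<longlongrightarrow> Z w) (at_right w)"
      using w u by (intro left_lim_tendsto_right Z) auto
    moreover have "eventually (\<lambda>x. left_lim Z x = left_lim Z u) (at_right w)"
      unfolding eventually_at_right_field using L w by (intro exI[of _ "u + e"]) auto
    then have "(left_lim Z \<longlongrightarrow> left_lim Z u) (at_right w)"
      by (simp add: tendsto_eventually)
    ultimately show ?thesis using tendsto_unique[of "at_right w"] by auto
  qed
  then show ?thesis using e by (intro exI[of _ "u + e"]) auto
qed

text \<open>Left limits inherit the closeness to \<open>Z (a k)\<close> on an interval closed on the right, as a step
  that is left continuous requires.\<close>

lemma continuous_image_subdivision:
  fixes Z :: "real \<Rightarrow> 'z::banach"
    and \<Phi> :: "'z \<Rightarrow> 'h::real_normed_vector \<Rightarrow>\<^sub>L 'g::real_normed_vector"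
  assumes Z: "cadlag Z" and \<Phi>: "continuous_map euclidean Lc_topology \<Phi>" and K: "compact K"
    and t: "0 \<le> t" and e: "0 < e"
    and flat: "\<And>u. 0 < u \<Longrightarrow> u < t \<Longrightarrow> \<not> good u \<Longrightarrow> \<exists>v>u. \<forall>w\<in>{u..<v}. Z w = left_lim Z u"
  obtains N :: nat and a where "a 0 = 0" "a N = t" "\<And>k. k < N \<Longrightarrow> a k < a (Suc k)"
    "\<And>k. 0 < k \<Longrightarrow> k < N \<Longrightarrow> good (a k)"
    "\<And>k s. k < N \<Longrightarrow> a k \<le> s \<Longrightarrow> s < a (Suc k) \<Longrightarrow> rho K (\<Phi> (Z s) - \<Phi> (Z (a k))) < e"
    "\<And>k s. k < N \<Longrightarrow> a k < s \<Longrightarrow> s \<le> a (Suc k) \<Longrightarrow> rho K (\<Phi> (left_lim Z s) - \<Phi> (Z (a k))) < e"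
proof -
  obtain \<delta> where \<delta>: "0 < \<delta>"
    "\<And>z z'. z \<in> closure (Z ` {0..t}) \<Longrightarrow> dist z z' < \<delta> \<Longrightarrow> rho K (\<Phi> z' - \<Phi> z) < e"
    using continuous_map_Lc_uniform[OF \<Phi> cadlag_compact_range[OF Z] K e] by blast
  have "0 < \<delta> / 2" using \<delta> by simp
  from cadlag_subdivision[OF Z t this flat] obtain N :: nat and a where
    a: "a 0 = 0" "a N = t" "\<And>k. k < N \<Longrightarrow> a k < a (Suc k)"
    "\<And>k s. k < N \<Longrightarrow> a k \<le> s \<Longrightarrow> s < a (Suc k) \<Longrightarrow> norm (Z s - Z (a k)) \<le> \<delta> / 2"
    "\<And>k. 0 < k \<Longrightarrow> k < N \<Longrightarrow> good (a k)" by blast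
  have a_in: "0 \<le> a k" "a k \<le> t" if "k \<le> N" for k
    using subdivision_mono[of N a 0 k] subdivision_mono[of N a k N] a that by auto
  have mem: "Z (a k) \<in> closure (Z ` {0..t})" if "k < N" for k
    using a_in[of k] that by (intro closure_subset[THEN subsetD] imageI) auto
  show ?thesis
  proof (rule that[OF a(1,2,3,5)])
    fix k s assume k: "k < N" "a k \<le> s" "s < a (Suc k)"
    then show "rho K (\<Phi> (Z s) - \<Phi> (Z (a k))) < e"
      using a(4)[OF k] \<delta>(1) by (intro \<delta>(2)[OF mem]) (auto simp: dist_norm norm_minus_commute)
  next
    fix k s assume k: "k < N" "a k < s" "s \<le> a (Suc k)"
    have "left_lim Z s \<in> cball (Z (a k)) (\<delta> / 2)"
      by (rule left_lim_in_closed[OF Z _ _ k(2)])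
         (use a(4)[OF k(1)] a_in(1)[of k] k in \<open>auto simp: dist_norm norm_minus_commute\<close>)
    then show "rho K (\<Phi> (left_lim Z s) - \<Phi> (Z (a k))) < e"
      using \<delta>(1) k(1) by (intro \<delta>(2)[OF mem]) auto
  qed simp
qed

definition subdivision_step :: "nat \<Rightarrow> (nat \<Rightarrow> real) \<Rightarrow> (nat \<Rightarrow> 'h::real_normed_vector \<Rightarrow>\<^sub>L 'g::real_normed_vector) \<Rightarrow> ('h, 'g) step" where
  "subdivision_step N a c = (c 0, map (\<lambda>k. (a k, a (Suc k), c k)) [0..<N])"

lemma subdivision_interval_unique:
  fixes a :: "nat \<Rightarrow> real"
  assumes "\<And>k. k < N \<Longrightarrow> a k < a (Suc k)" "j < N" "k < N"
    "a k < s \<and> s \<le> a (Suc k) \<and> a j < s \<and> s \<le> a (Suc j) \<or> a k \<le> s \<and> s < a (Suc k) \<and> a j \<le> s \<and> s < a (Suc j)"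
  shows "j = k"
proof (rule ccontr)
  assume "j \<noteq> k"
  then consider "Suc j \<le> k" | "Suc k \<le> j" by linarith
  then show False
  proof cases
    case 1
    then have "a (Suc j) \<le> a k" using assms(1,3) by (intro subdivision_mono[of N]) auto
    then show False using assms(4) by auto
  next
    case 2
    then have "a (Suc k) \<le> a j" using assms(1,2) by (intro subdivision_mono[of N]) auto
    then show False using assms(4) by auto
  qed
qed

lemma is_step_subdivision:
  assumes "a 0 = 0" "\<And>k. k < N \<Longrightarrow> a k < a (Suc k)"
  shows "is_step (subdivision_step N a c)"
proof -
  have "0 \<le> a k" if "k < N" for k
    using subdivision_mono[of N a 0 k] assms that by simp
  then show ?thesis using assms(2) by (auto simp: is_step_def subdivision_step_def)
qed

lemma step_fun_subdivision:
  assumes a: "a 0 = 0" "\<And>k. k < N \<Longrightarrow> a k < a (Suc k)" and k: "k < N" "a k < s" "s \<le> a (Suc k)"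
  shows "step_fun (subdivision_step N a c) s = c k"
proof -
  have "0 < s" using subdivision_mono[of N a 0 k] a k by auto
  then have "step_fun (subdivision_step N a c) s = (\<Sum>j<N. indicat_real {a j<..a (Suc j)} s *\<^sub>R c j)"
    by (simp add: step_fun_def subdivision_step_def o_def sum_list_distinct_conv_sum_set lessThan_atLeast0)
  also have "\<dots> = (\<Sum>j<N. if j = k then c k else 0)"
    using k subdivision_interval_unique[of N a _ k s] a(2)
    by (intro sum.cong) (auto simp: indicator_def)
  finally show ?thesis using k by simp
qed

lemma step_fun_subdivision_0:
  assumes a: "a 0 = 0" "\<And>k. k < N \<Longrightarrow> a k < a (Suc k)"
  shows "step_fun (subdivision_step N a c) 0 = c 0"
proof -
  have "indicat_real {a j<..a (Suc j)} 0 = 0" if "j < N" for j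
    using subdivision_mono[of N a 0 j] a that by (auto simp: indicator_def)
  then show ?thesis
    by (simp add: step_fun_def subdivision_step_def o_def sum_list_distinct_conv_sum_set)
qed

lemma step_integral_subdivision:
  assumes a: "a 0 = 0" "a N = t" "\<And>k. k < N \<Longrightarrow> a k < a (Suc k)"
  shows "step_integral G t (subdivision_step N a c) = (\<Sum>k<N. blinfun_apply (c k) (G (a (Suc k)) - G (a k)))"
proof -
  have le: "a k \<le> t" if "k \<le> N" for k
    using subdivision_mono[of N a k N] a that by auto
  have "step_integral G t (subdivision_step N a c)
      = (\<Sum>k<N. blinfun_apply (c k) (G (min (a (Suc k)) t) - G (min (a k) t)))"
    by (simp add: step_integral_def subdivision_step_def o_def sum_list_distinct_conv_sum_set lessThan_atLeast0)
  also have "\<dots> = (\<Sum>k<N. blinfun_apply (c k) (G (a (Suc k)) - G (a k)))"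
    using le by (intro sum.cong) (auto simp: min_absorb1)
  finally show ?thesis .
qed

lemma subdivision_step_close:
  fixes Z :: "real \<Rightarrow> 'z::t2_space"
    and \<Phi> :: "'z \<Rightarrow> 'h::real_normed_vector \<Rightarrow>\<^sub>L 'g::real_normed_vector"
  assumes a: "a 0 = 0" "a N = t" "\<And>k. k < N \<Longrightarrow> a k < a (Suc k)" and e: "0 < e"
    and close: "\<And>k s. k < N \<Longrightarrow> a k < s \<Longrightarrow> s \<le> a (Suc k) \<Longrightarrow> rho K (\<Phi> (left_lim Z s) - \<Phi> (Z (a k))) < e"
    and s: "s \<in> {0..t}"
  shows "rho K (\<Phi> (left_lim Z s) - step_fun (subdivision_step N a (\<lambda>k. \<Phi> (Z (a k)))) s) < e"
proof (cases "s = 0")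
  case True
  have "step_fun (subdivision_step N a (\<lambda>k. \<Phi> (Z (a k)))) 0 = \<Phi> (Z (a 0))"
    by (rule step_fun_subdivision_0[OF a(1,3)])
  with True show ?thesis using a(1) e by (simp add: rho_0)
next
  case False
  then obtain k where k: "k < N" "a k < s" "s \<le> a (Suc k)"
    using subdivision_locate'[of a s N] a s by auto
  have "step_fun (subdivision_step N a (\<lambda>k. \<Phi> (Z (a k)))) s = \<Phi> (Z (a k))"
    by (rule step_fun_subdivision[OF a(1,3) k])
  with close[OF k] show ?thesis by simp
qed

lemma step_approx_left_lim_neq_bot:
  fixes Z :: "real \<Rightarrow> 'z::banach"
    and \<Phi> :: "'z \<Rightarrow> 'h::real_normed_vector \<Rightarrow>\<^sub>L 'g::real_normed_vector"
  assumes Z: "cadlag Z" and \<Phi>: "continuous_map euclidean Lc_topology \<Phi>"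
  shows "step_approx (\<lambda>s. \<Phi> (left_lim Z s)) \<noteq> bot"
proof (rule step_approx_neq_bot)
  fix K :: "'h set" and T \<delta> :: real assume K: "compact K" "0 \<le> T" "0 < \<delta>"
  obtain N a where a: "a 0 = 0" "a N = T" "\<And>k. k < N \<Longrightarrow> a k < a (Suc k)"
    "\<And>k s. k < N \<Longrightarrow> a k < s \<Longrightarrow> s \<le> a (Suc k) \<Longrightarrow> rho K (\<Phi> (left_lim Z s) - \<Phi> (Z (a k))) < \<delta>"
    by (rule continuous_image_subdivision[OF Z \<Phi> K, of "\<lambda>_. True"]) auto
  show "\<exists>\<sigma>. is_step \<sigma> \<and> (\<forall>s\<in>{0..T}. rho K (\<Phi> (left_lim Z s) - step_fun \<sigma> s) < \<delta>)"
    using is_step_subdivision[of a N] subdivision_step_close[OF a(1-3) K(3) a(4)] a(1,3) by blast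
qed

text \<open>
  The integrand is frozen at finitely many good times \<open>a\<^sub>k\<close>, uniformly up to \<open>\<eta>\<close>. The frozen sums
  converge by hypothesis, and the freezing error is at most \<open>\<eta> * C\<close> in norm for every partition of
  the sequence. This uniformity lets a merely weak convergence of the sums of the increments pass to
  the weighted sums.
\<close>

theorem left_point_sums_converge:
  fixes Z :: "real \<Rightarrow> 'z::banach" and G :: "real \<Rightarrow> 'h::real_normed_vector"
    and \<Phi> :: "'z \<Rightarrow> 'h \<Rightarrow>\<^sub>L 'g::real_normed_vector"
    and h :: "nat \<Rightarrow> real \<Rightarrow> real \<Rightarrow> 'h"
  assumes P: "\<And>n. is_partition (\<pi> n)" and Z: "cadlag Z" and left: "approximates_from_left \<pi> Z"
    and \<Phi>: "continuous_map euclidean Lc_topology \<Phi>" and t: "0 \<le> t"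
    and K: "compact K" and h_K: "\<And>n r s. (r, s) \<in> \<pi> n \<Longrightarrow> r < t \<Longrightarrow> h n r s \<in> K"
    and h_C: "\<And>n. partition_sum (\<pi> n) t (\<lambda>r s. norm (h n r s)) \<le> C"
    and v: "dominates_increments v G"
    and G_K: "\<And>u w. u \<in> {0..t} \<Longrightarrow> w \<in> {0..t} \<Longrightarrow> G u - G w \<in> K"
    and start: "limitin (mode_topology m) (\<lambda>n. partition_sum (\<pi> n) t (h n)) (G t - G 0) sequentially"
    and later: "\<And>a. 0 < a \<Longrightarrow> a < t \<Longrightarrow> (\<lambda>n. upper_pt (\<pi> n) a) \<longlonglongrightarrow> a \<Longrightarrow>
      limitin (mode_topology m) (\<lambda>n. partition_sum (\<pi> n) t (\<lambda>r s. if a \<le> r then h n r s else 0))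
        (G t - G a) sequentially"
    and I: "(step_integral G t \<longlongrightarrow> I) (step_approx (\<lambda>s. \<Phi> (left_lim Z s)))"
  shows "limitin (mode_topology m)
    (\<lambda>n. partition_sum (\<pi> n) t (\<lambda>r s. blinfun_apply (\<Phi> (Z r)) (h n r s))) I sequentially"
proof (rule mode_limit_approx)
  fix e :: real assume e: "0 < e"
  define V where "V = v t - v 0"
  have V: "0 \<le> V" using dominates_increments_mono[OF v, of 0 t] t by (simp add: V_def)
  have C: "0 \<le> C"
    using order_trans[OF _ h_C[of 0]] unfolding partition_sum_def by (simp add: sum_nonneg case_prod_unfold)
  define \<eta> where "\<eta> = e / (C + 2 * V + 1)"
  have den: "0 < C + 2 * V + 1" using C V by linarith
  have \<eta>: "0 < \<eta>" using e den by (simp add: \<eta>_def)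
  have \<eta>e: "\<eta> * (C + 2 * V + 1) = e" using den by (simp add: \<eta>_def)
  have \<eta>C: "\<eta> * C \<le> e" and \<eta>V: "(2 * \<eta>) * V \<le> e"
  proof -
    have "0 \<le> \<eta> * C" "0 \<le> \<eta> * V" using \<eta> C V by simp_all
    moreover have "\<eta> * C + 2 * (\<eta> * V) + \<eta> = e" using \<eta>e by (simp add: algebra_simps)
    ultimately show "\<eta> * C \<le> e" "(2 * \<eta>) * V \<le> e" using \<eta> by linarith+
  qed
  obtain N :: nat and a where a: "a 0 = 0" "a N = t" "\<And>k. k < N \<Longrightarrow> a k < a (Suc k)"
    and good: "\<And>k. 0 < k \<Longrightarrow> k < N \<Longrightarrow> (\<lambda>n. upper_pt (\<pi> n) (a k)) \<longlonglongrightarrow> a k"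
    and close: "\<And>k s. k < N \<Longrightarrow> a k \<le> s \<Longrightarrow> s < a (Suc k) \<Longrightarrow> rho K (\<Phi> (Z s) - \<Phi> (Z (a k))) < \<eta>"
      "\<And>k s. k < N \<Longrightarrow> a k < s \<Longrightarrow> s \<le> a (Suc k) \<Longrightarrow> rho K (\<Phi> (left_lim Z s) - \<Phi> (Z (a k))) < \<eta>"
    by (rule continuous_image_subdivision[OF Z \<Phi> K t \<eta>, of "\<lambda>u. (\<lambda>n. upper_pt (\<pi> n) u) \<longlonglongrightarrow> u"])
       (use path_constant_of_upper_pt_not_convergent[OF P Z left] in blast)+
  define c where "c k = \<Phi> (Z (a k))" for k
  define S where "S n b = partition_sum (\<pi> n) t (\<lambda>r s. if b \<le> r then h n r s else 0)" for n b
  define g where "g n = (\<Sum>k<N. blinfun_apply (c k) (S n (a k) - S n (a (Suc k))))" for n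
  have S_lim: "limitin (mode_topology m) (\<lambda>n. S n (a k)) (G t - G (a k)) sequentially" if k: "k \<le> N" for k
  proof -
    consider "k = 0" | "0 < k" "k < N" | "k = N" using k by linarith
    then show ?thesis
    proof cases
      case 1
      have "S n (a k) = partition_sum (\<pi> n) t (h n)" for n
        unfolding S_def 1 a using partition_cell_order(1)[OF P] by (intro partition_sum_cong) simp
      then show ?thesis using start 1 a by simp
    next
      case 2
      have "a 0 < a k" "a k < a N"
        using subdivision_strict_mono[of N a] a(3) 2 by simp_all
      then show ?thesis unfolding S_def using later[OF _ _ good[OF 2]] a by simp
    next
      case 3
      have "S n (a k) = 0" for n
        unfolding S_def 3 a partition_sum_def by (intro sum.neutral) auto
      then show ?thesis using mode_limit_of_tendsto[OF tendsto_const[of 0]] 3 a by simp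
    qed
  qed
  have g_lim: "limitin (mode_topology m) g (\<Sum>k<N. blinfun_apply (c k) (G (a (Suc k)) - G (a k))) sequentially"
  proof -
    have "limitin (mode_topology m) (\<lambda>n. \<Sum>k<N. blinfun_apply (c k) (S n (a k) - S n (a (Suc k))))
        (\<Sum>k<N. blinfun_apply (c k) ((G t - G (a k)) - (G t - G (a (Suc k))))) sequentially"
      by (intro mode_limit_sum mode_limit_blinfun mode_limit_diff S_lim) auto
    then show ?thesis by (simp add: g_def[abs_def])
  qed
  \<comment> \<open>An interval \<open>(r, s]\<close> is assigned to the block \<open>[a\<^sub>k, a\<^sub>k\<^sub>+\<^sub>1)\<close> that contains its left end point, where
      \<open>\<Phi> (Z r)\<close> is close to \<open>\<Phi> (Z a\<^sub>k)\<close> no matter how far \<open>s\<close> lies beyond the block.\<close>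
  have near: "norm (partition_sum (\<pi> n) t (\<lambda>r s. blinfun_apply (\<Phi> (Z r)) (h n r s)) - g n) \<le> e" for n
  proof -
    define f where "f k r s = blinfun_apply (c k) ((if a k \<le> r then h n r s else 0) - (if a (Suc k) \<le> r then h n r s else 0))" for k r s
    have "g n = partition_sum (\<pi> n) t (\<lambda>r s. \<Sum>k<N. f k r s)"
      by (simp add: g_def S_def f_def partition_sum_sum partition_sum_blinfun partition_sum_diff)
    then have "norm (partition_sum (\<pi> n) t (\<lambda>r s. blinfun_apply (\<Phi> (Z r)) (h n r s)) - g n)
        = norm (partition_sum (\<pi> n) t (\<lambda>r s. blinfun_apply (\<Phi> (Z r)) (h n r s) - (\<Sum>k<N. f k r s)))"
      by (simp add: partition_sum_diff)
    also have "\<dots> \<le> partition_sum (\<pi> n) t (\<lambda>r s. \<eta> * norm (h n r s))"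
    proof (rule partition_sum_norm_le)
      fix r s assume rs: "(r, s) \<in> \<pi> n" "r < t"
      have "0 \<le> r" by (rule partition_cell_order(1)[OF P rs(1)])
      then obtain k where k: "k < N" "a k \<le> r" "r < a (Suc k)"
        using subdivision_locate[of a r N] a rs by auto
      have "f j r s = (if j = k then blinfun_apply (c k) (h n r s) else 0)" if "j < N" for j
      proof (cases "j = k")
        case False
        then have "\<not> (a j \<le> r \<and> r < a (Suc j))"
          using subdivision_interval_unique[of N a j k r] a(3) k that by blast
        moreover have "a (Suc j) \<le> r \<Longrightarrow> a j \<le> r" using a(3)[OF that] by simp
        ultimately show ?thesis using False by (auto simp: f_def not_less)
      qed (use k in \<open>simp add: f_def\<close>)
      then have "(\<Sum>j<N. f j r s) = blinfun_apply (c k) (h n r s)" using k by simp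
      then have "blinfun_apply (\<Phi> (Z r)) (h n r s) - (\<Sum>j<N. f j r s)
          = blinfun_apply (\<Phi> (Z r) - \<Phi> (Z (a k))) (h n r s)"
        by (simp add: c_def blinfun.diff_left)
      then show "norm (blinfun_apply (\<Phi> (Z r)) (h n r s) - (\<Sum>j<N. f j r s)) \<le> \<eta> * norm (h n r s)"
        using rho_lessD[OF close(1)[OF k] h_K[OF rs]] by simp
    qed
    also have "\<dots> = \<eta> * partition_sum (\<pi> n) t (\<lambda>r s. norm (h n r s))"
      by (rule partition_sum_cmult)
    also have "\<dots> \<le> \<eta> * C" using \<eta> h_C by (intro mult_left_mono) auto
    finally show ?thesis using \<eta>C by linarith
  qed
  have "norm (I - step_integral G t (subdivision_step N a c)) \<le> (2 * \<eta>) * (v t - v 0)"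
  proof (rule stieltjes_limit_close[OF step_approx_left_lim_neq_bot[OF Z \<Phi>] I _ _ t v K G_K \<eta>])
    show "is_step (subdivision_step N a c)" by (rule is_step_subdivision[OF a(1,3)])
    show "rho K (\<Phi> (left_lim Z s) - step_fun (subdivision_step N a c) s) < \<eta>" if "s \<in> {0..t}" for s
      unfolding c_def[abs_def] by (rule subdivision_step_close[OF a \<eta> close(2) that])
  qed
  then have "norm (I - (\<Sum>k<N. blinfun_apply (c k) (G (a (Suc k)) - G (a k)))) \<le> e"
  proof -
    have "step_integral G t (subdivision_step N a c) = (\<Sum>k<N. blinfun_apply (c k) (G (a (Suc k)) - G (a k)))"
      by (rule step_integral_subdivision[OF a])
    then show ?thesis using \<eta>V \<open>norm (I - _) \<le> _\<close> by (simp add: V_def)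
  qed
  then show "\<exists>g k. limitin (mode_topology m) g k sequentially
      \<and> eventually (\<lambda>n. norm (partition_sum (\<pi> n) t (\<lambda>r s. blinfun_apply (\<Phi> (Z r)) (h n r s)) - g n) \<le> e) sequentially
      \<and> norm (I - k) \<le> e"
    using g_lim near by (intro exI conjI always_eventually allI)
qed

lemma caglad_Lc_left_lim:
  fixes Z :: "real \<Rightarrow> 'z::metric_space"
    and \<Phi> :: "'z \<Rightarrow> 'h::real_normed_vector \<Rightarrow>\<^sub>L 'g::real_normed_vector"
  assumes Z: "cadlag Z" and \<Phi>: "continuous_map euclidean Lc_topology \<Phi>"
  shows "caglad_Lc (\<lambda>s. \<Phi> (left_lim Z s))"
  unfolding caglad_Lc_def
  using continuous_map_Lc_limitin[OF \<Phi> left_lim_tendsto_left[OF Z]]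
    continuous_map_Lc_limitin[OF \<Phi> left_lim_tendsto_right[OF Z]] by blast


section \<open>Taylor expansion\<close>

lemma has_gateaux_derivative_line:
  fixes g :: "'a::real_normed_vector \<Rightarrow> 'b::real_normed_vector"
  assumes "has_gateaux_derivative g L (x + s *\<^sub>R h)"
  shows "((\<lambda>s. g (x + s *\<^sub>R h)) has_vector_derivative blinfun_apply L h) (at s)"
  unfolding has_vector_derivative_def has_derivative_at
proof
  show "bounded_linear (\<lambda>t. t *\<^sub>R blinfun_apply L h)"
    by (rule bounded_linear_scaleR_left)
  have "((\<lambda>t. inverse t *\<^sub>R (g (x + s *\<^sub>R h + t *\<^sub>R h) - g (x + s *\<^sub>R h)) - blinfun_apply L h) \<longlongrightarrow> 0) (at 0)"
    using assms unfolding has_gateaux_derivative_def by (simp add: LIM_zero)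
  then have lim: "((\<lambda>t. norm (inverse t *\<^sub>R (g (x + s *\<^sub>R h + t *\<^sub>R h) - g (x + s *\<^sub>R h)) - blinfun_apply L h)) \<longlongrightarrow> 0) (at 0)"
    by (rule tendsto_norm_zero)
  show "((\<lambda>t. norm (g (x + (s + t) *\<^sub>R h) - g (x + s *\<^sub>R h) - t *\<^sub>R blinfun_apply L h) / norm t) \<longlongrightarrow> 0) (at 0)"
  proof (rule Lim_transform_eventually[OF lim])
    have "norm (inverse t *\<^sub>R (g (x + s *\<^sub>R h + t *\<^sub>R h) - g (x + s *\<^sub>R h)) - blinfun_apply L h)
        = norm (g (x + (s + t) *\<^sub>R h) - g (x + s *\<^sub>R h) - t *\<^sub>R blinfun_apply L h) / norm t" if "t \<noteq> 0" for t
    proof -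
      have "inverse t *\<^sub>R (g (x + s *\<^sub>R h + t *\<^sub>R h) - g (x + s *\<^sub>R h)) - blinfun_apply L h
          = inverse t *\<^sub>R (g (x + (s + t) *\<^sub>R h) - g (x + s *\<^sub>R h) - t *\<^sub>R blinfun_apply L h)"
        using that by (simp add: scaleR_add_left add.assoc scaleR_diff_right)
      then show ?thesis by (simp add: divide_inverse mult.commute)
    qed
    then show "eventually (\<lambda>t. norm (inverse t *\<^sub>R (g (x + s *\<^sub>R h + t *\<^sub>R h) - g (x + s *\<^sub>R h)) - blinfun_apply L h)
        = norm (g (x + (s + t) *\<^sub>R h) - g (x + s *\<^sub>R h) - t *\<^sub>R blinfun_apply L h) / norm t) (at 0)"
      by (auto simp: eventually_at_filter)
  qed
qed

lemma unit_interval_mean_value_bound: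
  fixes p :: "real \<Rightarrow> 'b::real_normed_vector"
  assumes deriv: "\<And>s. 0 \<le> s \<Longrightarrow> s \<le> 1 \<Longrightarrow> (p has_vector_derivative p' s) (at s)"
    and bound: "\<And>s. 0 \<le> s \<Longrightarrow> s \<le> 1 \<Longrightarrow> norm (p' s) \<le> B" and s: "0 \<le> s" "s \<le> 1"
  shows "norm (p s - p 0) \<le> B"
proof (cases "s = 0")
  case True
  then show ?thesis using order_trans[OF norm_ge_zero bound[of 0]] by simp
next
  case False
  have "norm (p s - p 0) \<le> B * s - B * 0"
  proof (rule differentiable_bound_general[where f' = p'])
    show "continuous_on {0..s} p"
    proof (intro continuous_at_imp_continuous_on ballI)
      fix x assume "x \<in> {0..s}"
      then show "isCont p x" using s by (intro has_vector_derivative_continuous[OF deriv]) auto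
    qed
    show "((*) B has_vector_derivative B) (at x)" for x
      by (auto intro!: derivative_eq_intros simp: has_real_derivative_iff_has_vector_derivative[symmetric])
  qed (use False s deriv bound in \<open>auto intro!: continuous_intros\<close>)
  also have "\<dots> \<le> B"
    using mult_left_le[of s B] order_trans[OF norm_ge_zero bound[of 0]] s by simp
  finally show ?thesis .
qed

lemma dist_Pair_le: "dist (a, x) (b, y) \<le> dist a b + dist x y"
  unfolding dist_Pair_Pair by (rule sqrt_sum_squares_le_sum) auto

lemma sum_norm_le_norm: "sum_norm z \<le> 2 * norm z"
  using norm_fst_le[of "fst z" "snd z"] norm_snd_le[of "snd z" "fst z"] by (simp add: sum_norm_def)

text \<open>
  \<open>T\<close> stands for the bilinear map \<open>(u, v) \<mapsto> u \<otimes> v\<close> into the completed tensor product.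
\<close>

locale ito_function =
  fixes f :: "'f::banach \<times> 'e::banach \<Rightarrow> 'g::banach"
    and Da :: "'f \<times> 'e \<Rightarrow> 'f \<Rightarrow>\<^sub>L 'g"
    and Dx :: "'f \<times> 'e \<Rightarrow> 'e \<Rightarrow>\<^sub>L 'g"
    and Dxx :: "'f \<times> 'e \<Rightarrow> 'e \<Rightarrow>\<^sub>L 'e \<Rightarrow>\<^sub>L 'g"
    and D2 :: "'f \<times> 'e \<Rightarrow> 'h::banach \<Rightarrow>\<^sub>L 'g"
    and T :: "'e \<Rightarrow> 'e \<Rightarrow> 'h"
  assumes T: "bounded_bilinear T"
    and Da: "\<And>a x. has_gateaux_derivative (\<lambda>a. f (a, x)) (Da (a, x)) a"
    and Da_cont: "continuous_map euclidean Lc_topology Da"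
    and Dx: "\<And>a x. has_gateaux_derivative (\<lambda>x. f (a, x)) (Dx (a, x)) x"
    and Dxx: "\<And>a x. has_gateaux_derivative (\<lambda>x. Dx (a, x)) (Dxx (a, x)) x"
    and Dx_cont: "continuous_map euclidean Lc_topology Dx"
    and D2: "\<And>a x u v. blinfun_apply (D2 (a, x)) (T u v) = blinfun_apply (blinfun_apply (Dxx (a, x)) u) v"
    and D2_cont: "continuous_map euclidean Lc_topology D2"
begin

definition remainder :: "'f \<times> 'e \<Rightarrow> 'f \<times> 'e \<Rightarrow> 'g" where
  "remainder z z' = f z' - f z - blinfun_apply (Da z) (fst z' - fst z) - blinfun_apply (Dx z) (snd z' - snd z)
     - (1/2) *\<^sub>R blinfun_apply (D2 z) (T (snd z' - snd z) (snd z' - snd z))"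

text \<open>
  The increment is split at \<open>(a, x + k)\<close> into a first-order expansion in the first variable and a
  second-order one in the second. Both derivatives are compared with their values at \<open>(a, x)\<close>
  only on the increments themselves, so convergence in the topology of compact sets is enough.
\<close>

lemma remainder_bound:
  assumes Da_near: "\<And>z'. dist (a, x) z' < \<delta> \<Longrightarrow> rho KA (Da z' - Da (a, x)) < \<eta>"
    and D2_near: "\<And>z'. dist (a, x) z' < \<delta> \<Longrightarrow> rho KH (D2 z' - D2 (a, x)) < \<eta>"
    and h: "h \<in> KA" and k: "T k k \<in> KH" and small: "norm h + norm k < \<delta>" and \<eta>: "0 < \<eta>"
  shows "norm (remainder (a, x) (a + h, x + k)) \<le> \<eta> * (norm h + norm (T k k))"
proof -
  have near: "dist (a, x) (a + s *\<^sub>R h, x + t *\<^sub>R k) < \<delta>" if "0 \<le> s" "s \<le> 1" "0 \<le> t" "t \<le> 1" for s t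
  proof -
    have "dist (a, x) (a + s *\<^sub>R h, x + t *\<^sub>R k) \<le> s * norm h + t * norm k"
      using dist_Pair_le[of a x "a + s *\<^sub>R h" "x + t *\<^sub>R k"] that by (simp add: dist_norm)
    also have "\<dots> \<le> norm h + norm k"
      using that by (intro add_mono mult_left_le_one_le) auto
    finally show ?thesis using small by simp
  qed
  have first: "norm (f (a + h, x + k) - f (a, x + k) - blinfun_apply (Da (a, x)) h) \<le> \<eta> * norm h"
  proof -
    let ?p = "\<lambda>s. f (a + s *\<^sub>R h, x + k) - s *\<^sub>R blinfun_apply (Da (a, x)) h"
    let ?p' = "\<lambda>s. blinfun_apply (Da (a + s *\<^sub>R h, x + k)) h - blinfun_apply (Da (a, x)) h"
    have "norm (?p 1 - ?p 0) \<le> \<eta> * norm h"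
    proof (rule unit_interval_mean_value_bound[of ?p ?p'])
      fix s :: real assume s: "0 \<le> s" "s \<le> 1"
      have "((\<lambda>s. s *\<^sub>R blinfun_apply (Da (a, x)) h) has_vector_derivative blinfun_apply (Da (a, x)) h) (at s)"
        by (auto intro!: derivative_eq_intros)
      then show "(?p has_vector_derivative ?p' s) (at s)"
        using has_gateaux_derivative_line[where g = "\<lambda>a. f (a, x + k)", OF Da] by (intro has_vector_derivative_diff)
      have "rho KA (Da (a + s *\<^sub>R h, x + k) - Da (a, x)) < \<eta>"
        using near[OF s, of 1] by (intro Da_near) simp
      from rho_lessD[OF this h] show "norm (?p' s) \<le> \<eta> * norm h" by (simp add: blinfun.diff_left)
    qed auto
    then show ?thesis by (simp add: algebra_simps)
  qed
  have second: "norm (f (a, x + k) - f (a, x) - blinfun_apply (Dx (a, x)) k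
      - (1/2) *\<^sub>R blinfun_apply (D2 (a, x)) (T k k)) \<le> \<eta> * norm (T k k)"
  proof -
    let ?c = "blinfun_apply (D2 (a, x)) (T k k)"
    let ?q = "\<lambda>s. blinfun_apply (Dx (a, x + s *\<^sub>R k)) k - s *\<^sub>R ?c"
    let ?q' = "\<lambda>s. blinfun_apply (D2 (a, x + s *\<^sub>R k)) (T k k) - ?c"
    have q: "norm (?q s - ?q 0) \<le> \<eta> * norm (T k k)" if s: "0 \<le> s" "s \<le> 1" for s
    proof (rule unit_interval_mean_value_bound[of ?q ?q', OF _ _ s])
      fix s :: real assume s: "0 \<le> s" "s \<le> 1"
      have "((\<lambda>s. Dx (a, x + s *\<^sub>R k)) has_vector_derivative blinfun_apply (Dxx (a, x + s *\<^sub>R k)) k) (at s)"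
        by (rule has_gateaux_derivative_line[OF Dxx])
      from bounded_linear.has_vector_derivative[OF blinfun.bounded_linear_left this, of k]
      have "((\<lambda>s. blinfun_apply (Dx (a, x + s *\<^sub>R k)) k) has_vector_derivative
          blinfun_apply (D2 (a, x + s *\<^sub>R k)) (T k k)) (at s)" by (simp add: D2)
      moreover have "((\<lambda>s. s *\<^sub>R ?c) has_vector_derivative ?c) (at s)"
        by (auto intro!: derivative_eq_intros)
      ultimately show "(?q has_vector_derivative ?q' s) (at s)"
        by (rule has_vector_derivative_diff)
      have "rho KH (D2 (a, x + s *\<^sub>R k) - D2 (a, x)) < \<eta>"
        using near[of 0 s] s by (intro D2_near) simp
      from rho_lessD[OF this k] show "norm (?q' s) \<le> \<eta> * norm (T k k)" by (simp add: blinfun.diff_left)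
    qed
    let ?p = "\<lambda>s. f (a, x + s *\<^sub>R k) - s *\<^sub>R blinfun_apply (Dx (a, x)) k - (s\<^sup>2 / 2) *\<^sub>R ?c"
    have "norm (?p 1 - ?p 0) \<le> \<eta> * norm (T k k)"
    proof (rule unit_interval_mean_value_bound[of ?p "\<lambda>s. ?q s - ?q 0"])
      fix s :: real assume s: "0 \<le> s" "s \<le> 1"
      have "((\<lambda>s. s *\<^sub>R blinfun_apply (Dx (a, x)) k) has_vector_derivative blinfun_apply (Dx (a, x)) k) (at s)"
        by (auto intro!: derivative_eq_intros)
      moreover have "((\<lambda>s. (s\<^sup>2 / 2) *\<^sub>R ?c) has_vector_derivative s *\<^sub>R ?c) (at s)"
        by (auto intro!: derivative_eq_intros)
      ultimately have "(?p has_vector_derivative blinfun_apply (Dx (a, x + s *\<^sub>R k)) k - blinfun_apply (Dx (a, x)) k - s *\<^sub>R ?c) (at s)"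
        using has_gateaux_derivative_line[where g = "\<lambda>x. f (a, x)", OF Dx] by (intro has_vector_derivative_diff)
      then show "(?p has_vector_derivative (?q s - ?q 0)) (at s)" by (simp add: algebra_simps)
    qed (use q in auto)
    then show ?thesis by (simp add: algebra_simps)
  qed
  have "remainder (a, x) (a + h, x + k) = (f (a + h, x + k) - f (a, x + k) - blinfun_apply (Da (a, x)) h)
      + (f (a, x + k) - f (a, x) - blinfun_apply (Dx (a, x)) k - (1/2) *\<^sub>R blinfun_apply (D2 (a, x)) (T k k))"
    by (simp add: remainder_def)
  also have "norm \<dots> \<le> \<eta> * norm h + \<eta> * norm (T k k)"
    by (rule order_trans[OF norm_triangle_ineq add_mono[OF first second]])
  finally show ?thesis by (simp add: distrib_left)
qed

text \<open>Uniform continuity of both derivatives on the compact set \<open>M\<close> makes one \<open>\<delta>\<close> serve all base points.\<close>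

lemma remainder_bound_uniform:
  assumes M: "compact M" and KA: "compact KA" and KH: "compact KH" and \<eta>: "0 < \<eta>"
  obtains \<delta> where "0 < \<delta>" "\<And>z z'. z \<in> M \<Longrightarrow> fst z' - fst z \<in> KA \<Longrightarrow>
    T (snd z' - snd z) (snd z' - snd z) \<in> KH \<Longrightarrow> sum_norm (z' - z) < \<delta> \<Longrightarrow>
    norm (remainder z z') \<le> \<eta> * (norm (fst z' - fst z) + norm (T (snd z' - snd z) (snd z' - snd z)))"
proof -
  obtain \<delta>1 where \<delta>1: "0 < \<delta>1" "\<And>z z'. z \<in> M \<Longrightarrow> dist z z' < \<delta>1 \<Longrightarrow> rho KA (Da z' - Da z) < \<eta>"
    using continuous_map_Lc_uniform[OF Da_cont M KA \<eta>] by blast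
  obtain \<delta>2 where \<delta>2: "0 < \<delta>2" "\<And>z z'. z \<in> M \<Longrightarrow> dist z z' < \<delta>2 \<Longrightarrow> rho KH (D2 z' - D2 z) < \<eta>"
    using continuous_map_Lc_uniform[OF D2_cont M KH \<eta>] by blast
  show ?thesis
  proof (rule that[of "min \<delta>1 \<delta>2"])
    fix z z' :: "'f \<times> 'e"
    assume z: "z \<in> M" and KA: "fst z' - fst z \<in> KA" and KH: "T (snd z' - snd z) (snd z' - snd z) \<in> KH"
      and small: "sum_norm (z' - z) < min \<delta>1 \<delta>2"
    have z_eq: "(fst z, snd z) = z" "(fst z + (fst z' - fst z), snd z + (snd z' - snd z)) = z'" by simp_all
    have "norm (remainder (fst z, snd z) (fst z + (fst z' - fst z), snd z + (snd z' - snd z)))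
        \<le> \<eta> * (norm (fst z' - fst z) + norm (T (snd z' - snd z) (snd z' - snd z)))"
      using small z \<delta>1(2)[OF z] \<delta>2(2)[OF z]
      by (intro remainder_bound[of _ _ "min \<delta>1 \<delta>2" KA \<eta> KH] KA KH \<eta>) (auto simp: sum_norm_def)
    then show "norm (remainder z z') \<le> \<eta> * (norm (fst z' - fst z) + norm (T (snd z' - snd z) (snd z' - snd z)))"
      unfolding z_eq .
  qed (use \<delta>1 \<delta>2 in auto)
qed

text \<open>
  Joint continuity comes from the Taylor bound at \<open>z0\<close>, with \<open>\<eta> = 1\<close> and the compact sets formed by
  the null sequences of increments in the first variable and of their tensor squares in the second.
\<close>

lemma f_tendsto:
  assumes z: "z \<longlonglongrightarrow> z0"
  shows "(\<lambda>n. f (z n)) \<longlonglongrightarrow> f z0"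
proof -
  define h where "h n = fst (z n) - fst z0" for n
  define k where "k n = snd (z n) - snd z0" for n
  have h0: "h \<longlonglongrightarrow> 0"
    unfolding h_def using tendsto_fst[OF z] by (simp add: LIM_zero)
  have k0: "k \<longlonglongrightarrow> 0"
    unfolding k_def using tendsto_snd[OF z] by (simp add: LIM_zero)
  have T0: "(\<lambda>n. T (k n) (k n)) \<longlonglongrightarrow> 0"
    using bounded_bilinear.tendsto[OF T k0 k0] bounded_bilinear.zero_left[OF T] by simp
  obtain \<delta> where \<delta>: "0 < \<delta>" "\<And>z z'. z \<in> {z0} \<Longrightarrow> fst z' - fst z \<in> insert 0 (range h) \<Longrightarrow>
    T (snd z' - snd z) (snd z' - snd z) \<in> insert 0 (range (\<lambda>n. T (k n) (k n))) \<Longrightarrow> sum_norm (z' - z) < \<delta> \<Longrightarrow>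
    norm (remainder z z') \<le> 1 * (norm (fst z' - fst z) + norm (T (snd z' - snd z) (snd z' - snd z)))"
    using remainder_bound_uniform[OF compact_sing compact_insert_limit[OF h0] compact_insert_limit[OF T0] zero_less_one]
    by blast
  have "(\<lambda>n. norm (h n) + norm (k n)) \<longlonglongrightarrow> 0"
    using tendsto_add[OF tendsto_norm_zero[OF h0] tendsto_norm_zero[OF k0]] by simp
  then have "eventually (\<lambda>n. norm (h n) + norm (k n) < \<delta>) sequentially"
    using \<delta>(1) by (rule order_tendstoD)
  then have bound: "eventually (\<lambda>n. norm (remainder z0 (z n)) \<le> norm (h n) + norm (T (k n) (k n))) sequentially"
  proof eventually_elim
    case (elim n)
    then show ?case using \<delta>(2)[of z0 "z n"] by (simp add: h_def k_def sum_norm_def)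
  qed
  have "(\<lambda>n. norm (h n) + norm (T (k n) (k n))) \<longlonglongrightarrow> 0"
    using tendsto_add[OF tendsto_norm_zero[OF h0] tendsto_norm_zero[OF T0]] by simp
  from Lim_null_comparison[OF bound this] have rem: "(\<lambda>n. remainder z0 (z n)) \<longlonglongrightarrow> 0" .
  have "(\<lambda>n. remainder z0 (z n) + blinfun_apply (Da z0) (h n) + blinfun_apply (Dx z0) (k n)
      + (1/2) *\<^sub>R blinfun_apply (D2 z0) (T (k n) (k n)) + f z0)
    \<longlonglongrightarrow> 0 + blinfun_apply (Da z0) 0 + blinfun_apply (Dx z0) 0 + (1/2) *\<^sub>R blinfun_apply (D2 z0) 0 + f z0"
    by (intro tendsto_intros rem h0 k0 T0)
  then show ?thesis by (simp add: remainder_def h_def k_def)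
qed

lemma remainder_tendsto:
  assumes z: "z \<longlonglongrightarrow> z0" and z': "z' \<longlonglongrightarrow> z0'"
  shows "(\<lambda>n. remainder (z n) (z' n)) \<longlonglongrightarrow> remainder z0 z0'"
  unfolding remainder_def
  by (intro tendsto_diff tendsto_scaleR tendsto_const f_tendsto z z' tendsto_fst tendsto_snd
      continuous_map_Lc_tendsto_apply[OF Da_cont] continuous_map_Lc_tendsto_apply[OF Dx_cont]
      continuous_map_Lc_tendsto_apply[OF D2_cont] bounded_bilinear.tendsto[OF T])


section \<open>The remainder sums converge to a sum over the jumps\<close>

text \<open>Left limits lie in the closure of the range of the path, so the same \<open>\<delta>\<close> bounds the remainders of
  increments and of jumps.\<close>

lemma remainder_near_jumps:
  assumes A: "cadlag A" and X: "cadlag X" and \<eta>: "0 < \<eta>"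
  obtains \<delta> where "0 < \<delta>"
    "\<And>u w. u \<in> {0..t} \<Longrightarrow> w \<in> {0..t} \<Longrightarrow> sum_norm ((A w, X w) - (A u, X u)) < \<delta> \<Longrightarrow>
      norm (remainder (A u, X u) (A w, X w)) \<le> \<eta> * (norm (A w - A u) + norm (T (X w - X u) (X w - X u)))"
    "\<And>s. s \<in> {0..t} \<Longrightarrow> sum_norm (jump (\<lambda>s. (A s, X s)) s) < \<delta> \<Longrightarrow>
      norm (remainder (left_lim A s, left_lim X s) (A s, X s)) \<le> \<eta> * (norm (jump A s) + norm (T (jump X s) (jump X s)))"
proof -
  let ?Z = "\<lambda>s. (A s, X s)"
  have Z: "cadlag ?Z" by (rule cadlag_Pair[OF A X])
  define M where "M = closure (?Z ` {0..t})"
  have M: "compact M" unfolding M_def by (rule cadlag_compact_range[OF Z])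
  have in_M: "?Z u \<in> M" if "u \<in> {0..t}" for u
    using that closure_subset unfolding M_def by fastforce
  have left_M: "(left_lim A u, left_lim X u) \<in> M" if "u \<in> {0..t}" for u
    using left_lim_in_closure_range[OF Z, of u t] that by (simp add: M_def left_lim_Pair[OF A X])
  obtain KA where KA: "compact KA" "\<And>u v. u \<in> {0..t} \<Longrightarrow> v \<in> {0..t} \<Longrightarrow> A u - A v \<in> KA"
    "\<And>u. u \<in> {0..t} \<Longrightarrow> jump A u \<in> KA"
    using cadlag_compact_increments[OF A, of t] by metis
  obtain KX where KX: "compact KX" "\<And>u v. u \<in> {0..t} \<Longrightarrow> v \<in> {0..t} \<Longrightarrow> X u - X v \<in> KX"
    "\<And>u. u \<in> {0..t} \<Longrightarrow> jump X u \<in> KX"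
    using cadlag_compact_increments[OF X, of t] by metis
  have KH: "compact ((\<lambda>k. T k k) ` KX)"
    by (intro compact_continuous_image KX bounded_bilinear.continuous_on[OF T] continuous_on_id)
  obtain \<delta> where \<delta>: "0 < \<delta>" "\<And>z z'. z \<in> M \<Longrightarrow> fst z' - fst z \<in> KA \<Longrightarrow>
    T (snd z' - snd z) (snd z' - snd z) \<in> (\<lambda>k. T k k) ` KX \<Longrightarrow> sum_norm (z' - z) < \<delta> \<Longrightarrow>
    norm (remainder z z') \<le> \<eta> * (norm (fst z' - fst z) + norm (T (snd z' - snd z) (snd z' - snd z)))"
    by (rule remainder_bound_uniform[OF M KA(1) KH \<eta>]) (rule that; assumption)
  show ?thesis
  proof (rule that[OF \<delta>(1)])
    fix u w assume uw: "u \<in> {0..t}" "w \<in> {0..t}" and "sum_norm (?Z w - ?Z u) < \<delta>"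
    then show "norm (remainder (A u, X u) (A w, X w)) \<le> \<eta> * (norm (A w - A u) + norm (T (X w - X u) (X w - X u)))"
      using \<delta>(2)[OF in_M[OF uw(1)], of "?Z w"] KA(2)[OF uw(2,1)] KX(2)[OF uw(2,1)] by simp
  next
    fix s assume s: "s \<in> {0..t}" and small: "sum_norm (jump ?Z s) < \<delta>"
    have eq: "?Z s - (left_lim A s, left_lim X s) = jump ?Z s"
      by (simp add: jump_def left_lim_Pair[OF A X])
    have "A s - left_lim A s = jump A s" "X s - left_lim X s = jump X s" by (simp_all add: jump_def)
    then show "norm (remainder (left_lim A s, left_lim X s) (A s, X s)) \<le> \<eta> * (norm (jump A s) + norm (T (jump X s) (jump X s)))"
      using \<delta>(2)[OF left_M[OF s], of "?Z s"] KA(3)[OF s] KX(3)[OF s] small unfolding eq by simp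
  qed
qed

lemma finite_big_jumps_sum_norm:
  assumes Z: "cadlag (Z :: real \<Rightarrow> 'a::real_normed_vector \<times> 'b::real_normed_vector)" and \<epsilon>: "0 < \<epsilon>"
  shows "finite ({0<..t} \<inter> big_jump_times sum_norm \<epsilon> Z)"
proof (rule finite_subset)
  show "finite {s \<in> {0<..t}. \<epsilon> / 2 \<le> norm (jump Z s)}"
    using \<epsilon> by (intro finite_big_jumps Z) simp
  show "{0<..t} \<inter> big_jump_times sum_norm \<epsilon> Z \<subseteq> {s \<in> {0<..t}. \<epsilon> / 2 \<le> norm (jump Z s)}"
  proof
    fix s assume "s \<in> {0<..t} \<inter> big_jump_times sum_norm \<epsilon> Z"
    then show "s \<in> {s \<in> {0<..t}. \<epsilon> / 2 \<le> norm (jump Z s)}"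
      using sum_norm_le_norm[of "jump Z s"] by (auto simp: big_jump_times_def)
  qed
qed

text \<open>Only finitely many jumps exceed the threshold; the remainders of the others are dominated by a
  summable family.\<close>

lemma jump_remainder_tail:
  assumes Z: "cadlag (\<lambda>s. (A s, X s))" and \<delta>: "0 < \<delta>"
    and small: "\<And>s. s \<in> {0..t} \<Longrightarrow> sum_norm (jump (\<lambda>s. (A s, X s)) s) < \<delta> \<Longrightarrow>
      norm (r s) \<le> \<eta> * (norm (jump A s) + norm (T (jump X s) (jump X s)))"
    and W: "((\<lambda>s. norm (jump A s) + norm (T (jump X s) (jump X s))) has_sum W) {0<..t}"
    and \<epsilon>: "0 < \<epsilon>" "\<epsilon> \<le> \<delta>" and \<eta>: "0 < \<eta>" and B: "B = {0<..t} \<inter> big_jump_times sum_norm \<epsilon> (\<lambda>s. (A s, X s))"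
  shows "(r :: real \<Rightarrow> 'g) summable_on {0<..t}" "norm ((\<Sum>\<^sub>\<infinity>s\<in>{0<..t}. r s) - (\<Sum>s\<in>B. r s)) \<le> \<eta> * W"
proof -
  let ?b = "\<lambda>s. norm (jump A s) + norm (T (jump X s) (jump X s))"
  have fin: "finite B" unfolding B by (rule finite_big_jumps_sum_norm[OF Z \<epsilon>(1)])
  have le: "norm (r s) \<le> \<eta> * ?b s" if "s \<in> {0<..t} - B" for s
    using that \<epsilon> by (intro small) (auto simp: B big_jump_times_def)
  have bound: "(\<lambda>s. \<eta> * ?b s) summable_on {0<..t}"
    by (rule summable_on_cmult_right[OF has_sum_imp_summable[OF W]])
  then have bound': "(\<lambda>s. \<eta> * ?b s) summable_on {0<..t} - B"
    by (rule summable_on_subset_banach) auto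
  have abs: "(\<lambda>s. norm (r s)) summable_on {0<..t} - B"
    using summable_on_comparison_test[OF bound', of "\<lambda>s. norm (r s)"] le by simp
  then have rest: "r summable_on {0<..t} - B" by (rule abs_summable_summable)
  have fin_sum: "r summable_on B" using fin by (rule summable_on_finite)
  have split: "{0<..t} = ({0<..t} - B) \<union> B" using B by blast
  show "r summable_on {0<..t}"
    by (subst split, intro summable_on_Un_disjoint rest fin_sum) auto
  have "(\<Sum>\<^sub>\<infinity>s\<in>{0<..t}. r s) = (\<Sum>\<^sub>\<infinity>s\<in>{0<..t} - B. r s) + (\<Sum>\<^sub>\<infinity>s\<in>B. r s)"
    by (subst split, intro infsum_Un_disjoint rest fin_sum) auto
  then have "norm ((\<Sum>\<^sub>\<infinity>s\<in>{0<..t}. r s) - (\<Sum>s\<in>B. r s)) = norm (\<Sum>\<^sub>\<infinity>s\<in>{0<..t} - B. r s)"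
    using fin by simp
  also have "\<dots> \<le> (\<Sum>\<^sub>\<infinity>s\<in>{0<..t} - B. norm (r s))" by (rule norm_infsum_bound[OF abs])
  also have "\<dots> \<le> (\<Sum>\<^sub>\<infinity>s\<in>{0<..t} - B. \<eta> * ?b s)" by (rule infsum_mono[OF abs bound' le])
  also have "\<dots> \<le> (\<Sum>\<^sub>\<infinity>s\<in>{0<..t}. \<eta> * ?b s)"
    using \<eta> by (intro infsum_mono_neutral bound bound') auto
  also have "\<dots> = \<eta> * W"
    by (rule infsumI[OF has_sum_cmult_right[OF W]])
  finally show "norm ((\<Sum>\<^sub>\<infinity>s\<in>{0<..t}. r s) - (\<Sum>s\<in>B. r s)) \<le> \<eta> * W" .
qed

end

text \<open>On a partition interval without big jumps the path itself oscillates as little as the path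
  without its big jumps; right continuity adds the left end point.\<close>

lemma increment_le_osc:
  fixes Z :: "real \<Rightarrow> 'a::real_normed_vector \<times> 'b::real_normed_vector"
  assumes Z: "cadlag Z" and rs: "(r, s) \<in> P" "0 \<le> r" "r < s" "r < t"
    and none: "\<And>u. u \<in> {0<..t} \<inter> big_jump_times sum_norm \<epsilon> Z \<Longrightarrow> \<not> (r < u \<and> u \<le> s)"
    and osc: "osc sum_norm (\<lambda>u. Z u - big_jump_part sum_norm \<epsilon> Z u) P t < ennreal c" and c: "0 < c"
  shows "sum_norm (Z (min s t) - Z r) \<le> c"
proof -
  let ?Y = "\<lambda>u. Z u - big_jump_part sum_norm \<epsilon> Z u"
  let ?m = "min s t"
  have J: "big_jump_part sum_norm \<epsilon> Z w = big_jump_part sum_norm \<epsilon> Z ?m" if "r < w" "w \<le> ?m" for w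
  proof -
    have "{0<..w} \<inter> big_jump_times sum_norm \<epsilon> Z = {0<..?m} \<inter> big_jump_times sum_norm \<epsilon> Z"
    proof (intro set_eqI iffI)
      fix x assume "x \<in> {0<..w} \<inter> big_jump_times sum_norm \<epsilon> Z"
      then show "x \<in> {0<..?m} \<inter> big_jump_times sum_norm \<epsilon> Z" using that by simp
    next
      fix x assume x: "x \<in> {0<..?m} \<inter> big_jump_times sum_norm \<epsilon> Z"
      then have "\<not> (r < x \<and> x \<le> s)" by (intro none) simp
      then show "x \<in> {0<..w} \<inter> big_jump_times sum_norm \<epsilon> Z" using x that by simp
    qed
    then show ?thesis by (simp add: big_jump_part_def)
  qed
  have le: "sum_norm (Z ?m - Z w) \<le> c" if w: "r < w" "w \<le> ?m" for w
  proof -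
    have "ennreal (sum_norm (?Y ?m - ?Y w)) \<le> (SUP v\<in>{r<..s} \<inter> {0..t}. ennreal (sum_norm (?Y ?m - ?Y v)))"
      using w rs by (intro SUP_upper) auto
    also have "\<dots> \<le> (SUP u\<in>{r<..s} \<inter> {0..t}. SUP v\<in>{r<..s} \<inter> {0..t}. ennreal (sum_norm (?Y u - ?Y v)))"
      using w rs by (intro SUP_upper) auto
    also have "\<dots> \<le> osc sum_norm ?Y P t"
      unfolding osc_def by (rule SUP_upper2[OF rs(1)]) simp
    also have "\<dots> \<le> ennreal c" using osc by simp
    finally show ?thesis using J[OF w] c by (simp add: ennreal_le_iff)
  qed
  have "((\<lambda>w. sum_norm (Z ?m - Z w)) \<longlongrightarrow> sum_norm (Z ?m - Z r)) (at_right r)"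
    unfolding sum_norm_def using cadlag_tendsto_right[OF Z rs(2)] by (intro tendsto_intros)
  moreover have "eventually (\<lambda>w. sum_norm (Z ?m - Z w) \<le> c) (at_right r)"
    unfolding eventually_at_right_field using le rs by (intro exI[of _ ?m]) auto
  ultimately show ?thesis by (rule tendsto_upperbound) simp
qed

lemma cadlag_tendsto_from_right:
  assumes X: "cadlag X" and u: "0 \<le> u" and s: "s \<longlonglongrightarrow> u" "\<And>n. u \<le> s n"
  shows "(\<lambda>n. X (s n)) \<longlonglongrightarrow> X u"
proof (rule topological_tendstoI)
  fix S assume S: "open S" "X u \<in> S"
  then have "eventually (\<lambda>w. X w \<in> S) (at_right u)"
    using topological_tendstoD[OF cadlag_tendsto_right[OF X u]] by blast
  then obtain b where b: "u < b" "\<And>w. u < w \<Longrightarrow> w < b \<Longrightarrow> X w \<in> S"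
    unfolding eventually_at_right_field by blast
  have "eventually (\<lambda>n. s n < b) sequentially" using s(1) b(1) by (rule order_tendstoD)
  then show "eventually (\<lambda>n. X (s n) \<in> S) sequentially"
  proof eventually_elim
    case (elim n)
    then show ?case using b(2)[of "s n"] s(2)[of n] S(2) by (cases "s n = u") auto
  qed
qed

lemma min_upper_pt_tendsto:
  assumes P: "\<And>n. is_partition (\<pi> n)" and X: "cadlag X" and u: "0 < u" "u \<le> t"
    and good: "(\<lambda>n. upper_pt (\<pi> n) u) \<longlonglongrightarrow> u"
  shows "(\<lambda>n. X (min (upper_pt (\<pi> n) u) t)) \<longlonglongrightarrow> X u"
proof (rule cadlag_tendsto_from_right[OF X])
  show "(\<lambda>n. min (upper_pt (\<pi> n) u) t) \<longlonglongrightarrow> u"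
    using tendsto_min[OF good tendsto_const[of t]] u by (simp add: min_absorb1)
  show "u \<le> min (upper_pt (\<pi> n) u) t" for n
    using cell_mem(3)[OF P u(1), of n] u by simp
qed (use u in auto)

context ito_function
begin

text \<open>
  For a small threshold \<open>\<epsilon>\<close>, the intervals without a jump of size \<open>\<epsilon>\<close> contribute little by the Taylor
  bound. Each remaining interval is eventually the interval around exactly one of the finitely many
  big jumps, where the remainder converges because the end points straddle the jump in the limit.
\<close>

theorem remainder_sums_converge:
  fixes A :: "real \<Rightarrow> 'f" and X :: "real \<Rightarrow> 'e"
  defines "Z \<equiv> \<lambda>s. (A s, X s)"
  assumes P: "\<And>n. is_partition (\<pi> n)" and A: "cadlag A" and X: "cadlag X"
    and C: "condition_C sum_norm \<pi> Z" and left: "approximates_from_left \<pi> Z" and t: "0 \<le> t"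
    and CA: "\<And>n. partition_sum (\<pi> n) t (\<lambda>r s. norm (A (min s t) - A (min r t))) \<le> CA"
    and CX: "\<And>n. partition_sum (\<pi> n) t (\<lambda>r s. norm (T (X (min s t) - X (min r t)) (X (min s t) - X (min r t)))) \<le> CX"
    and W: "((\<lambda>s. norm (jump A s) + norm (T (jump X s) (jump X s))) has_sum W) {0<..t}"
  shows "(\<lambda>s. remainder (left_lim Z s) (Z s)) summable_on {0<..t}"
    and "(\<lambda>n. partition_sum (\<pi> n) t (\<lambda>r s. remainder (Z (min r t)) (Z (min s t))))
      \<longlonglongrightarrow> (\<Sum>\<^sub>\<infinity>s\<in>{0<..t}. remainder (left_lim Z s) (Z s))"
proof -
  have Z: "cadlag Z" unfolding Z_def by (rule cadlag_Pair[OF A X])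
  have left_Z: "left_lim Z s = (left_lim A s, left_lim X s)" for s
    unfolding Z_def by (rule left_lim_Pair[OF A X])
  let ?r = "\<lambda>s. remainder (left_lim Z s) (Z s)"
  let ?F = "\<lambda>r s. remainder (Z (min r t)) (Z (min s t))"
  let ?incr = "\<lambda>r s. norm (A (min s t) - A (min r t)) + norm (T (X (min s t) - X (min r t)) (X (min s t) - X (min r t)))"
  show "?r summable_on {0<..t}"
  proof -
    obtain \<delta> where \<delta>: "0 < \<delta>" "\<And>s. s \<in> {0..t} \<Longrightarrow> sum_norm (jump (\<lambda>s. (A s, X s)) s) < \<delta> \<Longrightarrow>
      norm (remainder (left_lim A s, left_lim X s) (A s, X s)) \<le> 1 * (norm (jump A s) + norm (T (jump X s) (jump X s)))"
      by (rule remainder_near_jumps[OF A X zero_less_one, of t]) (rule that; assumption)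
    have "(\<lambda>s. remainder (left_lim A s, left_lim X s) (A s, X s)) summable_on {0<..t}"
      by (rule jump_remainder_tail(1)[OF Z[unfolded Z_def] \<delta> W \<delta>(1) order_refl zero_less_one refl])
    then show ?thesis by (simp add: left_Z) (simp add: Z_def)
  qed
  show "(\<lambda>n. partition_sum (\<pi> n) t ?F) \<longlonglongrightarrow> (\<Sum>\<^sub>\<infinity>s\<in>{0<..t}. ?r s)"
  proof (rule tendstoI)
    fix e :: real assume e: "0 < e"
    have nonneg: "0 \<le> CA" "0 \<le> CX" "0 \<le> W"
    proof -
      show "0 \<le> CA" "0 \<le> CX"
        using order_trans[OF _ CA[of 0]] order_trans[OF _ CX[of 0]]
        unfolding partition_sum_def by (simp_all add: sum_nonneg case_prod_unfold)
      show "0 \<le> W" using W by (rule has_sum_nonneg) simp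
    qed
    define D where "D = CA + CX + W + 1"
    define \<eta> where "\<eta> = e / 2 / D"
    have D: "0 < D" using nonneg unfolding D_def by linarith
    have \<eta>: "0 < \<eta>" using e D by (simp add: \<eta>_def)
    have "\<eta> * D = e / 2" using D by (simp add: \<eta>_def)
    then have "\<eta> * (CA + CX) + \<eta> * W + \<eta> = e / 2" by (simp add: D_def algebra_simps)
    then have \<eta>e: "\<eta> * (CA + CX) + \<eta> * W < e / 2" using \<eta> by linarith
    obtain \<delta> where \<delta>: "0 < \<delta>"
      "\<And>u w. u \<in> {0..t} \<Longrightarrow> w \<in> {0..t} \<Longrightarrow> sum_norm ((A w, X w) - (A u, X u)) < \<delta> \<Longrightarrow>
        norm (remainder (A u, X u) (A w, X w)) \<le> \<eta> * (norm (A w - A u) + norm (T (X w - X u) (X w - X u)))"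
      "\<And>s. s \<in> {0..t} \<Longrightarrow> sum_norm (jump (\<lambda>s. (A s, X s)) s) < \<delta> \<Longrightarrow>
        norm (remainder (left_lim A s, left_lim X s) (A s, X s)) \<le> \<eta> * (norm (jump A s) + norm (T (jump X s) (jump X s)))"
      by (rule remainder_near_jumps[OF A X \<eta>, of t]) (rule that; assumption)
    obtain \<epsilon> where \<epsilon>: "0 < \<epsilon>" "\<epsilon> < \<delta>"
      and osc: "limsup (\<lambda>n. osc sum_norm (\<lambda>u. Z u - big_jump_part sum_norm \<epsilon> Z u) (\<pi> n) t) < ennreal (\<delta> / 2)"
    proof -
      have "Limsup (at_right 0) (\<lambda>\<epsilon>. limsup (\<lambda>n. osc sum_norm (\<lambda>u. Z u - big_jump_part sum_norm \<epsilon> Z u) (\<pi> n) t)) < ennreal (\<delta> / 2)"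
        using C t \<delta>(1) unfolding condition_C_def by simp
      from Limsup_lessD[OF this]
      have "eventually (\<lambda>\<epsilon>. limsup (\<lambda>n. osc sum_norm (\<lambda>u. Z u - big_jump_part sum_norm \<epsilon> Z u) (\<pi> n) t) < ennreal (\<delta> / 2)) (at_right 0)" .
      moreover have "eventually (\<lambda>\<epsilon>. \<epsilon> \<in> {0<..<\<delta>}) (at_right (0::real))"
        using eventually_at_right_real[OF \<delta>(1)] .
      ultimately have "eventually (\<lambda>\<epsilon>. limsup (\<lambda>n. osc sum_norm (\<lambda>u. Z u - big_jump_part sum_norm \<epsilon> Z u) (\<pi> n) t) < ennreal (\<delta> / 2)
          \<and> \<epsilon> \<in> {0<..<\<delta>}) (at_right 0)" by (rule eventually_conj)
      from eventually_happens'[OF trivial_limit_at_right_real this] show ?thesis using that by auto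
    qed
    define B where "B = {0<..t} \<inter> big_jump_times sum_norm \<epsilon> Z"
    have B_fin: "finite B" unfolding B_def by (rule finite_big_jumps_sum_norm[OF Z \<epsilon>(1)])
    have tail: "norm ((\<Sum>\<^sub>\<infinity>s\<in>{0<..t}. ?r s) - (\<Sum>s\<in>B. ?r s)) \<le> \<eta> * W"
      using jump_remainder_tail(2)[OF Z[unfolded Z_def] \<delta>(1,3) W \<epsilon>(1) less_imp_le[OF \<epsilon>(2)] \<eta> B_def[unfolded Z_def]]
      unfolding left_Z unfolding Z_def .
    \<comment> \<open>At a time that is not good the path would equal its left limit.\<close>
    have good: "(\<lambda>n. upper_pt (\<pi> n) u) \<longlonglongrightarrow> u" if u: "u \<in> B" for u
    proof (rule ccontr)
      have u0: "0 < u" using u by (simp add: B_def)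
      assume "\<not> (\<lambda>n. upper_pt (\<pi> n) u) \<longlonglongrightarrow> u"
      from path_constant_of_upper_pt_not_convergent[OF P Z left u0 this]
      have "jump Z u = 0" by (auto simp: jump_def)
      then show False using u \<epsilon>(1) by (simp add: B_def big_jump_times_def sum_norm_def)
    qed
    \<comment> \<open>The contribution of the intervals that contain a big jump, indexed by the jump.\<close>
    define big where "big n = (\<Sum>u\<in>B. ?F (lower_pt (\<pi> n) u) (upper_pt (\<pi> n) u))" for n
    have big_lim: "big \<longlonglongrightarrow> (\<Sum>u\<in>B. ?r u)"
      unfolding big_def
    proof (intro tendsto_sum remainder_tendsto)
      fix u assume u: "u \<in> B"
      then have u0: "0 < u" "u \<le> t" by (auto simp: B_def)
      have "min (lower_pt (\<pi> n) u) t = lower_pt (\<pi> n) u" for n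
        using cell_mem(2)[OF P u0(1), of n] u0 by simp
      then show "(\<lambda>n. Z (min (lower_pt (\<pi> n) u) t)) \<longlonglongrightarrow> left_lim Z u"
        using left u0 by (simp add: approximates_from_left_def)
      show "(\<lambda>n. Z (min (upper_pt (\<pi> n) u) t)) \<longlonglongrightarrow> Z u"
        by (rule min_upper_pt_tendsto[OF P Z u0 good[OF u]])
    qed
    have "eventually (\<lambda>n. osc sum_norm (\<lambda>u. Z u - big_jump_part sum_norm \<epsilon> Z u) (\<pi> n) t < ennreal (\<delta> / 2)) sequentially"
      by (rule Limsup_lessD[OF osc])
    moreover have "eventually (\<lambda>n. \<forall>(r, s)\<in>\<pi> n. \<forall>u \<in> {r<..s} \<inter> {0..t} \<inter> big_jump_times sum_norm \<epsilon> Z.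
        \<forall>v \<in> {r<..s} \<inter> {0..t} \<inter> big_jump_times sum_norm \<epsilon> Z. u = v) sequentially"
      using C t \<epsilon>(1) unfolding condition_C_def eventually_sequentially by blast
    moreover have "eventually (\<lambda>n. dist (big n) (\<Sum>u\<in>B. ?r u) < e / 2) sequentially"
      using tendstoD[OF big_lim, of "e / 2"] e by simp
    ultimately show "eventually (\<lambda>n. dist (partition_sum (\<pi> n) t ?F) (\<Sum>\<^sub>\<infinity>s\<in>{0<..t}. ?r s) < e) sequentially"
    proof eventually_elim
      case (elim n)
      define S where "S = {(r, s). (r, s) \<in> \<pi> n \<and> r < t}"
      have S_fin: "finite S" unfolding S_def by (rule finite_partition_cells[OF P])
      have cell_B: "cell (\<pi> n) u \<in> \<pi> n" "lower_pt (\<pi> n) u < u" "u \<le> upper_pt (\<pi> n) u" "0 < u" "u \<le> t"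
        if "u \<in> B" for u
        using that cell_mem[OF P, of u n] by (auto simp: B_def)
      have sub: "cell (\<pi> n) ` B \<subseteq> S"
        using cell_B by (force simp: S_def case_prod_unfold)
      have inj: "inj_on (cell (\<pi> n)) B"
      proof (rule inj_onI)
        fix u v assume uv: "u \<in> B" "v \<in> B" "cell (\<pi> n) u = cell (\<pi> n) v"
        have u: "u \<in> {lower_pt (\<pi> n) u<..upper_pt (\<pi> n) u} \<inter> {0..t} \<inter> big_jump_times sum_norm \<epsilon> Z"
          using cell_B[OF uv(1)] uv(1) by (simp add: B_def)
        have v: "v \<in> {lower_pt (\<pi> n) u<..upper_pt (\<pi> n) u} \<inter> {0..t} \<inter> big_jump_times sum_norm \<epsilon> Z"
          using cell_B[OF uv(2)] uv(2) unfolding uv(3) by (simp add: B_def)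
        note unique = bspec[OF elim(2) cell_B(1)[OF uv(1)], unfolded case_prod_unfold]
        show "u = v" by (rule bspec[OF bspec[OF unique u] v])
      qed
      let ?G = "\<lambda>p. ?F (fst p) (snd p)"
      have sum_S: "partition_sum (\<pi> n) t ?F = (\<Sum>p\<in>S - cell (\<pi> n) ` B. ?G p) + big n"
      proof -
        have "partition_sum (\<pi> n) t ?F = (\<Sum>p\<in>S. ?G p)"
          by (simp add: partition_sum_def S_def case_prod_unfold)
        also have "\<dots> = (\<Sum>p\<in>S - cell (\<pi> n) ` B. ?G p) + (\<Sum>p\<in>cell (\<pi> n) ` B. ?G p)"
          by (rule sum.subset_diff[OF sub S_fin])
        finally show ?thesis by (simp add: sum.reindex[OF inj] big_def)
      qed
      have "norm (\<Sum>p\<in>S - cell (\<pi> n) ` B. ?G p) \<le> (\<Sum>p\<in>S - cell (\<pi> n) ` B. \<eta> * ?incr (fst p) (snd p))"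
      proof (rule sum_norm_le)
        fix p assume p: "p \<in> S - cell (\<pi> n) ` B"
        obtain r s where rs: "p = (r, s)" "(r, s) \<in> \<pi> n" "r < t" using p by (auto simp: S_def)
        have r: "0 \<le> r" "r < s" using partition_cell_order[OF P rs(2)] by auto
        have none: "\<not> (r < u \<and> u \<le> s)" if "u \<in> {0<..t} \<inter> big_jump_times sum_norm \<epsilon> Z" for u
        proof
          assume "r < u \<and> u \<le> s"
          then have "cell (\<pi> n) u = p" using cell_eqI[OF P rs(2), of u] rs(1) by simp
          moreover have "u \<in> B" using that by (simp add: B_def)
          ultimately show False using p by blast
        qed
        have "sum_norm (Z (min s t) - Z r) \<le> \<delta> / 2"
          using increment_le_osc[OF Z rs(2) r rs(3) none elim(1)] \<delta>(1) by simp
        then have "sum_norm ((A (min s t), X (min s t)) - (A (min r t), X (min r t))) < \<delta>"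
          using rs(3) \<delta>(1) by (simp add: Z_def min_absorb1)
        then have "norm (remainder (A (min r t), X (min r t)) (A (min s t), X (min s t))) \<le> \<eta> * ?incr r s"
          using r rs(3) t by (intro \<delta>(2)) auto
        then show "norm (?G p) \<le> \<eta> * ?incr (fst p) (snd p)" by (simp add: rs(1) Z_def)
      qed
      also have "\<dots> \<le> (\<Sum>p\<in>S. \<eta> * ?incr (fst p) (snd p))"
        using \<eta> by (intro sum_mono2 S_fin) auto
      also have "\<dots> = \<eta> * partition_sum (\<pi> n) t ?incr"
        by (simp add: partition_sum_def S_def case_prod_unfold sum_distrib_left)
      also have "partition_sum (\<pi> n) t ?incr \<le> CA + CX"
        unfolding partition_sum_add by (intro add_mono CA CX)
      finally have small: "norm (\<Sum>p\<in>S - cell (\<pi> n) ` B. ?G p) \<le> \<eta> * (CA + CX)"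
        using \<eta> by simp
      have eq: "partition_sum (\<pi> n) t ?F - (\<Sum>\<^sub>\<infinity>s\<in>{0<..t}. ?r s) = (\<Sum>p\<in>S - cell (\<pi> n) ` B. ?G p)
          + (big n - (\<Sum>u\<in>B. ?r u)) - ((\<Sum>\<^sub>\<infinity>s\<in>{0<..t}. ?r s) - (\<Sum>s\<in>B. ?r s))"
        by (simp add: sum_S)
      have add: "norm (x + y - z) < e" if "norm x \<le> p" "norm y < e / 2" "norm z \<le> q" "p + q < e / 2"
        for x y z :: 'g and p q :: real
        using that norm_triangle_ineq4[of "x + y" z] norm_triangle_ineq[of x y] by linarith
      show ?case
        unfolding dist_norm eq by (rule add[OF small elim(3)[unfolded dist_norm] tail \<eta>e])
    qed
  qed
qed

end


section \<open>The Ito formula\<close>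

lemma bounded_bilinear_embedded_tensor:
  assumes \<alpha>: "reasonable_crossnorm \<alpha>" and \<iota>: "is_completion \<alpha> \<iota>"
  shows "bounded_bilinear (\<lambda>u v. \<iota> (u \<otimes> v))"
    and "norm (\<iota> (u \<otimes> v)) \<le> norm u * norm v"
proof -
  have lin: "linear \<iota>" using \<iota> by (simp add: is_completion_def)
  have bound: "norm (\<iota> (u \<otimes> v)) \<le> norm u * norm v" for u v
    using \<alpha> \<iota> by (simp add: is_completion_def reasonable_crossnorm_def)
  then show "norm (\<iota> (u \<otimes> v)) \<le> norm u * norm v" .
  show "bounded_bilinear (\<lambda>u v. \<iota> (u \<otimes> v))"
    by (rule bounded_bilinear.intro)
       (use bound in \<open>auto simp: bilinear_ladd[OF bilinear_tensor_of] bilinear_radd[OF bilinear_tensor_of]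
          bilinear_lmul[OF bilinear_tensor_of] bilinear_rmul[OF bilinear_tensor_of]
          linear_add[OF lin] linear_scale[OF lin] intro!: exI[of _ 1]\<close>)
qed

text \<open>The increments from \<open>a\<close> on telescope to \<open>A t - A a\<close>, up to the increment of \<open>A\<close> from \<open>a\<close> to the end
  of the interval that straddles \<open>a\<close>. At a good time it vanishes in the limit by right continuity.\<close>

lemma finite_variation_left_point_sums:
  fixes Z :: "real \<Rightarrow> 'z::banach" and A :: "real \<Rightarrow> 'h::banach"
    and \<Phi> :: "'z \<Rightarrow> 'h \<Rightarrow>\<^sub>L 'g::real_normed_vector"
  assumes P: "\<And>n. is_partition (\<pi> n)" and Z: "cadlag Z" and left: "approximates_from_left \<pi> Z"
    and \<Phi>: "continuous_map euclidean Lc_topology \<Phi>" and t: "0 \<le> t"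
    and A: "cadlag A" and v: "dominates_increments v A"
    and I: "(step_integral A t \<longlongrightarrow> I) (step_approx (\<lambda>s. \<Phi> (left_lim Z s)))"
  shows "(\<lambda>n. partition_sum (\<pi> n) t (\<lambda>r s. blinfun_apply (\<Phi> (Z r)) (A (min s t) - A (min r t)))) \<longlonglongrightarrow> I"
proof -
  obtain K where K: "compact K" "\<And>u v. u \<in> {0..t} \<Longrightarrow> v \<in> {0..t} \<Longrightarrow> A u - A v \<in> K"
    using cadlag_compact_increments[OF A, of t] by metis
  have "limitin (mode_topology Strong)
    (\<lambda>n. partition_sum (\<pi> n) t (\<lambda>r s. blinfun_apply (\<Phi> (Z r)) (A (min s t) - A (min r t)))) I sequentially"
  proof (rule left_point_sums_converge[OF P Z left \<Phi> t K(1) _ _ v K(2) _ _ I])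
    fix n r s assume "(r, s) \<in> \<pi> n" "r < t"
    then show "A (min s t) - A (min r t) \<in> K"
      using partition_cell_order[OF P, of r s n] t by (intro K(2)) auto
  next
    show "partition_sum (\<pi> n) t (\<lambda>r s. norm (A (min s t) - A (min r t))) \<le> v t - v 0" for n
      by (rule partition_sum_increments_le[OF P t v])
  next
    show "limitin (mode_topology Strong) (\<lambda>n. partition_sum (\<pi> n) t (\<lambda>r s. A (min s t) - A (min r t))) (A t - A 0) sequentially"
      unfolding partition_sum_telescope[OF P t] by (intro mode_limit_of_tendsto tendsto_const)
  next
    fix a assume a: "0 < a" "a < t" "(\<lambda>n. upper_pt (\<pi> n) a) \<longlonglongrightarrow> a"
    have "partition_sum (\<pi> n) t (\<lambda>r s. if a \<le> r then A (min s t) - A (min r t) else 0)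
        = A t - A (min (upper_pt (\<pi> n) a) t)" for n
      using partition_sum_from[OF P a(1,2), of n "\<lambda>x y. A y - A x"]
        partition_sum_telescope[OF P t, of n A] partition_sum_telescope[OF P less_imp_le[OF a(1)], of n A]
      by (simp add: algebra_simps)
    moreover have "(\<lambda>n. A t - A (min (upper_pt (\<pi> n) a) t)) \<longlonglongrightarrow> A t - A a"
      using a by (intro tendsto_intros min_upper_pt_tendsto[OF P A]) auto
    ultimately show "limitin (mode_topology Strong)
        (\<lambda>n. partition_sum (\<pi> n) t (\<lambda>r s. if a \<le> r then A (min s t) - A (min r t) else 0)) (A t - A a) sequentially"
      by (simp add: mode_limit_of_tendsto)
  qed
  then show ?thesis by simp
qed

text \<open>
  Convergence of the sums is known for fixed end times only, so sums over a block are differences of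
  these. The correction at a good time \<open>a\<close> compares the squares of the increments over the straddling
  interval up to its end and up to \<open>a\<close>; both tend to the square of the jump at \<open>a\<close>.
\<close>

lemma quadratic_left_point_sums:
  fixes Z :: "real \<Rightarrow> 'z::banach" and X :: "real \<Rightarrow> 'e::banach" and Q :: "real \<Rightarrow> 'h::banach"
    and \<Phi> :: "'z \<Rightarrow> 'h \<Rightarrow>\<^sub>L 'g::real_normed_vector"
  assumes P: "\<And>n. is_partition (\<pi> n)" and Z: "cadlag Z" and left: "approximates_from_left \<pi> Z"
    and \<Phi>: "continuous_map euclidean Lc_topology \<Phi>" and t: "0 \<le> t"
    and T: "bounded_bilinear T" and X: "cadlag X" and left_X: "approximates_from_left \<pi> X"
    and Q: "cadlag Q" and v: "dominates_increments v Q"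
    and QV: "\<And>t. 0 \<le> t \<Longrightarrow> limitin (mode_topology m)
      (\<lambda>n. partition_sum (\<pi> n) t (\<lambda>r s. T (X (min s t) - X (min r t)) (X (min s t) - X (min r t)))) (Q t) sequentially"
    and C: "\<And>n. partition_sum (\<pi> n) t (\<lambda>r s. norm (T (X (min s t) - X (min r t)) (X (min s t) - X (min r t)))) \<le> C"
    and I: "(step_integral Q t \<longlongrightarrow> I) (step_approx (\<lambda>s. \<Phi> (left_lim Z s)))"
  shows "limitin (mode_topology m) (\<lambda>n. partition_sum (\<pi> n) t
    (\<lambda>r s. blinfun_apply (\<Phi> (Z r)) (T (X (min s t) - X (min r t)) (X (min s t) - X (min r t))))) I sequentially"
proof -
  obtain KQ where KQ: "compact KQ" "\<And>u v. u \<in> {0..t} \<Longrightarrow> v \<in> {0..t} \<Longrightarrow> Q u - Q v \<in> KQ"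
    using cadlag_compact_increments[OF Q, of t] by metis
  obtain KX where KX: "compact KX" "\<And>u v. u \<in> {0..t} \<Longrightarrow> v \<in> {0..t} \<Longrightarrow> X u - X v \<in> KX"
    using cadlag_compact_increments[OF X, of t] by metis
  define K where "K = KQ \<union> (\<lambda>k. T k k) ` KX"
  have K: "compact K"
    unfolding K_def
    by (intro compact_Un KQ compact_continuous_image KX bounded_bilinear.continuous_on[OF T] continuous_on_id)
  have Q_K: "Q u - Q w \<in> K" if "u \<in> {0..t}" "w \<in> {0..t}" for u w
    using KQ(2)[OF that] by (simp add: K_def)
  \<comment> \<open>The sum up to time \<open>0\<close> is empty. Subtracting it turns the limits at \<open>t\<close> and at \<open>0\<close> into the limit
      \<open>Q t - Q 0\<close>, in either topology.\<close>
  define H where "H x y = T (X y - X x) (X y - X x)" for x y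
  have zero: "partition_sum (\<pi> n) 0 (\<lambda>r s. H (min r 0) (min s 0)) = 0" for n
    unfolding partition_sum_def using partition_cell_order(1)[OF P] by (intro sum.neutral) fastforce
  show ?thesis
  proof (rule left_point_sums_converge[OF P Z left \<Phi> t K _ C v Q_K _ _ I])
    fix n r s assume "(r, s) \<in> \<pi> n" "r < t"
    then have "X (min s t) - X (min r t) \<in> KX"
      using partition_cell_order[OF P, of r s n] t by (intro KX(2)) auto
    then show "T (X (min s t) - X (min r t)) (X (min s t) - X (min r t)) \<in> K" by (simp add: K_def)
  next
    have "limitin (mode_topology m) (\<lambda>n. partition_sum (\<pi> n) t (\<lambda>r s. H (min r t) (min s t))
        - partition_sum (\<pi> n) 0 (\<lambda>r s. H (min r 0) (min s 0))) (Q t - Q 0) sequentially"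
      unfolding H_def using t by (intro mode_limit_diff QV) auto
    then show "limitin (mode_topology m)
      (\<lambda>n. partition_sum (\<pi> n) t (\<lambda>r s. T (X (min s t) - X (min r t)) (X (min s t) - X (min r t)))) (Q t - Q 0) sequentially"
      unfolding zero by (simp add: H_def)
  next
    fix a assume a: "0 < a" "a < t" "(\<lambda>n. upper_pt (\<pi> n) a) \<longlonglongrightarrow> a"
    have X_left: "(\<lambda>n. X (lower_pt (\<pi> n) a)) \<longlonglongrightarrow> left_lim X a"
      using left_X a by (simp add: approximates_from_left_def)
    have X_upper: "(\<lambda>n. X (min (upper_pt (\<pi> n) a) t)) \<longlonglongrightarrow> X a"
      using a by (intro min_upper_pt_tendsto[OF P X]) auto
    have "(\<lambda>n. H (lower_pt (\<pi> n) a) (min (upper_pt (\<pi> n) a) t) - H (lower_pt (\<pi> n) a) a)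
        \<longlonglongrightarrow> T (X a - left_lim X a) (X a - left_lim X a) - T (X a - left_lim X a) (X a - left_lim X a)"
      unfolding H_def
      by (intro tendsto_diff bounded_bilinear.tendsto[OF T] X_left X_upper tendsto_const)
    then have "limitin (mode_topology m) (\<lambda>n. H (lower_pt (\<pi> n) a) (min (upper_pt (\<pi> n) a) t) - H (lower_pt (\<pi> n) a) a) 0 sequentially"
      by (intro mode_limit_of_tendsto) simp
    then have "limitin (mode_topology m) (\<lambda>n. partition_sum (\<pi> n) t (\<lambda>r s. H (min r t) (min s t))
        - partition_sum (\<pi> n) a (\<lambda>r s. H (min r a) (min s a))
        - (H (lower_pt (\<pi> n) a) (min (upper_pt (\<pi> n) a) t) - H (lower_pt (\<pi> n) a) a)) (Q t - Q a - 0) sequentially"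
      using t a QV[OF t] QV[of a] unfolding H_def by (intro mode_limit_diff) auto
    then have "limitin (mode_topology m)
        (\<lambda>n. partition_sum (\<pi> n) t (\<lambda>r s. if a \<le> r then H (min r t) (min s t) else 0)) (Q t - Q a - 0) sequentially"
      unfolding partition_sum_from[OF P a(1,2)] .
    then show "limitin (mode_topology m) (\<lambda>n. partition_sum (\<pi> n) t (\<lambda>r s. if a \<le> r
        then T (X (min s t) - X (min r t)) (X (min s t) - X (min r t)) else 0)) (Q t - Q a) sequentially"
      unfolding H_def by simp
  qed
qed

theorem corollary3p7:
  fixes \<alpha> :: "('e::banach, 'e) tensor \<Rightarrow> real"
    and \<iota> :: "('e, 'e) tensor \<Rightarrow> 'h::banach"
    and \<pi> :: "nat \<Rightarrow> (real \<times> real) set"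
    and X :: "real \<Rightarrow> 'e" and A :: "real \<Rightarrow> 'f::banach" and Q :: "real \<Rightarrow> 'h"
    and m :: mode
    and f :: "'f \<times> 'e \<Rightarrow> 'g::banach"
    and Da :: "'f \<times> 'e \<Rightarrow> 'f \<Rightarrow>\<^sub>L 'g"
    and Dx :: "'f \<times> 'e \<Rightarrow> 'e \<Rightarrow>\<^sub>L 'g"
    and Dxx :: "'f \<times> 'e \<Rightarrow> 'e \<Rightarrow>\<^sub>L 'e \<Rightarrow>\<^sub>L 'g"
    and D2 :: "'f \<times> 'e \<Rightarrow> 'h \<Rightarrow>\<^sub>L 'g"
    and t :: real
  assumes crossnorm: "reasonable_crossnorm \<alpha>"
    and completion: "is_completion \<alpha> \<iota>"
    and partitions: "\<And>n. is_partition (\<pi> n)"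
    and X: "cadlag X"
    and QV: "tensor_quadratic_variation m \<iota> \<pi> X Q"
    and two_var: "finite_2_variation \<pi> X"
    and A: "cadlag A" "finite_variation A"
    and C: "condition_C sum_norm \<pi> (\<lambda>t. (A t, X t))"
    and left: "approximates_from_left \<pi> (\<lambda>t. (A t, X t))"
    and Da: "\<And>a x. has_gateaux_derivative (\<lambda>a. f (a, x)) (Da (a, x)) a"
    and Da_cont: "continuous_map euclidean Lc_topology Da"
    and Dx: "\<And>a x. has_gateaux_derivative (\<lambda>x. f (a, x)) (Dx (a, x)) x"
    and Dxx: "\<And>a x. has_gateaux_derivative (\<lambda>x. Dx (a, x)) (Dxx (a, x)) x"
    and Dx_cont: "continuous_map euclidean Lc_topology Dx"
    and D2: "\<And>a x u v. D2 (a, x) (\<iota> (u \<otimes> v)) = Dxx (a, x) u v"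
    and D2_cont: "continuous_map euclidean Lc_topology D2"
    and t: "0 \<le> t"
  shows "\<exists>I\<^sub>A I\<^sub>X I\<^sub>Q S.
      limitin (mode_topology m)
        (\<lambda>n. partition_sum (\<pi> n) t (\<lambda>r s. Dx (A r, X r) (X (min s t) - X (min r t))))
        I\<^sub>X sequentially
    \<and> has_stieltjes_integral (\<lambda>s. Da (left_lim A s, left_lim X s)) (cont_part A) t I\<^sub>A
    \<and> has_stieltjes_integral (\<lambda>s. D2 (left_lim A s, left_lim X s)) (cont_part Q) t I\<^sub>Q
    \<and> ((\<lambda>s. (f (A s, X s) - f (left_lim A s, left_lim X s))
             - Dx (left_lim A s, left_lim X s) (jump X s)) has_sum S) {0<..t}
    \<and> f (A t, X t) - f (A 0, X 0) = I\<^sub>A + I\<^sub>X + (1/2) *\<^sub>R I\<^sub>Q + S"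

proof -
  define T where "T u v = \<iota> (u \<otimes> v)" for u v
  have T: "bounded_bilinear T" and T_norm: "norm (T u v) \<le> norm u * norm v" for u v
    using bounded_bilinear_embedded_tensor[OF crossnorm completion] by (simp_all add: T_def[abs_def])
  have D2_T: "blinfun_apply (D2 (a, x)) (T u v) = blinfun_apply (blinfun_apply (Dxx (a, x)) u) v" for a x u v
    unfolding T_def by (rule D2)
  interpret ito_function f Da Dx Dxx D2 T
    by (rule ito_function.intro[OF T Da Da_cont Dx Dxx Dx_cont D2_T D2_cont])
  define Z where "Z s = (A s, X s)" for s
  have Z_abs: "Z = (\<lambda>s. (A s, X s))" by (rule ext) (simp add: Z_def)
  have Z: "cadlag Z" unfolding Z_abs by (rule cadlag_Pair[OF A(1) X])
  have left_Z: "left_lim Z s = (left_lim A s, left_lim X s)" for s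
    unfolding Z_abs by (rule left_lim_Pair[OF A(1) X])
  have left': "approximates_from_left \<pi> Z" using left by (simp add: Z_abs)
  have left_X: "approximates_from_left \<pi> X"
    unfolding approximates_from_left_def
  proof (intro allI impI)
    fix u :: real assume "0 < u"
    then have "(\<lambda>n. Z (lower_pt (\<pi> n) u)) \<longlonglongrightarrow> left_lim Z u"
      using left' by (simp add: approximates_from_left_def)
    from tendsto_snd[OF this] show "(\<lambda>n. X (lower_pt (\<pi> n) u)) \<longlonglongrightarrow> left_lim X u"
      by (simp add: left_Z) (simp add: Z_def)
  qed
  have Q: "cadlag Q" "finite_variation Q"
    and Q_lim: "\<And>t. 0 \<le> t \<Longrightarrow> limitin (mode_topology m)
      (\<lambda>n. partition_sum (\<pi> n) t (\<lambda>r s. T (X (min s t) - X (min r t)) (X (min s t) - X (min r t)))) (Q t) sequentially"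
    and Q_jump: "\<And>t. 0 \<le> t \<Longrightarrow> jump Q t = T (jump X t) (jump X t)"
    using QV by (simp_all add: tensor_quadratic_variation_def T_def)
  obtain vA where vA: "dominates_increments vA A" using finite_variation_dominated[OF A(2)] .
  obtain vQ where vQ: "dominates_increments vQ Q" using finite_variation_dominated[OF Q(2)] .
  obtain CX where CX: "\<And>n. partition_sum (\<pi> n) t (\<lambda>r s. norm (T (X (min s t) - X (min r t)) (X (min s t) - X (min r t)))) \<le> CX"
  proof -
    obtain C where C: "\<And>n. partition_sum (\<pi> n) t (\<lambda>r s. (norm (X (min s t) - X (min r t)))\<^sup>2) \<le> C"
      using two_var t unfolding finite_2_variation_def bdd_above_def by blast
    have "partition_sum (\<pi> n) t (\<lambda>r s. norm (T (X (min s t) - X (min r t)) (X (min s t) - X (min r t)))) \<le> C" for n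
      by (rule order_trans[OF partition_sum_mono C]) (simp add: power2_eq_square T_norm)
    then show ?thesis using that by blast
  qed
  have Da_nb: "step_approx (\<lambda>s. Da (left_lim Z s)) \<noteq> bot"
    by (rule step_approx_left_lim_neq_bot[OF Z Da_cont])
  have D2_nb: "step_approx (\<lambda>s. D2 (left_lim Z s)) \<noteq> bot"
    by (rule step_approx_left_lim_neq_bot[OF Z D2_cont])
  obtain IA where IA: "(step_integral A t \<longlongrightarrow> IA) (step_approx (\<lambda>s. Da (left_lim Z s)))"
    using stieltjes_limit_exists[OF Da_nb A t] .
  obtain IQ where IQ: "(step_integral Q t \<longlongrightarrow> IQ) (step_approx (\<lambda>s. D2 (left_lim Z s)))"
    using stieltjes_limit_exists[OF D2_nb Q t] .
  define JA where "JA = (\<Sum>\<^sub>\<infinity>s\<in>{0<..t}. blinfun_apply (Da (left_lim Z s)) (jump A s))"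
  define JQ where "JQ = (\<Sum>\<^sub>\<infinity>s\<in>{0<..t}. blinfun_apply (D2 (left_lim Z s)) (jump Q s))"
  define R where "R = (\<Sum>\<^sub>\<infinity>s\<in>{0<..t}. remainder (left_lim Z s) (Z s))"
  have JA: "((\<lambda>s. blinfun_apply (Da (left_lim Z s)) (jump A s)) has_sum JA) {0<..t}"
    unfolding JA_def by (intro has_sum_infsum stieltjes_limit_cont_part(1)[OF Da_nb A t IA])
  have JQ: "((\<lambda>s. blinfun_apply (D2 (left_lim Z s)) (jump Q s)) has_sum JQ) {0<..t}"
    unfolding JQ_def by (intro has_sum_infsum stieltjes_limit_cont_part(1)[OF D2_nb Q t IQ])
  have W: "((\<lambda>s. norm (jump A s) + norm (T (jump X s) (jump X s))) has_sum
      ((\<Sum>\<^sub>\<infinity>s\<in>{0<..t}. norm (jump A s)) + (\<Sum>\<^sub>\<infinity>s\<in>{0<..t}. norm (jump Q s)))) {0<..t}"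
  proof -
    have "((\<lambda>s. norm (jump A s) + norm (jump Q s)) has_sum
      ((\<Sum>\<^sub>\<infinity>s\<in>{0<..t}. norm (jump A s)) + (\<Sum>\<^sub>\<infinity>s\<in>{0<..t}. norm (jump Q s)))) {0<..t}"
      by (intro has_sum_add has_sum_infsum jump_abs_summable A Q)
    then show ?thesis by (rule has_sum_cong[THEN iffD1, rotated]) (simp add: Q_jump)
  qed
  have rem: "(\<lambda>s. remainder (left_lim Z s) (Z s)) summable_on {0<..t}"
    "(\<lambda>n. partition_sum (\<pi> n) t (\<lambda>r s. remainder (Z (min r t)) (Z (min s t))))
      \<longlonglongrightarrow> (\<Sum>\<^sub>\<infinity>s\<in>{0<..t}. remainder (left_lim Z s) (Z s))"
    unfolding Z_abs
    by (rule remainder_sums_converge[OF partitions A(1) X C left t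
          partition_sum_increments_le[OF partitions t vA] CX W])+
  have R: "((\<lambda>s. remainder (left_lim Z s) (Z s)) has_sum R) {0<..t}"
    unfolding R_def by (rule has_sum_infsum[OF rem(1)])
  have A_lim: "limitin (mode_topology m)
      (\<lambda>n. partition_sum (\<pi> n) t (\<lambda>r s. blinfun_apply (Da (Z r)) (A (min s t) - A (min r t)))) IA sequentially"
    by (rule mode_limit_of_tendsto[OF finite_variation_left_point_sums[OF partitions Z left' Da_cont t A(1) vA IA]])
  have QX_lim: "limitin (mode_topology m) (\<lambda>n. partition_sum (\<pi> n) t
      (\<lambda>r s. blinfun_apply (D2 (Z r)) (T (X (min s t) - X (min r t)) (X (min s t) - X (min r t))))) IQ sequentially"
    by (rule quadratic_left_point_sums[OF partitions Z left' D2_cont t T X left_X Q(1) vQ Q_lim CX IQ])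
  have sum_eq: "partition_sum (\<pi> n) t (\<lambda>r s. blinfun_apply (Dx (A r, X r)) (X (min s t) - X (min r t)))
      = (f (Z t) - f (Z 0))
        - partition_sum (\<pi> n) t (\<lambda>r s. blinfun_apply (Da (Z r)) (A (min s t) - A (min r t)))
        - (1/2) *\<^sub>R partition_sum (\<pi> n) t (\<lambda>r s. blinfun_apply (D2 (Z r)) (T (X (min s t) - X (min r t)) (X (min s t) - X (min r t))))
        - partition_sum (\<pi> n) t (\<lambda>r s. remainder (Z (min r t)) (Z (min s t)))" for n
  proof -
    have "partition_sum (\<pi> n) t (\<lambda>r s. blinfun_apply (Dx (A r, X r)) (X (min s t) - X (min r t)))
      = partition_sum (\<pi> n) t (\<lambda>r s. (f (Z (min s t)) - f (Z (min r t)))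
        - blinfun_apply (Da (Z r)) (A (min s t) - A (min r t))
        - (1/2) *\<^sub>R blinfun_apply (D2 (Z r)) (T (X (min s t) - X (min r t)) (X (min s t) - X (min r t)))
        - remainder (Z (min r t)) (Z (min s t)))"
      by (rule partition_sum_cong) (simp add: remainder_def Z_def min_absorb1)
    then show ?thesis
      unfolding partition_sum_diff partition_sum_scaleR
      using partition_sum_telescope[OF partitions t, of n "\<lambda>u. f (Z u)"] unfolding partition_sum_diff by simp
  qed
  \<comment> \<open>The value that the formula dictates; it is the limit because all other terms of the expansion converge.\<close>
  define IX where "IX = (f (Z t) - f (Z 0)) - IA - (1/2) *\<^sub>R IQ - R"
  have X_lim: "limitin (mode_topology m)
      (\<lambda>n. partition_sum (\<pi> n) t (\<lambda>r s. blinfun_apply (Dx (A r, X r)) (X (min s t) - X (min r t)))) IX sequentially"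
    unfolding sum_eq IX_def R_def
    by (intro mode_limit_diff mode_limit_scaleR A_lim QX_lim mode_limit_of_tendsto[OF rem(2)]
        mode_limit_of_tendsto[OF tendsto_const])
  have Da_int: "has_stieltjes_integral (\<lambda>s. Da (left_lim A s, left_lim X s)) (cont_part A) t (IA - JA)"
    unfolding left_Z[symmetric] has_stieltjes_integral_def JA_def
    using caglad_Lc_left_lim[OF Z Da_cont] Da_nb stieltjes_limit_cont_part(2)[OF Da_nb A t IA] by blast
  have D2_int: "has_stieltjes_integral (\<lambda>s. D2 (left_lim A s, left_lim X s)) (cont_part Q) t (IQ - JQ)"
    unfolding left_Z[symmetric] has_stieltjes_integral_def JQ_def
    using caglad_Lc_left_lim[OF Z D2_cont] D2_nb stieltjes_limit_cont_part(2)[OF D2_nb Q t IQ] by blast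
  have S: "((\<lambda>s. (f (A s, X s) - f (left_lim A s, left_lim X s))
      - blinfun_apply (Dx (left_lim A s, left_lim X s)) (jump X s)) has_sum (R + JA + (1/2) *\<^sub>R JQ)) {0<..t}"
  proof -
    have "((\<lambda>s. remainder (left_lim Z s) (Z s) + blinfun_apply (Da (left_lim Z s)) (jump A s)
        + (1/2) *\<^sub>R blinfun_apply (D2 (left_lim Z s)) (jump Q s)) has_sum (R + JA + (1/2) *\<^sub>R JQ)) {0<..t}"
      by (intro has_sum_add R JA has_sum_scaleR JQ)
    then show ?thesis
      by (rule has_sum_cong[THEN iffD1, rotated])
         (simp add: remainder_def left_Z Q_jump, simp add: Z_def jump_def)
  qed
  have "f (A t, X t) - f (A 0, X 0) = (IA - JA) + IX + (1/2) *\<^sub>R (IQ - JQ) + (R + JA + (1/2) *\<^sub>R JQ)"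
    by (simp add: IX_def Z_def scaleR_diff_right)
  with X_lim Da_int D2_int S show ?thesis by blast
qed

end
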